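(* Let $\mathcal{K}$ be a 2-category, $T$ a 2-monad on $\mathcal{K}$, and $\Omega$ a family of 2-cells of $\mathcal{K}$ closed under horizontal and vertical composition and containing all identity 2-cells. Let $(\mathcal{A},\Sigma)$ be a PIE indexing pair and let $\overline{F}:\mathcal{A}\to T\text{-}Alg_\omega^\Omega$ be a 2-functor; write $F=U_\omega^\Omega\overline{F}:\mathcal{A}\to\mathcal{K}$ and $\overline{F}(f)=(F(f),\overline{F(f)})$ for each arrow $f$ of $\mathcal{A}$. Assume that $\overline{F(f_A)}$ is an invertible 2-cell for each $A\in\mathcal{A}$. If the $\sigma$-s-oplimit of $F$ (with respect to $\Sigma$) exists in $\mathcal{K}$ and is $\Omega$-compatible, then the $\sigma$-s-oplimit of $\overline{F}$ (with respect to $\Sigma$) exists in $T\text{-}Alg_\omega^\Omega$ and is preserved by $U_\omega^\Omega$; in other words, the forgetful 2-functor $U_\omega^\Omega$ creates this type of $\sigma$-s-oplimits. The projections $\{\pi_{A_0}\}_{A_0\in\mathcal{A}_0}$ of this (lifted) limit are strict, and they jointly detect $\Omega'$-ness for any family $\Omega'$ of 2-cells of $\mathcal{K}$ (closed under horizontal and vertical composition and containing all identity 2-cells) such that the $\sigma$-s-oplimit of $F$ is also $\Omega'$-compatible.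
   Context: **Indexing pairs.** An indexing pair $(\mathcal{A},\Sigma)$ is a 2-category $\mathcal{A}$ with a family $\Sigma$ of its arrows, closed under composition and containing all identities. It is PIE if, in the 1-subcategory of $\mathcal{A}$ given by all objects of $\mathcal{A}$ and the arrows of $\Sigma$, each connected component has an initial object. For $(\mathcal{A},\Sigma)$ PIE, $\mathcal{A}_0$ denotes the family of these initial objects (one for each connected component), and for $A\in\mathcal{A}$, $f_A:A_0\to A$ denotes the unique arrow in $\Sigma$ to $A$ from the initial object $A_0\in\mathcal{A}_0$ of its connected component. **Op-lax cones.** Let $F:\mathcal{A}\to\mathcal{B}$ be a 2-functor and $E\in\mathcal{B}$. An op-lax cone for $F$ with vertex $E$ consists of arrows $\theta_A:E\to FA$ ($A\in\mathcal{A}$) and 2-cells $\theta_f:\theta_B\Rightarrow Ff\,\theta_A$ (for each $f:A\to B$) such that: $\theta_{id_A}=id_{\theta_A}$; $\theta_{gf}=Fg\,\theta_f\circ\theta_g$ for $A\xrightarrow{f}B\xrightarrow{g}C$; and $\theta_g=F\gamma\,\theta_A\circ\theta_f$ for each 2-cell $\gamma:f\Rightarrow g:A\to B$. A morphism $\alpha:\theta\to\theta'$ is a family of 2-cells $\alpha_A:\theta_A\Rightarrow\theta'_A$ with $Ff\,\alpha_A\circ\theta_f=\theta'_f\circ\alpha_B$ for all $f:A\to B$. A $\sigma$-s-opcone (with respect to $\Sigma$) is an op-lax cone with $\theta_f$ an identity 2-cell for every $f\in\Sigma$; these form a full subcategory of the category of op-lax cones. **$\sigma$-s-oplimits.** The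 $\sigma$-s-oplimit of $F$ (with respect to $\Sigma$) is a universal $\sigma$-s-opcone $\pi$ with vertex $L$: for each $E\in\mathcal{B}$, composition with $\pi$ is an isomorphism of categories from $\mathcal{B}(E,L)$ to the category of $\sigma$-s-opcones for $F$ with vertex $E$. The arrows $\pi_A$ are the projections. For a family $\Omega$ of 2-cells of $\mathcal{B}$, the limit is $\Omega$-compatible if, for any morphism $\alpha:\theta\to\theta'$ of $\sigma$-s-opcones and the corresponding 2-cell $\beta:\phi\Rightarrow\phi':E\to L$ (so $\pi_A\beta=\alpha_A$), whenever $\alpha_A\in\Omega$ for all $A\in\mathcal{A}$, also $\beta\in\Omega$. **Weak algebra morphisms.** $T\text{-}Alg_\omega^\Omega$ has as objects the strict $T$-algebras $(A,a:TA\to A)$. An arrow ($\omega$-morphism with respect to $\Omega$) $(A,a)\to(B,b)$ is a pair $(f,\overline{f})$ with $f:A\to B$ in $\mathcal{K}$ and $\overline{f}:b\,Tf\Rightarrow f\,a$ a 2-cell in $\Omega$, subject to the usual coherence conditions: with $i,m$ the unit and multiplication of $T$, $\overline{f}\,i_A=id_f$ and $\overline{f}\,m_A=(\overline{f}\,Ta)\circ(b\,T\overline{f})$. Composition is given by $\overline{gf}=(g\,\overline{f})\circ(\overline{g}\,Tf)$. A 2-cell $(f,\overline{f})\Rightarrow(g,\overline{g})$ is any 2-cell $\alpha:f\Rightarrow g$ of $\mathcal{K}$ with $(\alpha\,a)\circ\overline{f}=\overline{g}\circ(b\,T\alpha)$. $U_\omega^\Omega:T\text{-}Alg_\omega^\Omega\to\mathcal{K}$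 is the forgetful 2-functor. A morphism $(f,\overline{f})$ is strict if $\overline{f}$ is an identity. **Detection.** A family of morphisms $p_i:L\to A_i$ in $T\text{-}Alg_\omega^\Omega$ jointly detects $\Omega'$-ness if, for any morphism $z:Z\to L$ in $T\text{-}Alg_\omega^\Omega$, whenever all composites $p_iz$ are $\omega$-morphisms with respect to $\Omega'$ (i.e. have structural 2-cell in $\Omega'$), so is $z$. Since limits in $T\text{-}Alg_\omega^\Omega$ are determined only up to isomorphism there, the assertions about the projections mean that the limit cone of $F$ in $\mathcal{K}$ lifts to a limit cone of $\overline{F}$ in $T\text{-}Alg_\omega^\Omega$ with those properties. *)

theory Defs
  imports Main "HOL-Library.FuncSet"
begin

section \<open>Categories\<close>

record ('o, 'm) cat1 =
  Ob :: "'o set"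
  Mor :: "'m set"
  sce :: "'m \<Rightarrow> 'o"
  tgt :: "'m \<Rightarrow> 'o"
  one :: "'o \<Rightarrow> 'm"
  cmp1 :: "'m \<Rightarrow> 'm \<Rightarrow> 'm"   \<comment> \<open>\<open>cmp1 C g f\<close> is \<open>g\<close> after \<open>f\<close>\<close>

definition Hom1 :: "('o, 'm) cat1 \<Rightarrow> 'o \<Rightarrow> 'o \<Rightarrow> 'm set" where
  "Hom1 C X Y = {f \<in> Mor C. sce C f = X \<and> tgt C f = Y}"

locale category =
  fixes C :: "('o, 'm) cat1"
  assumes sce_Ob: "f \<in> Mor C \<Longrightarrow> sce C f \<in> Ob C"
    and tgt_Ob: "f \<in> Mor C \<Longrightarrow> tgt C f \<in> Ob C"
    and one_Hom: "X \<in> Ob C \<Longrightarrow> one C X \<in> Hom1 C X X"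
    and cmp1_Hom: "\<lbrakk>f \<in> Hom1 C X Y; g \<in> Hom1 C Y Z\<rbrakk> \<Longrightarrow> cmp1 C g f \<in> Hom1 C X Z"
    and cmp1_one_right: "f \<in> Hom1 C X Y \<Longrightarrow> cmp1 C f (one C X) = f"
    and cmp1_one_left: "f \<in> Hom1 C X Y \<Longrightarrow> cmp1 C (one C Y) f = f"
    and cmp1_assoc: "\<lbrakk>f \<in> Hom1 C W X; g \<in> Hom1 C X Y; h \<in> Hom1 C Y Z\<rbrakk>
      \<Longrightarrow> cmp1 C h (cmp1 C g f) = cmp1 C (cmp1 C h g) f"

record ('o, 'm, 'p, 'n) fun1 =
  obmap1 :: "'o \<Rightarrow> 'p"
  mormap1 :: "'m \<Rightarrow> 'n"

locale functor1 = C: category C + D: category D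
  for C :: "('o, 'm) cat1" and D :: "('p, 'n) cat1" +
  fixes H :: "('o, 'm, 'p, 'n) fun1"
  assumes obmap1: "X \<in> Ob C \<Longrightarrow> obmap1 H X \<in> Ob D"
    and mormap1: "f \<in> Hom1 C X Y \<Longrightarrow> mormap1 H f \<in> Hom1 D (obmap1 H X) (obmap1 H Y)"
    and mormap1_one: "X \<in> Ob C \<Longrightarrow> mormap1 H (one C X) = one D (obmap1 H X)"
    and mormap1_cmp1: "\<lbrakk>f \<in> Hom1 C X Y; g \<in> Hom1 C Y Z\<rbrakk>
      \<Longrightarrow> mormap1 H (cmp1 C g f) = cmp1 D (mormap1 H g) (mormap1 H f)"

definition isomorphism_of_categories ::
    "('o, 'm) cat1 \<Rightarrow> ('p, 'n) cat1 \<Rightarrow> ('o, 'm, 'p, 'n) fun1 \<Rightarrow> bool" where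
  "isomorphism_of_categories C D H \<longleftrightarrow> functor1 C D H \<and>
     (\<exists>G. functor1 D C G \<and>
        (\<forall>X\<in>Ob C. obmap1 G (obmap1 H X) = X) \<and> (\<forall>f\<in>Mor C. mormap1 G (mormap1 H f) = f) \<and>
        (\<forall>Y\<in>Ob D. obmap1 H (obmap1 G Y) = Y) \<and> (\<forall>g\<in>Mor D. mormap1 H (mormap1 G g) = g))"

definition connected_component :: "('o, 'm) cat1 \<Rightarrow> 'o \<Rightarrow> 'o set" where
  "connected_component C X = {Y \<in> Ob C. equivclp (\<lambda>U V. Hom1 C U V \<noteq> {}) X Y}"

text \<open>\<open>initial_in C S X\<close>: the object \<open>X\<close> is initial in the full subcategory of \<open>C\<close> on \<open>S\<close>.\<close>

definition initial_in :: "('o, 'm) cat1 \<Rightarrow> 'o set \<Rightarrow> 'o \<Rightarrow> bool" where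
  "initial_in C S X \<longleftrightarrow> X \<in> S \<and> (\<forall>Y\<in>S. \<exists>!f. f \<in> Hom1 C X Y)"


section \<open>2-categories, 2-functors and 2-monads\<close>

record ('o, 'm, 'c) cat2 =
  Obj :: "'o set"
  Arr :: "'m set"
  Cell :: "'c set"
  src :: "'m \<Rightarrow> 'o"
  trg :: "'m \<Rightarrow> 'o"
  Dom :: "'c \<Rightarrow> 'm"
  Cod :: "'c \<Rightarrow> 'm"
  ide :: "'o \<Rightarrow> 'm"
  idc :: "'m \<Rightarrow> 'c"
  cmp :: "'m \<Rightarrow> 'm \<Rightarrow> 'm"  (infixr "\<cdot>\<index>" 75)
  vcmp :: "'c \<Rightarrow> 'c \<Rightarrow> 'c"  (infixr "\<bullet>\<index>" 70)
  hcmp :: "'c \<Rightarrow> 'c \<Rightarrow> 'c"  (infixr "\<star>\<index>" 75)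

text \<open>All three compositions are written in the order of composition of functions.
  The whiskerings \<open>g \<alpha>\<close> and \<open>\<alpha> f\<close> are \<open>idc C g \<star> \<alpha>\<close> and \<open>\<alpha> \<star> idc C f\<close>.\<close>

definition Hom :: "('o, 'm, 'c) cat2 \<Rightarrow> 'o \<Rightarrow> 'o \<Rightarrow> 'm set" where
  "Hom C X Y = {f \<in> Arr C. src C f = X \<and> trg C f = Y}"

definition Cells :: "('o, 'm, 'c) cat2 \<Rightarrow> 'm \<Rightarrow> 'm \<Rightarrow> 'c set" where
  "Cells C f g = {\<alpha> \<in> Cell C. Dom C \<alpha> = f \<and> Cod C \<alpha> = g}"

locale two_category =
  fixes C :: "('o, 'm, 'c) cat2" (structure)
  assumes src_Obj: "f \<in> Arr C \<Longrightarrow> src C f \<in> Obj C"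
    and trg_Obj: "f \<in> Arr C \<Longrightarrow> trg C f \<in> Obj C"
    and Dom_Arr: "\<alpha> \<in> Cell C \<Longrightarrow> Dom C \<alpha> \<in> Arr C"
    and Cod_Arr: "\<alpha> \<in> Cell C \<Longrightarrow> Cod C \<alpha> \<in> Arr C"
    and src_Cod: "\<alpha> \<in> Cell C \<Longrightarrow> src C (Cod C \<alpha>) = src C (Dom C \<alpha>)"
    and trg_Cod: "\<alpha> \<in> Cell C \<Longrightarrow> trg C (Cod C \<alpha>) = trg C (Dom C \<alpha>)"
    and ide_Hom: "X \<in> Obj C \<Longrightarrow> ide C X \<in> Hom C X X"
    and cmp_Hom: "\<lbrakk>f \<in> Hom C X Y; g \<in> Hom C Y Z\<rbrakk> \<Longrightarrow> g \<cdot> f \<in> Hom C X Z"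
    and cmp_ide_right: "f \<in> Hom C X Y \<Longrightarrow> f \<cdot> ide C X = f"
    and cmp_ide_left: "f \<in> Hom C X Y \<Longrightarrow> ide C Y \<cdot> f = f"
    and cmp_assoc: "\<lbrakk>f \<in> Hom C W X; g \<in> Hom C X Y; h \<in> Hom C Y Z\<rbrakk> \<Longrightarrow> h \<cdot> (g \<cdot> f) = (h \<cdot> g) \<cdot> f"
    and idc_Cells: "f \<in> Arr C \<Longrightarrow> idc C f \<in> Cells C f f"
    and vcmp_Cells: "\<lbrakk>\<alpha> \<in> Cells C f g; \<beta> \<in> Cells C g h\<rbrakk> \<Longrightarrow> \<beta> \<bullet> \<alpha> \<in> Cells C f h"
    and vcmp_idc_right: "\<alpha> \<in> Cells C f g \<Longrightarrow> \<alpha> \<bullet> idc C f = \<alpha>"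
    and vcmp_idc_left: "\<alpha> \<in> Cells C f g \<Longrightarrow> idc C g \<bullet> \<alpha> = \<alpha>"
    and vcmp_assoc: "\<lbrakk>\<alpha> \<in> Cells C f g; \<beta> \<in> Cells C g h; \<gamma> \<in> Cells C h k\<rbrakk>
      \<Longrightarrow> \<gamma> \<bullet> (\<beta> \<bullet> \<alpha>) = (\<gamma> \<bullet> \<beta>) \<bullet> \<alpha>"
    and hcmp_Cells: "\<lbrakk>f \<in> Hom C X Y; g \<in> Hom C Y Z; \<alpha> \<in> Cells C f f'; \<beta> \<in> Cells C g g'\<rbrakk>
      \<Longrightarrow> \<beta> \<star> \<alpha> \<in> Cells C (g \<cdot> f) (g' \<cdot> f')"
    and hcmp_ide_right: "\<lbrakk>f \<in> Hom C X Y; \<alpha> \<in> Cells C f g\<rbrakk> \<Longrightarrow> \<alpha> \<star> idc C (ide C X) = \<alpha>"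
    and hcmp_ide_left: "\<lbrakk>f \<in> Hom C X Y; \<alpha> \<in> Cells C f g\<rbrakk> \<Longrightarrow> idc C (ide C Y) \<star> \<alpha> = \<alpha>"
    and hcmp_assoc: "\<lbrakk>f \<in> Hom C W X; g \<in> Hom C X Y; h \<in> Hom C Y Z;
        \<alpha> \<in> Cells C f f'; \<beta> \<in> Cells C g g'; \<gamma> \<in> Cells C h h'\<rbrakk>
      \<Longrightarrow> \<gamma> \<star> (\<beta> \<star> \<alpha>) = (\<gamma> \<star> \<beta>) \<star> \<alpha>"
    and hcmp_idc: "\<lbrakk>f \<in> Hom C X Y; g \<in> Hom C Y Z\<rbrakk> \<Longrightarrow> idc C g \<star> idc C f = idc C (g \<cdot> f)"
    and interchange: "\<lbrakk>f \<in> Hom C X Y; g \<in> Hom C Y Z;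
        \<alpha> \<in> Cells C f f'; \<alpha>' \<in> Cells C f' f''; \<beta> \<in> Cells C g g'; \<beta>' \<in> Cells C g' g''\<rbrakk>
      \<Longrightarrow> (\<beta>' \<bullet> \<beta>) \<star> (\<alpha>' \<bullet> \<alpha>) = (\<beta>' \<star> \<alpha>') \<bullet> (\<beta> \<star> \<alpha>)"

definition is_identity_cell :: "('o, 'm, 'c) cat2 \<Rightarrow> 'c \<Rightarrow> bool" where
  "is_identity_cell C \<alpha> \<longleftrightarrow> (\<exists>f\<in>Arr C. \<alpha> = idc C f)"

definition is_invertible_cell :: "('o, 'm, 'c) cat2 \<Rightarrow> 'c \<Rightarrow> bool" where
  "is_invertible_cell C \<alpha> \<longleftrightarrow> \<alpha> \<in> Cell C \<and>
     (\<exists>\<beta>\<in>Cells C (Cod C \<alpha>) (Dom C \<alpha>).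
        \<beta> \<bullet>\<^bsub>C\<^esub> \<alpha> = idc C (Dom C \<alpha>) \<and> \<alpha> \<bullet>\<^bsub>C\<^esub> \<beta> = idc C (Cod C \<alpha>))"

text \<open>Families of 2-cells closed under horizontal and vertical composition and containing all
  identity 2-cells.\<close>

definition closed_family :: "('o, 'm, 'c) cat2 \<Rightarrow> 'c set \<Rightarrow> bool" where
  "closed_family C \<Omega> \<longleftrightarrow> \<Omega> \<subseteq> Cell C \<and>
     (\<forall>f\<in>Arr C. idc C f \<in> \<Omega>) \<and>
     (\<forall>\<alpha>\<in>\<Omega>. \<forall>\<beta>\<in>\<Omega>. Dom C \<beta> = Cod C \<alpha> \<longrightarrow> \<beta> \<bullet>\<^bsub>C\<^esub> \<alpha> \<in> \<Omega>) \<and>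
     (\<forall>\<alpha>\<in>\<Omega>. \<forall>\<beta>\<in>\<Omega>. src C (Dom C \<beta>) = trg C (Dom C \<alpha>) \<longrightarrow> \<beta> \<star>\<^bsub>C\<^esub> \<alpha> \<in> \<Omega>)"

record ('o, 'm, 'c, 'p, 'n, 'd) fun2 =
  obmap :: "'o \<Rightarrow> 'p"
  arrmap :: "'m \<Rightarrow> 'n"
  cellmap :: "'c \<Rightarrow> 'd"

locale two_functor = C: two_category C + D: two_category D
  for C :: "('o, 'm, 'c) cat2" and D :: "('p, 'n, 'd) cat2" +
  fixes F :: "('o, 'm, 'c, 'p, 'n, 'd) fun2"
  assumes obmap: "X \<in> Obj C \<Longrightarrow> obmap F X \<in> Obj D"
    and arrmap: "f \<in> Hom C X Y \<Longrightarrow> arrmap F f \<in> Hom D (obmap F X) (obmap F Y)"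
    and cellmap: "\<alpha> \<in> Cells C f g \<Longrightarrow> cellmap F \<alpha> \<in> Cells D (arrmap F f) (arrmap F g)"
    and arrmap_ide: "X \<in> Obj C \<Longrightarrow> arrmap F (ide C X) = ide D (obmap F X)"
    and arrmap_cmp: "\<lbrakk>f \<in> Hom C X Y; g \<in> Hom C Y Z\<rbrakk>
      \<Longrightarrow> arrmap F (g \<cdot>\<^bsub>C\<^esub> f) = arrmap F g \<cdot>\<^bsub>D\<^esub> arrmap F f"
    and cellmap_idc: "f \<in> Arr C \<Longrightarrow> cellmap F (idc C f) = idc D (arrmap F f)"
    and cellmap_vcmp: "\<lbrakk>\<alpha> \<in> Cells C f g; \<beta> \<in> Cells C g h\<rbrakk>
      \<Longrightarrow> cellmap F (\<beta> \<bullet>\<^bsub>C\<^esub> \<alpha>) = cellmap F \<beta> \<bullet>\<^bsub>D\<^esub> cellmap F \<alpha>"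
    and cellmap_hcmp: "\<lbrakk>f \<in> Hom C X Y; g \<in> Hom C Y Z; \<alpha> \<in> Cells C f f'; \<beta> \<in> Cells C g g'\<rbrakk>
      \<Longrightarrow> cellmap F (\<beta> \<star>\<^bsub>C\<^esub> \<alpha>) = cellmap F \<beta> \<star>\<^bsub>D\<^esub> cellmap F \<alpha>"

definition id2 :: "('o, 'm, 'c, 'o, 'm, 'c) fun2" where
  "id2 = \<lparr>obmap = (\<lambda>X. X), arrmap = (\<lambda>f. f), cellmap = (\<lambda>\<alpha>. \<alpha>)\<rparr>"

definition comp2 :: "('p, 'n, 'd, 'q, 'l, 'e) fun2 \<Rightarrow> ('o, 'm, 'c, 'p, 'n, 'd) fun2
    \<Rightarrow> ('o, 'm, 'c, 'q, 'l, 'e) fun2" (infixr "\<circ>\<^sub>2" 55) where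
  "G \<circ>\<^sub>2 F = \<lparr>obmap = obmap G \<circ> obmap F, arrmap = arrmap G \<circ> arrmap F,
             cellmap = cellmap G \<circ> cellmap F\<rparr>"

locale two_natural = F: two_functor C D F + G: two_functor C D G
  for C :: "('o, 'm, 'c) cat2" and D :: "('p, 'n, 'd) cat2"
    and F :: "('o, 'm, 'c, 'p, 'n, 'd) fun2" and G :: "('o, 'm, 'c, 'p, 'n, 'd) fun2" +
  fixes \<eta> :: "'o \<Rightarrow> 'n"
  assumes component: "X \<in> Obj C \<Longrightarrow> \<eta> X \<in> Hom D (obmap F X) (obmap G X)"
    and natural_arr: "f \<in> Hom C X Y \<Longrightarrow> \<eta> Y \<cdot>\<^bsub>D\<^esub> arrmap F f = arrmap G f \<cdot>\<^bsub>D\<^esub> \<eta> X"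
    and natural_cell: "\<lbrakk>f \<in> Hom C X Y; \<alpha> \<in> Cells C f g\<rbrakk>
      \<Longrightarrow> idc D (\<eta> Y) \<star>\<^bsub>D\<^esub> cellmap F \<alpha> = cellmap G \<alpha> \<star>\<^bsub>D\<^esub> idc D (\<eta> X)"

locale two_monad = two_functor K K T + unit: two_natural K K id2 T i
    + mult: two_natural K K "T \<circ>\<^sub>2 T" T m
  for K :: "('o, 'm, 'c) cat2" and T :: "('o, 'm, 'c, 'o, 'm, 'c) fun2"
    and i :: "'o \<Rightarrow> 'm" and m :: "'o \<Rightarrow> 'm" +
  assumes unit_left: "X \<in> Obj K \<Longrightarrow> m X \<cdot>\<^bsub>K\<^esub> i (obmap T X) = ide K (obmap T X)"
    and unit_right: "X \<in> Obj K \<Longrightarrow> m X \<cdot>\<^bsub>K\<^esub> arrmap T (i X) = ide K (obmap T X)"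
    and mult_assoc: "X \<in> Obj K \<Longrightarrow> m X \<cdot>\<^bsub>K\<^esub> arrmap T (m X) = m X \<cdot>\<^bsub>K\<^esub> m (obmap T X)"


section \<open>Strict algebras and \<open>\<omega>\<close>-morphisms\<close>

record ('o, 'm) alg =
  carr :: 'o
  act :: 'm

record ('o, 'm, 'c) wmor =
  wsrc :: "('o, 'm) alg"
  wtrg :: "('o, 'm) alg"
  warr :: 'm
  wstr :: 'c

record ('o, 'm, 'c) wcell =
  wdom :: "('o, 'm, 'c) wmor"
  wcod :: "('o, 'm, 'c) wmor"
  wund :: 'c

definition algebras :: "('o, 'm, 'c) cat2 \<Rightarrow> ('o, 'm, 'c, 'o, 'm, 'c) fun2 \<Rightarrow> ('o \<Rightarrow> 'm) \<Rightarrow>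
    ('o \<Rightarrow> 'm) \<Rightarrow> ('o, 'm) alg set" where
  "algebras K T i m = {X. carr X \<in> Obj K \<and>
     act X \<in> Hom K (obmap T (carr X)) (carr X) \<and>
     act X \<cdot>\<^bsub>K\<^esub> i (carr X) = ide K (carr X) \<and>
     act X \<cdot>\<^bsub>K\<^esub> m (carr X) = act X \<cdot>\<^bsub>K\<^esub> arrmap T (act X)}"

definition wmorphisms :: "('o, 'm, 'c) cat2 \<Rightarrow> ('o, 'm, 'c, 'o, 'm, 'c) fun2 \<Rightarrow> ('o \<Rightarrow> 'm) \<Rightarrow>
    ('o \<Rightarrow> 'm) \<Rightarrow> 'c set \<Rightarrow> ('o, 'm, 'c) wmor set" where
  "wmorphisms K T i m \<Omega> = {w.
     wsrc w \<in> algebras K T i m \<and> wtrg w \<in> algebras K T i m \<and>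
     (let A = carr (wsrc w); a = act (wsrc w); B = carr (wtrg w); b = act (wtrg w);
          f = warr w; \<phi> = wstr w in
        f \<in> Hom K A B \<and>
        \<phi> \<in> Cells K (b \<cdot>\<^bsub>K\<^esub> arrmap T f) (f \<cdot>\<^bsub>K\<^esub> a) \<and> \<phi> \<in> \<Omega> \<and>
        \<phi> \<star>\<^bsub>K\<^esub> idc K (i A) = idc K f \<and>
        \<phi> \<star>\<^bsub>K\<^esub> idc K (m A) =
          (\<phi> \<star>\<^bsub>K\<^esub> idc K (arrmap T a)) \<bullet>\<^bsub>K\<^esub> (idc K b \<star>\<^bsub>K\<^esub> cellmap T \<phi>))}"

definition wcells :: "('o, 'm, 'c) cat2 \<Rightarrow> ('o, 'm, 'c, 'o, 'm, 'c) fun2 \<Rightarrow> ('o \<Rightarrow> 'm) \<Rightarrow>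
    ('o \<Rightarrow> 'm) \<Rightarrow> 'c set \<Rightarrow> ('o, 'm, 'c) wcell set" where
  "wcells K T i m \<Omega> = {x.
     wdom x \<in> wmorphisms K T i m \<Omega> \<and> wcod x \<in> wmorphisms K T i m \<Omega> \<and>
     wsrc (wdom x) = wsrc (wcod x) \<and> wtrg (wdom x) = wtrg (wcod x) \<and>
     (let a = act (wsrc (wdom x)); b = act (wtrg (wdom x)); \<alpha> = wund x in
        \<alpha> \<in> Cells K (warr (wdom x)) (warr (wcod x)) \<and>
        (\<alpha> \<star>\<^bsub>K\<^esub> idc K a) \<bullet>\<^bsub>K\<^esub> wstr (wdom x) =
          wstr (wcod x) \<bullet>\<^bsub>K\<^esub> (idc K b \<star>\<^bsub>K\<^esub> cellmap T \<alpha>))}"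

definition wcomp :: "('o, 'm, 'c) cat2 \<Rightarrow> ('o, 'm, 'c, 'o, 'm, 'c) fun2 \<Rightarrow>
    ('o, 'm, 'c) wmor \<Rightarrow> ('o, 'm, 'c) wmor \<Rightarrow> ('o, 'm, 'c) wmor" where
  "wcomp K T w v = \<lparr>wsrc = wsrc v, wtrg = wtrg w, warr = warr w \<cdot>\<^bsub>K\<^esub> warr v,
     wstr = (idc K (warr w) \<star>\<^bsub>K\<^esub> wstr v) \<bullet>\<^bsub>K\<^esub> (wstr w \<star>\<^bsub>K\<^esub> idc K (arrmap T (warr v)))\<rparr>"

definition TAlg :: "('o, 'm, 'c) cat2 \<Rightarrow> ('o, 'm, 'c, 'o, 'm, 'c) fun2 \<Rightarrow> ('o \<Rightarrow> 'm) \<Rightarrow>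
    ('o \<Rightarrow> 'm) \<Rightarrow> 'c set \<Rightarrow> (('o, 'm) alg, ('o, 'm, 'c) wmor, ('o, 'm, 'c) wcell) cat2" where
  "TAlg K T i m \<Omega> = \<lparr>
     Obj = algebras K T i m,
     Arr = wmorphisms K T i m \<Omega>,
     Cell = wcells K T i m \<Omega>,
     src = wsrc, trg = wtrg, Dom = wdom, Cod = wcod,
     ide = (\<lambda>X. \<lparr>wsrc = X, wtrg = X, warr = ide K (carr X), wstr = idc K (act X)\<rparr>),
     idc = (\<lambda>w. \<lparr>wdom = w, wcod = w, wund = idc K (warr w)\<rparr>),
     cmp = wcomp K T,
     vcmp = (\<lambda>y x. \<lparr>wdom = wdom x, wcod = wcod y, wund = wund y \<bullet>\<^bsub>K\<^esub> wund x\<rparr>),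
     hcmp = (\<lambda>y x. \<lparr>wdom = wcomp K T (wdom y) (wdom x), wcod = wcomp K T (wcod y) (wcod x),
                     wund = wund y \<star>\<^bsub>K\<^esub> wund x\<rparr>)\<rparr>"

definition Forget ::
    "(('o, 'm) alg, ('o, 'm, 'c) wmor, ('o, 'm, 'c) wcell, 'o, 'm, 'c) fun2" where
  "Forget = \<lparr>obmap = carr, arrmap = warr, cellmap = wund\<rparr>"

definition is_strict :: "('o, 'm, 'c) cat2 \<Rightarrow> ('o, 'm, 'c) wmor \<Rightarrow> bool" where
  "is_strict K w \<longleftrightarrow> is_identity_cell K (wstr w)"

text \<open>The family \<open>p\<close>, indexed by \<open>I\<close>, of morphisms with common source \<open>L\<close> jointly detects
  \<open>\<Omega>'\<close>-ness.\<close>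

definition jointly_detects :: "('o, 'm, 'c) cat2 \<Rightarrow> ('o, 'm, 'c, 'o, 'm, 'c) fun2 \<Rightarrow>
    ('o \<Rightarrow> 'm) \<Rightarrow> ('o \<Rightarrow> 'm) \<Rightarrow> 'c set \<Rightarrow> 'c set \<Rightarrow> 'x set \<Rightarrow> ('x \<Rightarrow> ('o, 'm, 'c) wmor) \<Rightarrow>
    ('o, 'm) alg \<Rightarrow> bool" where
  "jointly_detects K T i m \<Omega> \<Omega>' I p L \<longleftrightarrow>
     (\<forall>Z\<in>Obj (TAlg K T i m \<Omega>). \<forall>z\<in>Hom (TAlg K T i m \<Omega>) Z L.
        (\<forall>x\<in>I. wstr (p x \<cdot>\<^bsub>TAlg K T i m \<Omega>\<^esub> z) \<in> \<Omega>') \<longrightarrow> wstr z \<in> \<Omega>')"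


section \<open>Indexing pairs\<close>

definition indexing_pair :: "('o, 'm, 'c) cat2 \<Rightarrow> 'm set \<Rightarrow> bool" where
  "indexing_pair A \<Sigma> \<longleftrightarrow> two_category A \<and> \<Sigma> \<subseteq> Arr A \<and> (\<forall>X\<in>Obj A. ide A X \<in> \<Sigma>) \<and>
     (\<forall>f\<in>\<Sigma>. \<forall>g\<in>\<Sigma>. src A g = trg A f \<longrightarrow> g \<cdot>\<^bsub>A\<^esub> f \<in> \<Sigma>)"

definition sigma_cat :: "('o, 'm, 'c) cat2 \<Rightarrow> 'm set \<Rightarrow> ('o, 'm) cat1" where
  "sigma_cat A \<Sigma> = \<lparr>Ob = Obj A, Mor = \<Sigma>, sce = src A, tgt = trg A, one = ide A, cmp1 = cmp A\<rparr>"

definition PIE :: "('o, 'm, 'c) cat2 \<Rightarrow> 'm set \<Rightarrow> bool" where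
  "PIE A \<Sigma> \<longleftrightarrow> (\<forall>X\<in>Obj A. \<exists>X0.
     initial_in (sigma_cat A \<Sigma>) (connected_component (sigma_cat A \<Sigma>) X) X0)"

text \<open>Initial objects being unique only up to isomorphism, the family \<open>\<A>\<^sub>0\<close> of initial objects is
  a choice of one for each connected component.\<close>

definition initial_family :: "('o, 'm, 'c) cat2 \<Rightarrow> 'm set \<Rightarrow> 'o set \<Rightarrow> bool" where
  "initial_family A \<Sigma> A0 \<longleftrightarrow>
     (\<forall>X\<in>A0. X \<in> Obj A \<and>
        initial_in (sigma_cat A \<Sigma>) (connected_component (sigma_cat A \<Sigma>) X) X) \<and>
     (\<forall>X\<in>Obj A. \<exists>!X0. X0 \<in> A0 \<and> X0 \<in> connected_component (sigma_cat A \<Sigma>) X)"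

definition initial_arr :: "('o, 'm, 'c) cat2 \<Rightarrow> 'm set \<Rightarrow> 'o set \<Rightarrow> 'o \<Rightarrow> 'm" where
  "initial_arr A \<Sigma> A0 X = (THE f. f \<in> \<Sigma> \<and> src A f \<in> A0 \<and> trg A f = X)"


section \<open>Op-lax cones and \<open>\<sigma>\<close>-s-oplimits\<close>

text \<open>Functions on the objects and arrows of the indexing 2-category are taken extensional (equal
  to \<open>undefined\<close> elsewhere), so that equality of cones and of their morphisms is the intended one.\<close>

record ('ao, 'am, 'm, 'c) opcone =
  leg :: "'ao \<Rightarrow> 'm"
  legcell :: "'am \<Rightarrow> 'c"

record ('ao, 'am, 'm, 'c) opcone_mor =
  mdom :: "('ao, 'am, 'm, 'c) opcone"
  mcod :: "('ao, 'am, 'm, 'c) opcone"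
  mcell :: "'ao \<Rightarrow> 'c"

definition oplax_cones :: "('ao, 'am, 'ac) cat2 \<Rightarrow> ('o, 'm, 'c) cat2 \<Rightarrow>
    ('ao, 'am, 'ac, 'o, 'm, 'c) fun2 \<Rightarrow> 'o \<Rightarrow> ('ao, 'am, 'm, 'c) opcone set" where
  "oplax_cones A B F E = {\<theta>.
     leg \<theta> \<in> (\<Pi>\<^sub>E X\<in>Obj A. Hom B E (obmap F X)) \<and>
     legcell \<theta> \<in>
       (\<Pi>\<^sub>E f\<in>Arr A. Cells B (leg \<theta> (trg A f)) (arrmap F f \<cdot>\<^bsub>B\<^esub> leg \<theta> (src A f))) \<and>
     (\<forall>X\<in>Obj A. legcell \<theta> (ide A X) = idc B (leg \<theta> X)) \<and>
     (\<forall>X Y Z f g. f \<in> Hom A X Y \<and> g \<in> Hom A Y Z \<longrightarrow>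
        legcell \<theta> (g \<cdot>\<^bsub>A\<^esub> f) =
          (idc B (arrmap F g) \<star>\<^bsub>B\<^esub> legcell \<theta> f) \<bullet>\<^bsub>B\<^esub> legcell \<theta> g) \<and>
     (\<forall>X Y f g \<gamma>. f \<in> Hom A X Y \<and> g \<in> Hom A X Y \<and> \<gamma> \<in> Cells A f g \<longrightarrow>
        legcell \<theta> g = (cellmap F \<gamma> \<star>\<^bsub>B\<^esub> idc B (leg \<theta> X)) \<bullet>\<^bsub>B\<^esub> legcell \<theta> f)}"

definition opcones :: "('ao, 'am, 'ac) cat2 \<Rightarrow> 'am set \<Rightarrow> ('o, 'm, 'c) cat2 \<Rightarrow>
    ('ao, 'am, 'ac, 'o, 'm, 'c) fun2 \<Rightarrow> 'o \<Rightarrow> ('ao, 'am, 'm, 'c) opcone set" where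
  "opcones A \<Sigma> B F E =
     {\<theta> \<in> oplax_cones A B F E. \<forall>f\<in>\<Sigma>. is_identity_cell B (legcell \<theta> f)}"

definition opcone_mors :: "('ao, 'am, 'ac) cat2 \<Rightarrow> 'am set \<Rightarrow> ('o, 'm, 'c) cat2 \<Rightarrow>
    ('ao, 'am, 'ac, 'o, 'm, 'c) fun2 \<Rightarrow> 'o \<Rightarrow> ('ao, 'am, 'm, 'c) opcone_mor set" where
  "opcone_mors A \<Sigma> B F E = {\<mu>.
     mdom \<mu> \<in> opcones A \<Sigma> B F E \<and> mcod \<mu> \<in> opcones A \<Sigma> B F E \<and>
     mcell \<mu> \<in> (\<Pi>\<^sub>E X\<in>Obj A. Cells B (leg (mdom \<mu>) X) (leg (mcod \<mu>) X)) \<and>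
     (\<forall>X Y f. f \<in> Hom A X Y \<longrightarrow>
        (idc B (arrmap F f) \<star>\<^bsub>B\<^esub> mcell \<mu> X) \<bullet>\<^bsub>B\<^esub> legcell (mdom \<mu>) f =
          legcell (mcod \<mu>) f \<bullet>\<^bsub>B\<^esub> mcell \<mu> Y)}"

definition opcone_cat :: "('ao, 'am, 'ac) cat2 \<Rightarrow> 'am set \<Rightarrow> ('o, 'm, 'c) cat2 \<Rightarrow>
    ('ao, 'am, 'ac, 'o, 'm, 'c) fun2 \<Rightarrow> 'o \<Rightarrow>
    (('ao, 'am, 'm, 'c) opcone, ('ao, 'am, 'm, 'c) opcone_mor) cat1" where
  "opcone_cat A \<Sigma> B F E = \<lparr>
     Ob = opcones A \<Sigma> B F E,
     Mor = opcone_mors A \<Sigma> B F E,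
     sce = mdom, tgt = mcod,
     one = (\<lambda>\<theta>. \<lparr>mdom = \<theta>, mcod = \<theta>, mcell = (\<lambda>X\<in>Obj A. idc B (leg \<theta> X))\<rparr>),
     cmp1 = (\<lambda>\<nu> \<mu>. \<lparr>mdom = mdom \<mu>, mcod = mcod \<nu>,
                     mcell = (\<lambda>X\<in>Obj A. mcell \<nu> X \<bullet>\<^bsub>B\<^esub> mcell \<mu> X)\<rparr>)\<rparr>"

definition hom_cat :: "('o, 'm, 'c) cat2 \<Rightarrow> 'o \<Rightarrow> 'o \<Rightarrow> ('m, 'c) cat1" where
  "hom_cat B X Y = \<lparr>
     Ob = Hom B X Y,
     Mor = {\<alpha> \<in> Cell B. Dom B \<alpha> \<in> Hom B X Y \<and> Cod B \<alpha> \<in> Hom B X Y},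
     sce = Dom B, tgt = Cod B, one = idc B, cmp1 = vcmp B\<rparr>"

text \<open>Composition with an opcone \<open>\<pi>\<close> of vertex \<open>L\<close>, as a functor from \<open>hom_cat B E L\<close> to the
  category of opcones of vertex \<open>E\<close>.\<close>

definition cone_comp :: "('ao, 'am, 'ac) cat2 \<Rightarrow> ('o, 'm, 'c) cat2 \<Rightarrow>
    ('ao, 'am, 'm, 'c) opcone \<Rightarrow> 'm \<Rightarrow> ('ao, 'am, 'm, 'c) opcone" where
  "cone_comp A B \<pi> \<phi> = \<lparr>leg = (\<lambda>X\<in>Obj A. leg \<pi> X \<cdot>\<^bsub>B\<^esub> \<phi>),
                        legcell = (\<lambda>f\<in>Arr A. legcell \<pi> f \<star>\<^bsub>B\<^esub> idc B \<phi>)\<rparr>"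

definition cone_comp_functor :: "('ao, 'am, 'ac) cat2 \<Rightarrow> ('o, 'm, 'c) cat2 \<Rightarrow>
    ('ao, 'am, 'm, 'c) opcone \<Rightarrow>
    ('m, 'c, ('ao, 'am, 'm, 'c) opcone, ('ao, 'am, 'm, 'c) opcone_mor) fun1" where
  "cone_comp_functor A B \<pi> = \<lparr>
     obmap1 = cone_comp A B \<pi>,
     mormap1 = (\<lambda>\<beta>. \<lparr>mdom = cone_comp A B \<pi> (Dom B \<beta>), mcod = cone_comp A B \<pi> (Cod B \<beta>),
                      mcell = (\<lambda>X\<in>Obj A. idc B (leg \<pi> X) \<star>\<^bsub>B\<^esub> \<beta>)\<rparr>)\<rparr>"

definition is_oplimit :: "('ao, 'am, 'ac) cat2 \<Rightarrow> 'am set \<Rightarrow> ('o, 'm, 'c) cat2 \<Rightarrow>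
    ('ao, 'am, 'ac, 'o, 'm, 'c) fun2 \<Rightarrow> 'o \<Rightarrow> ('ao, 'am, 'm, 'c) opcone \<Rightarrow> bool" where
  "is_oplimit A \<Sigma> B F L \<pi> \<longleftrightarrow> L \<in> Obj B \<and> \<pi> \<in> opcones A \<Sigma> B F L \<and>
     (\<forall>E\<in>Obj B. isomorphism_of_categories (hom_cat B E L) (opcone_cat A \<Sigma> B F E)
        (cone_comp_functor A B \<pi>))"

definition compatible :: "('ao, 'am, 'ac) cat2 \<Rightarrow> 'am set \<Rightarrow> ('o, 'm, 'c) cat2 \<Rightarrow>
    ('ao, 'am, 'ac, 'o, 'm, 'c) fun2 \<Rightarrow> 'c set \<Rightarrow> 'o \<Rightarrow> ('ao, 'am, 'm, 'c) opcone \<Rightarrow> bool" where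
  "compatible A \<Sigma> B F \<Omega> L \<pi> \<longleftrightarrow>
     (\<forall>E\<in>Obj B. \<forall>\<mu>\<in>Mor (opcone_cat A \<Sigma> B F E). \<forall>\<beta>\<in>Mor (hom_cat B E L).
        mormap1 (cone_comp_functor A B \<pi>) \<beta> = \<mu> \<longrightarrow>
        (\<forall>X\<in>Obj A. mcell \<mu> X \<in> \<Omega>) \<longrightarrow> \<beta> \<in> \<Omega>)"

definition image_cone :: "('ao, 'am, 'ac) cat2 \<Rightarrow> ('o, 'm, 'c, 'p, 'n, 'd) fun2 \<Rightarrow>
    ('ao, 'am, 'm, 'c) opcone \<Rightarrow> ('ao, 'am, 'n, 'd) opcone" where
  "image_cone A G \<pi> = \<lparr>leg = (\<lambda>X\<in>Obj A. arrmap G (leg \<pi> X)),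
                       legcell = (\<lambda>f\<in>Arr A. cellmap G (legcell \<pi> f))\<rparr>"

definition preserves_oplimits :: "('ao, 'am, 'ac) cat2 \<Rightarrow> 'am set \<Rightarrow> ('o, 'm, 'c) cat2 \<Rightarrow>
    ('p, 'n, 'd) cat2 \<Rightarrow> ('o, 'm, 'c, 'p, 'n, 'd) fun2 \<Rightarrow>
    ('ao, 'am, 'ac, 'o, 'm, 'c) fun2 \<Rightarrow> bool" where
  "preserves_oplimits A \<Sigma> B D G F \<longleftrightarrow>
     (\<forall>L \<pi>. is_oplimit A \<Sigma> B F L \<pi> \<longrightarrow>
        is_oplimit A \<Sigma> D (G \<circ>\<^sub>2 F) (obmap G L) (image_cone A G \<pi>))"

end

theory Submission
  imports Defs
begin

text \<open>
  Write \<open>f\<^sub>X : X\<^sub>0 \<rightarrow> X\<close> for the initial arrow of \<open>X\<close>, \<open>a\<^sub>X\<close> for the action of the algebra \<open>Fbar X\<close> and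
  \<open>\<phi>\<^sub>f\<close> for the structure 2-cell of \<open>Fbar f\<close>. Since \<open>\<pi>\<^sub>X = F f\<^sub>X \<pi>\<^bsub>X\<^sub>0\<^esub>\<close>, demanding strict projections at
  the \<open>X\<^sub>0\<close> forces the opcone \<open>\<theta>\<^sub>X = F f\<^sub>X a\<^bsub>X\<^sub>0\<^esub> T\<pi>\<^bsub>X\<^sub>0\<^esub>\<close> with vertex \<open>T L\<close>. Its 2-cells come from those of
  the op-lax cone \<open>a\<^sub>X T\<pi>\<^sub>X\<close> by conjugation with the invertible \<open>\<psi>\<^sub>X = \<phi>\<^bsub>f\<^sub>X\<^esub> T\<pi>\<^bsub>X\<^sub>0\<^esub> : a\<^sub>X T\<pi>\<^sub>X \<Rightarrow> \<theta>\<^sub>X\<close>.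
  The arrow \<open>l : T L \<rightarrow> L\<close> induced by \<open>\<theta>\<close> is the action on \<open>L\<close>, and \<open>\<psi>\<^sub>X\<close> is the structure 2-cell of
  \<open>\<pi>\<^sub>X\<close>. The inverses of the \<open>\<phi>\<^bsub>f\<^sub>X\<^esub>\<close> need not lie in \<open>\<Omega>\<close>, but they enter only \<open>\<theta>\<close>, never a structure
  2-cell. A 2-cell into \<open>L\<close> is determined by its composites with the \<open>\<pi>\<^bsub>X\<^sub>0\<^esub>\<close>, and by compatibility and
  closure it lies in \<open>\<Omega>'\<close> if these composites do. As \<open>\<psi>\<^bsub>X\<^sub>0\<^esub>\<close> is an identity, the axioms for an induced
  morphism into \<open>(L, l)\<close> and the detection property can therefore be read off at the \<open>X\<^sub>0\<close>.
\<close>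

section \<open>Calculus in 2-categories\<close>

context two_category
begin

text \<open>The axioms are typed through \<open>Hom\<close> and \<open>Cells\<close>, with source
  and target as free variables. The simp rules of this context restate them through
  \<open>src\<close>, \<open>trg\<close>, \<open>Dom\<close> and \<open>Cod\<close>, so that
  composability becomes a simp condition; all three compositions are nested to the right.\<close>

lemma Hom_iff: "f \<in> Hom C X Y \<longleftrightarrow> f \<in> Arr C \<and> src C f = X \<and> trg C f = Y"
  by (simp add: Hom_def)

lemma Cells_iff: "\<alpha> \<in> Cells C f g \<longleftrightarrow> \<alpha> \<in> Cell C \<and> Dom C \<alpha> = f \<and> Cod C \<alpha> = g"
  by (simp add: Cells_def)

lemmas objects [simp] = src_Obj trg_Obj Dom_Arr Cod_Arr src_Cod trg_Cod

lemma ide_simps [simp]: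
  assumes "X \<in> Obj C"
  shows "ide C X \<in> Arr C" "src C (ide C X) = X" "trg C (ide C X) = X"
  using ide_Hom [OF assms] by (auto simp: Hom_iff)

lemma cmp_simps [simp]:
  assumes "f \<in> Arr C" "g \<in> Arr C" "src C g = trg C f"
  shows "g \<cdot> f \<in> Arr C" "src C (g \<cdot> f) = src C f" "trg C (g \<cdot> f) = trg C g"
  using cmp_Hom [of f "src C f" "trg C f" g "trg C g"] assms by (auto simp: Hom_iff)

lemma cmp_ide [simp]:
  assumes "f \<in> Arr C"
  shows "src C f = X \<Longrightarrow> f \<cdot> ide C X = f" "trg C f = X \<Longrightarrow> ide C X \<cdot> f = f"
  using assms by (auto intro: cmp_ide_left cmp_ide_right simp: Hom_iff)

lemma cmp_assoc' [simp]:
  assumes "f \<in> Arr C" "g \<in> Arr C" "h \<in> Arr C" "src C g = trg C f" "src C h = trg C g"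
  shows "(h \<cdot> g) \<cdot> f = h \<cdot> (g \<cdot> f)"
  by (rule cmp_assoc [symmetric]) (use assms in \<open>auto simp: Hom_iff\<close>)

lemma idc_simps [simp]:
  assumes "f \<in> Arr C"
  shows "idc C f \<in> Cell C" "Dom C (idc C f) = f" "Cod C (idc C f) = f"
  using idc_Cells [OF assms] by (auto simp: Cells_iff)

lemma vcmp_simps [simp]:
  assumes "\<alpha> \<in> Cell C" "\<beta> \<in> Cell C" "Dom C \<beta> = Cod C \<alpha>"
  shows "\<beta> \<bullet> \<alpha> \<in> Cell C" "Dom C (\<beta> \<bullet> \<alpha>) = Dom C \<alpha>" "Cod C (\<beta> \<bullet> \<alpha>) = Cod C \<beta>"
  using vcmp_Cells [of \<alpha> "Dom C \<alpha>" "Cod C \<alpha>" \<beta> "Cod C \<beta>"] assms by (auto simp: Cells_iff)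

lemma vcmp_idc [simp]:
  assumes "\<alpha> \<in> Cell C"
  shows "Dom C \<alpha> = f \<Longrightarrow> \<alpha> \<bullet> idc C f = \<alpha>" "Cod C \<alpha> = f \<Longrightarrow> idc C f \<bullet> \<alpha> = \<alpha>"
  using assms by (auto intro: vcmp_idc_left vcmp_idc_right simp: Cells_iff)

lemma vcmp_assoc' [simp]:
  assumes "\<alpha> \<in> Cell C" "\<beta> \<in> Cell C" "\<gamma> \<in> Cell C" "Dom C \<beta> = Cod C \<alpha>" "Dom C \<gamma> = Cod C \<beta>"
  shows "(\<gamma> \<bullet> \<beta>) \<bullet> \<alpha> = \<gamma> \<bullet> (\<beta> \<bullet> \<alpha>)"
  by (rule vcmp_assoc [symmetric]) (use assms in \<open>auto simp: Cells_iff\<close>)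

lemma hcmp_simps [simp]:
  assumes "\<alpha> \<in> Cell C" "\<beta> \<in> Cell C" "src C (Dom C \<beta>) = trg C (Dom C \<alpha>)"
  shows "\<beta> \<star> \<alpha> \<in> Cell C" "Dom C (\<beta> \<star> \<alpha>) = Dom C \<beta> \<cdot> Dom C \<alpha>"
    "Cod C (\<beta> \<star> \<alpha>) = Cod C \<beta> \<cdot> Cod C \<alpha>"
  using hcmp_Cells [of "Dom C \<alpha>" "src C (Dom C \<alpha>)" "trg C (Dom C \<alpha>)" "Dom C \<beta>"
      "trg C (Dom C \<beta>)" \<alpha> "Cod C \<alpha>" \<beta> "Cod C \<beta>"] assms
  by (auto simp: Cells_iff Hom_iff)

lemma hcmp_ide [simp]:
  assumes "\<alpha> \<in> Cell C"
  shows "src C (Dom C \<alpha>) = X \<Longrightarrow> \<alpha> \<star> idc C (ide C X) = \<alpha>"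
    "trg C (Dom C \<alpha>) = X \<Longrightarrow> idc C (ide C X) \<star> \<alpha> = \<alpha>"
  using assms hcmp_ide_right [of "Dom C \<alpha>" "src C (Dom C \<alpha>)" "trg C (Dom C \<alpha>)" \<alpha> "Cod C \<alpha>"]
    hcmp_ide_left [of "Dom C \<alpha>" "src C (Dom C \<alpha>)" "trg C (Dom C \<alpha>)" \<alpha> "Cod C \<alpha>"]
  by (auto simp: Cells_iff Hom_iff)

lemma hcmp_assoc' [simp]:
  assumes "\<alpha> \<in> Cell C" "\<beta> \<in> Cell C" "\<gamma> \<in> Cell C"
    "src C (Dom C \<beta>) = trg C (Dom C \<alpha>)" "src C (Dom C \<gamma>) = trg C (Dom C \<beta>)"
  shows "(\<gamma> \<star> \<beta>) \<star> \<alpha> = \<gamma> \<star> (\<beta> \<star> \<alpha>)"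
  by (rule hcmp_assoc [symmetric]) (use assms in \<open>auto simp: Cells_iff Hom_iff\<close>)

lemma hcmp_idc' [simp]:
  assumes "f \<in> Arr C" "g \<in> Arr C" "src C g = trg C f"
  shows "idc C g \<star> idc C f = idc C (g \<cdot> f)"
  by (rule hcmp_idc) (use assms in \<open>auto simp: Hom_iff\<close>)

text \<open>Right nesting separates two successive left whiskerings, so \<open>hcmp_idc'\<close>
  cannot see them. Successive right whiskerings are already merged by \<open>hcmp_assoc'\<close> and
  \<open>hcmp_idc'\<close>.\<close>

lemma hcmp_idc_merge [simp]:
  assumes "f \<in> Arr C" "g \<in> Arr C" "\<alpha> \<in> Cell C" "src C g = trg C f" "src C f = trg C (Dom C \<alpha>)"
  shows "idc C g \<star> (idc C f \<star> \<alpha>) = idc C (g \<cdot> f) \<star> \<alpha>"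
  using hcmp_assoc' [of \<alpha> "idc C f" "idc C g"] assms by simp

lemma interchange':
  assumes "\<alpha> \<in> Cell C" "\<alpha>' \<in> Cell C" "\<beta> \<in> Cell C" "\<beta>' \<in> Cell C"
    "Dom C \<alpha>' = Cod C \<alpha>" "Dom C \<beta>' = Cod C \<beta>" "src C (Dom C \<beta>) = trg C (Dom C \<alpha>)"
  shows "(\<beta>' \<bullet> \<beta>) \<star> (\<alpha>' \<bullet> \<alpha>) = (\<beta>' \<star> \<alpha>') \<bullet> (\<beta> \<star> \<alpha>)"
  by (rule interchange [of "Dom C \<alpha>" "src C (Dom C \<alpha>)" "trg C (Dom C \<alpha>)" "Dom C \<beta>"
      "trg C (Dom C \<beta>)"])
    (use assms in \<open>auto simp: Cells_iff Hom_iff\<close>)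

lemma whisker_vcmp [simp]:
  assumes "\<alpha> \<in> Cell C" "\<beta> \<in> Cell C" "Dom C \<beta> = Cod C \<alpha>" "f \<in> Arr C"
  shows "src C f = trg C (Dom C \<alpha>) \<Longrightarrow> idc C f \<star> (\<beta> \<bullet> \<alpha>) = (idc C f \<star> \<beta>) \<bullet> (idc C f \<star> \<alpha>)"
    "src C (Dom C \<alpha>) = trg C f \<Longrightarrow> (\<beta> \<bullet> \<alpha>) \<star> idc C f = (\<beta> \<star> idc C f) \<bullet> (\<alpha> \<star> idc C f)"
  using interchange' [of \<alpha> \<beta> "idc C f" "idc C f"] interchange' [of "idc C f" "idc C f" \<alpha> \<beta>] assms
  by auto

text \<open>By interchange both sides are \<open>\<beta> \<star> \<alpha>\<close>. This moves a
  2-cell past another one acting on the other side.\<close>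

lemma exchange:
  assumes "\<alpha> \<in> Cell C" "\<beta> \<in> Cell C" "src C (Dom C \<beta>) = trg C (Dom C \<alpha>)"
  shows "(\<beta> \<star> idc C (Cod C \<alpha>)) \<bullet> (idc C (Dom C \<beta>) \<star> \<alpha>) =
      (idc C (Cod C \<beta>) \<star> \<alpha>) \<bullet> (\<beta> \<star> idc C (Dom C \<alpha>))"
  using interchange' [of \<alpha> "idc C (Cod C \<alpha>)" "idc C (Dom C \<beta>)" \<beta>]
    interchange' [of "idc C (Dom C \<alpha>)" \<alpha> \<beta> "idc C (Cod C \<beta>)"] assms
  by auto

text \<open>In a right-nested composite an equation between two-factor composites is seldom a
  subterm. This form carries the remaining tail \<open>\<epsilon>\<close>, so that such an equation
  can still be used for rewriting.\<close>

lemma vcmp_square: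
  assumes "\<beta> \<bullet> \<alpha> = \<delta> \<bullet> \<gamma>"
    and "\<epsilon> \<in> Cell C" "\<alpha> \<in> Cell C" "\<beta> \<in> Cell C" "\<gamma> \<in> Cell C" "\<delta> \<in> Cell C"
    and "Dom C \<alpha> = Cod C \<epsilon>" "Dom C \<beta> = Cod C \<alpha>" "Dom C \<gamma> = Cod C \<epsilon>" "Dom C \<delta> = Cod C \<gamma>"
  shows "\<beta> \<bullet> (\<alpha> \<bullet> \<epsilon>) = \<delta> \<bullet> (\<gamma> \<bullet> \<epsilon>)"
  by (metis assms vcmp_assoc')

lemma identity_cell:
  assumes "is_identity_cell C \<alpha>"
  shows "\<alpha> = idc C (Dom C \<alpha>)" "Cod C \<alpha> = Dom C \<alpha>"
  using assms by (auto simp: is_identity_cell_def)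

lemma category_hom_cat: "category (hom_cat C X Y)"
  by unfold_locales (auto simp: hom_cat_def Hom1_def Hom_iff)

end

context two_functor
begin

lemma arrmap_simps [simp]:
  assumes "f \<in> Arr C"
  shows "arrmap F f \<in> Arr D" "src D (arrmap F f) = obmap F (src C f)"
    "trg D (arrmap F f) = obmap F (trg C f)"
  using arrmap [of f "src C f" "trg C f"] assms by (auto simp: D.Hom_iff C.Hom_iff)

lemma cellmap_simps [simp]:
  assumes "\<alpha> \<in> Cell C"
  shows "cellmap F \<alpha> \<in> Cell D" "Dom D (cellmap F \<alpha>) = arrmap F (Dom C \<alpha>)"
    "Cod D (cellmap F \<alpha>) = arrmap F (Cod C \<alpha>)"
  using cellmap [of \<alpha> "Dom C \<alpha>" "Cod C \<alpha>"] assms by (auto simp: D.Cells_iff C.Cells_iff)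

lemmas preserves_ide [simp] = obmap arrmap_ide cellmap_idc

lemma preserves_cmp [simp]:
  assumes "f \<in> Arr C" "g \<in> Arr C" "src C g = trg C f"
  shows "arrmap F (g \<cdot>\<^bsub>C\<^esub> f) = arrmap F g \<cdot>\<^bsub>D\<^esub> arrmap F f"
  by (rule arrmap_cmp) (use assms in \<open>auto simp: C.Hom_iff\<close>)

lemma preserves_vcmp [simp]:
  assumes "\<alpha> \<in> Cell C" "\<beta> \<in> Cell C" "Dom C \<beta> = Cod C \<alpha>"
  shows "cellmap F (\<beta> \<bullet>\<^bsub>C\<^esub> \<alpha>) = cellmap F \<beta> \<bullet>\<^bsub>D\<^esub> cellmap F \<alpha>"
  by (rule cellmap_vcmp) (use assms in \<open>auto simp: C.Cells_iff\<close>)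

lemma preserves_hcmp [simp]:
  assumes "\<alpha> \<in> Cell C" "\<beta> \<in> Cell C" "src C (Dom C \<beta>) = trg C (Dom C \<alpha>)"
  shows "cellmap F (\<beta> \<star>\<^bsub>C\<^esub> \<alpha>) = cellmap F \<beta> \<star>\<^bsub>D\<^esub> cellmap F \<alpha>"
  by (rule cellmap_hcmp [of "Dom C \<alpha>" "src C (Dom C \<alpha>)" "trg C (Dom C \<alpha>)" "Dom C \<beta>"
      "trg C (Dom C \<beta>)"])
    (use assms in \<open>auto simp: C.Cells_iff C.Hom_iff\<close>)

end

text \<open>The inverse of a bijective functor is automatically functorial. This reduces
  universality of a cone to existence and uniqueness of arrows and of 2-cells.\<close>

lemma isomorphism_of_categories_iff_bij:
  "isomorphism_of_categories C D H \<longleftrightarrow>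
     functor1 C D H \<and> bij_betw (obmap1 H) (Ob C) (Ob D) \<and> bij_betw (mormap1 H) (Mor C) (Mor D)"
proof
  assume "isomorphism_of_categories C D H"
  then obtain G where H: "functor1 C D H" and G: "functor1 D C G"
    and inv: "\<forall>X\<in>Ob C. obmap1 G (obmap1 H X) = X" "\<forall>f\<in>Mor C. mormap1 G (mormap1 H f) = f"
      "\<forall>Y\<in>Ob D. obmap1 H (obmap1 G Y) = Y" "\<forall>g\<in>Mor D. mormap1 H (mormap1 G g) = g"
    unfolding isomorphism_of_categories_def by blast
  have "mormap1 H ` Mor C \<subseteq> Mor D" "mormap1 G ` Mor D \<subseteq> Mor C"
    using functor1.mormap1 [OF H] functor1.mormap1 [OF G] by (fastforce simp: Hom1_def)+
  moreover have "obmap1 H ` Ob C \<subseteq> Ob D" "obmap1 G ` Ob D \<subseteq> Ob C"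
    using functor1.obmap1 [OF H] functor1.obmap1 [OF G] by blast+
  ultimately show
      "functor1 C D H \<and> bij_betw (obmap1 H) (Ob C) (Ob D) \<and> bij_betw (mormap1 H) (Mor C) (Mor D)"
    using H inv by (auto intro!: bij_betw_byWitness)
next
  assume *: "functor1 C D H \<and> bij_betw (obmap1 H) (Ob C) (Ob D) \<and>
      bij_betw (mormap1 H) (Mor C) (Mor D)"
  then interpret functor1 C D H by blast
  define G where "G = \<lparr>obmap1 = inv_into (Ob C) (obmap1 H), mormap1 = inv_into (Mor C) (mormap1 H)\<rparr>"
  have ob: "inj_on (obmap1 H) (Ob C)" "obmap1 H ` Ob C = Ob D"
    and mor: "inj_on (mormap1 H) (Mor C)" "mormap1 H ` Mor C = Mor D"
    using * by (auto simp: bij_betw_def)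
  have ob_inv [simp]: "\<And>X. X \<in> Ob C \<Longrightarrow> obmap1 G (obmap1 H X) = X"
      "\<And>Y. Y \<in> Ob D \<Longrightarrow> obmap1 H (obmap1 G Y) = Y" "\<And>Y. Y \<in> Ob D \<Longrightarrow> obmap1 G Y \<in> Ob C"
    using ob by (auto simp: G_def f_inv_into_f inv_into_into)
  have mor_inv [simp]: "\<And>f. f \<in> Mor C \<Longrightarrow> mormap1 G (mormap1 H f) = f"
      "\<And>g. g \<in> Mor D \<Longrightarrow> mormap1 H (mormap1 G g) = g" "\<And>g. g \<in> Mor D \<Longrightarrow> mormap1 G g \<in> Mor C"
    using mor by (auto simp: G_def f_inv_into_f inv_into_into)
  have hom: "mormap1 G g \<in> Hom1 C (obmap1 G X) (obmap1 G Y)" if "g \<in> Hom1 D X Y" for g X Y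
  proof -
    have g: "g \<in> Mor D" "sce D g = X" "tgt D g = Y" using that by (auto simp: Hom1_def)
    \<comment> \<open>Source and target of \<open>mormap1 G g\<close> become visible only after
      applying \<open>H\<close>; the left inverse on objects then recovers them.\<close>
    have "mormap1 H (mormap1 G g) \<in> Hom1 D (obmap1 H (sce C (mormap1 G g)))
        (obmap1 H (tgt C (mormap1 G g)))"
      by (rule mormap1) (use g in \<open>simp add: Hom1_def\<close>)
    with g have "obmap1 H (sce C (mormap1 G g)) = X" "obmap1 H (tgt C (mormap1 G g)) = Y"
      by (auto simp: Hom1_def)
    then show ?thesis using g C.sce_Ob C.tgt_Ob by (auto simp: Hom1_def)
  qed
  have "functor1 D C G"
  proof
    fix X assume X: "X \<in> Ob D"
    then have "mormap1 H (one C (obmap1 G X)) = one D X" by (simp add: mormap1_one)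
    moreover have "one C (obmap1 G X) \<in> Mor C" using C.one_Hom [of "obmap1 G X"] X
      by (simp add: Hom1_def)
    ultimately show "mormap1 G (one D X) = one C (obmap1 G X)" by (metis mor_inv(1))
  next
    fix f g X Y Z assume fg: "f \<in> Hom1 D X Y" "g \<in> Hom1 D Y Z"
    have "mormap1 H (cmp1 C (mormap1 G g) (mormap1 G f)) = cmp1 D g f"
      using mormap1_cmp1 [OF hom [OF fg(1)] hom [OF fg(2)]] fg by (simp add: Hom1_def)
    moreover have "cmp1 C (mormap1 G g) (mormap1 G f) \<in> Mor C"
      using C.cmp1_Hom [OF hom [OF fg(1)] hom [OF fg(2)]] by (simp add: Hom1_def)
    ultimately show "mormap1 G (cmp1 D g f) = cmp1 C (mormap1 G g) (mormap1 G f)"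
      by (metis mor_inv(1))
  qed (auto intro: hom)
  then show "isomorphism_of_categories C D H"
    unfolding isomorphism_of_categories_def using functor1_axioms by (intro conjI exI [of _ G]) auto
qed


section \<open>Opcones and universality\<close>

context two_functor
begin

lemma opcones_iff:
  "\<theta> \<in> opcones C \<Sigma> D F E \<longleftrightarrow>
     leg \<theta> \<in> extensional (Obj C) \<and> legcell \<theta> \<in> extensional (Arr C) \<and>
     (\<forall>X\<in>Obj C. leg \<theta> X \<in> Arr D \<and> src D (leg \<theta> X) = E \<and> trg D (leg \<theta> X) = obmap F X) \<and>
     (\<forall>f\<in>Arr C. legcell \<theta> f \<in> Cell D \<and> Dom D (legcell \<theta> f) = leg \<theta> (trg C f) \<and>
        Cod D (legcell \<theta> f) = arrmap F f \<cdot>\<^bsub>D\<^esub> leg \<theta> (src C f)) \<and>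
     (\<forall>X\<in>Obj C. legcell \<theta> (ide C X) = idc D (leg \<theta> X)) \<and>
     (\<forall>f\<in>Arr C. \<forall>g\<in>Arr C. src C g = trg C f \<longrightarrow>
        legcell \<theta> (g \<cdot>\<^bsub>C\<^esub> f) = (idc D (arrmap F g) \<star>\<^bsub>D\<^esub> legcell \<theta> f) \<bullet>\<^bsub>D\<^esub> legcell \<theta> g) \<and>
     (\<forall>\<gamma>\<in>Cell C. legcell \<theta> (Cod C \<gamma>) =
        (cellmap F \<gamma> \<star>\<^bsub>D\<^esub> idc D (leg \<theta> (src C (Dom C \<gamma>)))) \<bullet>\<^bsub>D\<^esub> legcell \<theta> (Dom C \<gamma>)) \<and>
     (\<forall>f\<in>\<Sigma>. is_identity_cell D (legcell \<theta> f))"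
  unfolding opcones_def oplax_cones_def mem_Collect_eq PiE_iff Hom_def Cells_def
  by (auto simp: C.Cod_Arr C.Dom_Arr)

lemma opcone_mors_iff:
  "\<mu> \<in> opcone_mors C \<Sigma> D F E \<longleftrightarrow>
     mdom \<mu> \<in> opcones C \<Sigma> D F E \<and> mcod \<mu> \<in> opcones C \<Sigma> D F E \<and>
     mcell \<mu> \<in> extensional (Obj C) \<and>
     (\<forall>X\<in>Obj C. mcell \<mu> X \<in> Cell D \<and> Dom D (mcell \<mu> X) = leg (mdom \<mu>) X \<and>
        Cod D (mcell \<mu> X) = leg (mcod \<mu>) X) \<and>
     (\<forall>f\<in>Arr C. (idc D (arrmap F f) \<star>\<^bsub>D\<^esub> mcell \<mu> (src C f)) \<bullet>\<^bsub>D\<^esub> legcell (mdom \<mu>) f =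
        legcell (mcod \<mu>) f \<bullet>\<^bsub>D\<^esub> mcell \<mu> (trg C f))"
  unfolding opcone_mors_def mem_Collect_eq PiE_iff Hom_def Cells_def
  by auto

lemma opcone_simps:
  assumes "\<theta> \<in> opcones C \<Sigma> D F E"
  shows "X \<in> Obj C \<Longrightarrow> leg \<theta> X \<in> Arr D" "X \<in> Obj C \<Longrightarrow> src D (leg \<theta> X) = E"
    "X \<in> Obj C \<Longrightarrow> trg D (leg \<theta> X) = obmap F X"
    "f \<in> Arr C \<Longrightarrow> legcell \<theta> f \<in> Cell D" "f \<in> Arr C \<Longrightarrow> Dom D (legcell \<theta> f) = leg \<theta> (trg C f)"
    "f \<in> Arr C \<Longrightarrow> Cod D (legcell \<theta> f) = arrmap F f \<cdot>\<^bsub>D\<^esub> leg \<theta> (src C f)"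
    "X \<in> Obj C \<Longrightarrow> legcell \<theta> (ide C X) = idc D (leg \<theta> X)"
    "\<lbrakk>f \<in> Arr C; g \<in> Arr C; src C g = trg C f\<rbrakk> \<Longrightarrow>
       legcell \<theta> (g \<cdot>\<^bsub>C\<^esub> f) = (idc D (arrmap F g) \<star>\<^bsub>D\<^esub> legcell \<theta> f) \<bullet>\<^bsub>D\<^esub> legcell \<theta> g"
  using assms by (auto simp: opcones_iff)

lemma opcone_cell:
  assumes "\<theta> \<in> opcones C \<Sigma> D F E" "\<gamma> \<in> Cell C"
  shows "legcell \<theta> (Cod C \<gamma>) =
    (cellmap F \<gamma> \<star>\<^bsub>D\<^esub> idc D (leg \<theta> (src C (Dom C \<gamma>)))) \<bullet>\<^bsub>D\<^esub> legcell \<theta> (Dom C \<gamma>)"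
  using assms by (auto simp: opcones_iff)

text \<open>An identity 2-cell has equal domain and codomain, so along \<Sigma> the legs of an
  opcone commute strictly. For the initial arrows this expresses every leg through one at an initial
  object.\<close>

lemma opcone_sigma:
  assumes "\<theta> \<in> opcones C \<Sigma> D F E" "f \<in> Arr C" "f \<in> \<Sigma>"
  shows "legcell \<theta> f = idc D (leg \<theta> (trg C f))"
    "leg \<theta> (trg C f) = arrmap F f \<cdot>\<^bsub>D\<^esub> leg \<theta> (src C f)"
  using assms D.identity_cell [of "legcell \<theta> f"] by (auto simp: opcones_iff)

lemma category_opcone_cat: "category (opcone_cat C \<Sigma> D F E)"
proof
  fix \<theta> assume "\<theta> \<in> Ob (opcone_cat C \<Sigma> D F E)"
  then have [simp]: "\<theta> \<in> opcones C \<Sigma> D F E" by (simp add: opcone_cat_def)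
  note [simp] = opcone_simps [OF this]
  show "one (opcone_cat C \<Sigma> D F E) \<theta> \<in> Hom1 (opcone_cat C \<Sigma> D F E) \<theta> \<theta>"
    by (simp add: opcone_cat_def Hom1_def opcone_mors_iff)
next
  fix \<mu> \<nu> \<theta> \<theta>' \<theta>''
  assume "\<mu> \<in> Hom1 (opcone_cat C \<Sigma> D F E) \<theta> \<theta>'" "\<nu> \<in> Hom1 (opcone_cat C \<Sigma> D F E) \<theta>' \<theta>''"
  then have mors: "\<mu> \<in> opcone_mors C \<Sigma> D F E" "\<nu> \<in> opcone_mors C \<Sigma> D F E"
    and [simp]: "mdom \<mu> = \<theta>" "mcod \<mu> = \<theta>'" "mdom \<nu> = \<theta>'" "mcod \<nu> = \<theta>''"
    by (auto simp: opcone_cat_def Hom1_def)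
  then have [simp]: "\<theta> \<in> opcones C \<Sigma> D F E" "\<theta>' \<in> opcones C \<Sigma> D F E" "\<theta>'' \<in> opcones C \<Sigma> D F E"
    by (auto simp: opcone_mors_iff)
  note [simp] = opcone_simps [OF this(1)] opcone_simps [OF this(2)] opcone_simps [OF this(3)]
  have [simp]: "mcell \<mu> X \<in> Cell D" "Dom D (mcell \<mu> X) = leg \<theta> X" "Cod D (mcell \<mu> X) = leg \<theta>' X"
    "mcell \<nu> X \<in> Cell D" "Dom D (mcell \<nu> X) = leg \<theta>' X" "Cod D (mcell \<nu> X) = leg \<theta>'' X"
    if "X \<in> Obj C" for X
    using mors that by (auto simp: opcone_mors_iff)
  have nat: "(idc D (arrmap F f) \<star>\<^bsub>D\<^esub> (mcell \<nu> (src C f) \<bullet>\<^bsub>D\<^esub> mcell \<mu> (src C f))) \<bullet>\<^bsub>D\<^esub> legcell \<theta> f =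
      legcell \<theta>'' f \<bullet>\<^bsub>D\<^esub> (mcell \<nu> (trg C f) \<bullet>\<^bsub>D\<^esub> mcell \<mu> (trg C f))" if f: "f \<in> Arr C" for f
  proof -
    have \<mu>\<nu>: "(idc D (arrmap F f) \<star>\<^bsub>D\<^esub> mcell \<mu> (src C f)) \<bullet>\<^bsub>D\<^esub> legcell \<theta> f =
        legcell \<theta>' f \<bullet>\<^bsub>D\<^esub> mcell \<mu> (trg C f)"
      "(idc D (arrmap F f) \<star>\<^bsub>D\<^esub> mcell \<nu> (src C f)) \<bullet>\<^bsub>D\<^esub> legcell \<theta>' f =
          legcell \<theta>'' f \<bullet>\<^bsub>D\<^esub> mcell \<nu> (trg C f)"
      using mors f by (auto simp: opcone_mors_iff)
    show ?thesis
      using f by (simp add: \<mu>\<nu>(1) D.vcmp_square [OF \<mu>\<nu>(2)])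
  qed
  have *: "\<lparr>mdom = \<theta>, mcod = \<theta>'', mcell = \<lambda>X\<in>Obj C. mcell \<nu> X \<bullet>\<^bsub>D\<^esub> mcell \<mu> X\<rparr>
      \<in> opcone_mors C \<Sigma> D F E"
    unfolding opcone_mors_iff using nat by (simp del: D.whisker_vcmp)
  then show "cmp1 (opcone_cat C \<Sigma> D F E) \<nu> \<mu> \<in> Hom1 (opcone_cat C \<Sigma> D F E) \<theta> \<theta>''"
    by (simp add: opcone_cat_def Hom1_def)
next
  fix \<mu> \<theta> \<theta>' assume "\<mu> \<in> Hom1 (opcone_cat C \<Sigma> D F E) \<theta> \<theta>'"
  then show "cmp1 (opcone_cat C \<Sigma> D F E) \<mu> (one (opcone_cat C \<Sigma> D F E) \<theta>) = \<mu>"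
    "cmp1 (opcone_cat C \<Sigma> D F E) (one (opcone_cat C \<Sigma> D F E) \<theta>') \<mu> = \<mu>"
    by (auto simp: opcone_cat_def Hom1_def opcone_mors_iff intro!: opcone_mor.equality
        extensionalityI)
next
  fix \<mu> \<nu> \<rho> \<theta> \<theta>' \<theta>'' \<theta>'''
  assume "\<mu> \<in> Hom1 (opcone_cat C \<Sigma> D F E) \<theta> \<theta>'" "\<nu> \<in> Hom1 (opcone_cat C \<Sigma> D F E) \<theta>' \<theta>''"
    "\<rho> \<in> Hom1 (opcone_cat C \<Sigma> D F E) \<theta>'' \<theta>'''"
  then show "cmp1 (opcone_cat C \<Sigma> D F E) \<rho> (cmp1 (opcone_cat C \<Sigma> D F E) \<nu> \<mu>) =
      cmp1 (opcone_cat C \<Sigma> D F E) (cmp1 (opcone_cat C \<Sigma> D F E) \<rho> \<nu>) \<mu>"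
    by (auto simp: opcone_cat_def Hom1_def opcone_mors_iff intro!: restrict_ext)
qed (auto simp: opcone_cat_def Hom1_def opcone_mors_iff)

section \<open>Composition with an opcone as a functor\<close>

context
  fixes \<Sigma> L \<pi>
  assumes \<pi>: "\<pi> \<in> opcones C \<Sigma> D F L" and \<Sigma>: "\<Sigma> \<subseteq> Arr C"
begin

lemma cone_comp_opcone:
  assumes \<phi>: "\<phi> \<in> Hom D E L"
  shows "cone_comp C D \<pi> \<phi> \<in> opcones C \<Sigma> D F E"
proof -
  note [simp] = opcone_simps [OF \<pi>]
  have [simp]: "\<phi> \<in> Arr D" "src D \<phi> = E" "trg D \<phi> = L" using \<phi> by (auto simp: D.Hom_iff)
  have "is_identity_cell D (legcell \<pi> f \<star>\<^bsub>D\<^esub> idc D \<phi>)" if f: "f \<in> \<Sigma>" for f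
  proof -
    have [simp]: "f \<in> Arr C" using f \<Sigma> by blast
    show ?thesis
      using opcone_sigma(1) [OF \<pi> _ f]
          by (auto simp: is_identity_cell_def intro!: bexI [of _ "leg \<pi> (trg C f) \<cdot>\<^bsub>D\<^esub> \<phi>"])
  qed
  then show ?thesis
    unfolding opcones_iff using \<Sigma>
    by (auto simp: cone_comp_def opcone_cell [OF \<pi>])
qed

lemma cone_comp_mor:
  assumes \<beta>: "\<beta> \<in> Cell D" "Dom D \<beta> \<in> Hom D E L"
  shows "mormap1 (cone_comp_functor C D \<pi>) \<beta> \<in> opcone_mors C \<Sigma> D F E"
proof -
  note [simp] = opcone_simps [OF \<pi>]
  have [simp]: "\<beta> \<in> Cell D" "src D (Dom D \<beta>) = E" "trg D (Dom D \<beta>) = L" using \<beta>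
    by (auto simp: D.Hom_iff)
  have "Cod D \<beta> \<in> Hom D E L" by (simp add: D.Hom_iff)
  \<comment> \<open>Naturality of the whiskered family is the exchange law for
    \<open>legcell \<pi> f\<close> and \<open>\<beta>\<close>.\<close>
  moreover have "(idc D (arrmap F f \<cdot>\<^bsub>D\<^esub> leg \<pi> (src C f)) \<star>\<^bsub>D\<^esub> \<beta>) \<bullet>\<^bsub>D\<^esub> (legcell \<pi> f \<star>\<^bsub>D\<^esub> idc D (Dom D \<beta>)) =
         (legcell \<pi> f \<star>\<^bsub>D\<^esub> idc D (Cod D \<beta>)) \<bullet>\<^bsub>D\<^esub> (idc D (leg \<pi> (trg C f)) \<star>\<^bsub>D\<^esub> \<beta>)" if "f \<in> Arr C" for f
    using that D.exchange [of \<beta> "legcell \<pi> f"] by simp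
  ultimately show ?thesis
    using \<beta> cone_comp_opcone unfolding opcone_mors_iff
    by (auto simp: cone_comp_functor_def cone_comp_def)
qed

lemma functor1_cone_comp:
  "functor1 (hom_cat D E L) (opcone_cat C \<Sigma> D F E) (cone_comp_functor C D \<pi>)"
proof -
  note [simp] = opcone_simps [OF \<pi>]
  interpret hc: category "hom_cat D E L" by (rule D.category_hom_cat)
  interpret oc: category "opcone_cat C \<Sigma> D F E" by (rule category_opcone_cat)
  show ?thesis
  proof
    show "obmap1 (cone_comp_functor C D \<pi>) \<phi> \<in> Ob (opcone_cat C \<Sigma> D F E)"
        if "\<phi> \<in> Ob (hom_cat D E L)" for \<phi>
      using that cone_comp_opcone by (simp add: hom_cat_def opcone_cat_def cone_comp_functor_def)
  next
    fix \<beta> X Y assume "\<beta> \<in> Hom1 (hom_cat D E L) X Y"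
    then show "mormap1 (cone_comp_functor C D \<pi>) \<beta> \<in> Hom1 (opcone_cat C \<Sigma> D F E)
        (obmap1 (cone_comp_functor C D \<pi>) X) (obmap1 (cone_comp_functor C D \<pi>) Y)"
      using cone_comp_mor [of \<beta> E]
          by (auto simp: hom_cat_def opcone_cat_def cone_comp_functor_def Hom1_def)
  qed (auto simp: hom_cat_def opcone_cat_def cone_comp_functor_def Hom1_def D.Hom_iff cone_comp_def
      intro!: restrict_ext)
qed

text \<open>By \<open>isomorphism_of_categories_iff_bij\<close> it is enough that composition with
  \<open>\<pi>\<close> is bijective on arrows and on 2-cells. The 2-cell conditions may fix the
  boundary \<open>z\<close>, \<open>z'\<close>, because \<open>ex\<close> and \<open>inj\<close>
  determine it from the cones.\<close>

lemma is_oplimitI: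
  assumes L: "L \<in> Obj D"
    and ex: "\<And>E \<theta>. \<lbrakk>E \<in> Obj D; \<theta> \<in> opcones C \<Sigma> D F E\<rbrakk> \<Longrightarrow> \<exists>z\<in>Hom D E L. cone_comp C D \<pi> z = \<theta>"
    and inj: "\<And>E z z'. \<lbrakk>E \<in> Obj D; z \<in> Hom D E L; z' \<in> Hom D E L; cone_comp C D \<pi> z =
        cone_comp C D \<pi> z'\<rbrakk> \<Longrightarrow> z = z'"
    and ex2: "\<And>E z z' \<mu>. \<lbrakk>E \<in> Obj D; z \<in> Hom D E L; z' \<in> Hom D E L; \<mu> \<in> opcone_mors C \<Sigma> D F E;
        mdom \<mu> = cone_comp C D \<pi> z; mcod \<mu> = cone_comp C D \<pi> z'\<rbrakk> \<Longrightarrow>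
        \<exists>\<beta>\<in>Cells D z z'. \<forall>X\<in>Obj C. idc D (leg \<pi> X) \<star>\<^bsub>D\<^esub> \<beta> = mcell \<mu> X"
    and inj2: "\<And>E z z' \<beta> \<beta>'. \<lbrakk>E \<in> Obj D; z \<in> Hom D E L; z' \<in> Hom D E L; \<beta> \<in> Cells D z z';
        \<beta>' \<in> Cells D z z';
        \<And>X. X \<in> Obj C \<Longrightarrow> idc D (leg \<pi> X) \<star>\<^bsub>D\<^esub> \<beta> = idc D (leg \<pi> X) \<star>\<^bsub>D\<^esub> \<beta>'\<rbrakk> \<Longrightarrow> \<beta> = \<beta>'"
  shows "is_oplimit C \<Sigma> D F L \<pi>"
proof -
  have "bij_betw (obmap1 (cone_comp_functor C D \<pi>)) (Ob (hom_cat D E L))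
      (Ob (opcone_cat C \<Sigma> D F E))"
    if E: "E \<in> Obj D" for E
    unfolding bij_betw_def
    using E ex [OF E] inj [OF E] cone_comp_opcone [of _ E]
    by (auto simp: hom_cat_def opcone_cat_def cone_comp_functor_def inj_on_def image_iff)
  moreover have
      "bij_betw (mormap1 (cone_comp_functor C D \<pi>)) (Mor (hom_cat D E L)) (Mor (opcone_cat C \<Sigma> D F
          E))"
    if E: "E \<in> Obj D" for E
    unfolding bij_betw_def
  proof
    show "inj_on (mormap1 (cone_comp_functor C D \<pi>)) (Mor (hom_cat D E L))"
    proof (rule inj_onI)
      fix \<beta> \<beta>' assume b: "\<beta> \<in> Mor (hom_cat D E L)" "\<beta>' \<in> Mor (hom_cat D E L)"
        and eq: "mormap1 (cone_comp_functor C D \<pi>) \<beta> = mormap1 (cone_comp_functor C D \<pi>) \<beta>'"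
      from eq have 1: "cone_comp C D \<pi> (Dom D \<beta>) = cone_comp C D \<pi> (Dom D \<beta>')"
        "cone_comp C D \<pi> (Cod D \<beta>) = cone_comp C D \<pi> (Cod D \<beta>')"
        by (simp_all add: cone_comp_functor_def)
      have 2: "idc D (leg \<pi> X) \<star>\<^bsub>D\<^esub> \<beta> = idc D (leg \<pi> X) \<star>\<^bsub>D\<^esub> \<beta>'" if "X \<in> Obj C" for X
        using fun_cong [OF arg_cong [OF eq, of mcell], of X] that
            by (simp add: cone_comp_functor_def)
      have hom: "Dom D \<beta> \<in> Hom D E L" "Cod D \<beta> \<in> Hom D E L" "Dom D \<beta>' \<in> Hom D E L"
          "Cod D \<beta>' \<in> Hom D E L"
        "\<beta> \<in> Cell D" "\<beta>' \<in> Cell D"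
        using b by (auto simp: hom_cat_def)
      have "Dom D \<beta> = Dom D \<beta>'" "Cod D \<beta> = Cod D \<beta>'"
        using 1 hom inj [OF E] by blast+
      then show "\<beta> = \<beta>'"
        using inj2 [OF E hom(1,2)] hom 2 by (auto simp: D.Cells_iff)
    qed
    show "mormap1 (cone_comp_functor C D \<pi>) ` Mor (hom_cat D E L) = Mor (opcone_cat C \<Sigma> D F E)"
    proof (intro equalityI subsetI)
      fix \<mu> assume "\<mu> \<in> mormap1 (cone_comp_functor C D \<pi>) ` Mor (hom_cat D E L)"
      then show "\<mu> \<in> Mor (opcone_cat C \<Sigma> D F E)"
        using cone_comp_mor [of _ E] by (auto simp: hom_cat_def opcone_cat_def)
    next
      fix \<mu> assume "\<mu> \<in> Mor (opcone_cat C \<Sigma> D F E)"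
      then have \<mu>: "\<mu> \<in> opcone_mors C \<Sigma> D F E" by (simp add: opcone_cat_def)
      then obtain z z' where z: "z \<in> Hom D E L" "z' \<in> Hom D E L"
          "mdom \<mu> = cone_comp C D \<pi> z" "mcod \<mu> = cone_comp C D \<pi> z'"
        using ex [OF E] unfolding opcone_mors_iff by metis
      from ex2 [OF E z(1,2) \<mu> z(3,4)] obtain \<beta> where
        \<beta>: "\<beta> \<in> Cells D z z'" "\<forall>X\<in>Obj C. idc D (leg \<pi> X) \<star>\<^bsub>D\<^esub> \<beta> = mcell \<mu> X" by blast
      have "mormap1 (cone_comp_functor C D \<pi>) \<beta> = \<mu>"
        using \<beta> z \<mu> unfolding opcone_mors_iff
        by (auto simp: cone_comp_functor_def D.Cells_iff intro!: opcone_mor.equality extensionalityI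
            [of _ "Obj C"])
      then show "\<mu> \<in> mormap1 (cone_comp_functor C D \<pi>) ` Mor (hom_cat D E L)"
        using \<beta> z by (intro image_eqI [of _ _ \<beta>]) (auto simp: hom_cat_def D.Cells_iff)
    qed
  qed
  ultimately show ?thesis
    unfolding is_oplimit_def isomorphism_of_categories_iff_bij
    using L \<pi> functor1_cone_comp by blast
qed

end

lemma is_oplimitD:
  assumes lim: "is_oplimit C \<Sigma> D F L \<pi>"
  shows "L \<in> Obj D" "\<pi> \<in> opcones C \<Sigma> D F L"
    and "\<lbrakk>E \<in> Obj D; \<theta> \<in> opcones C \<Sigma> D F E\<rbrakk> \<Longrightarrow> \<exists>z\<in>Hom D E L. cone_comp C D \<pi> z = \<theta>"
    and "\<lbrakk>E \<in> Obj D; z \<in> Hom D E L; z' \<in> Hom D E L; cone_comp C D \<pi> z = cone_comp C D \<pi> z'\<rbrakk> \<Longrightarrow> z =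
        z'"
    and "\<lbrakk>E \<in> Obj D; z \<in> Hom D E L; z' \<in> Hom D E L; \<mu> \<in> opcone_mors C \<Sigma> D F E;
        mdom \<mu> = cone_comp C D \<pi> z; mcod \<mu> = cone_comp C D \<pi> z'\<rbrakk> \<Longrightarrow>
        \<exists>\<beta>\<in>Cells D z z'. \<forall>X\<in>Obj C. idc D (leg \<pi> X) \<star>\<^bsub>D\<^esub> \<beta> = mcell \<mu> X"
    and "\<lbrakk>E \<in> Obj D; z \<in> Hom D E L; z' \<in> Hom D E L; \<beta> \<in> Cells D z z'; \<beta>' \<in> Cells D z z';
        \<And>X. X \<in> Obj C \<Longrightarrow> idc D (leg \<pi> X) \<star>\<^bsub>D\<^esub> \<beta> = idc D (leg \<pi> X) \<star>\<^bsub>D\<^esub> \<beta>'\<rbrakk> \<Longrightarrow> \<beta> = \<beta>'"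
proof -
  have bij: "bij_betw (cone_comp C D \<pi>) (Hom D E L) (opcones C \<Sigma> D F E)"
    "bij_betw (mormap1 (cone_comp_functor C D \<pi>))
      {\<alpha> \<in> Cell D. Dom D \<alpha> \<in> Hom D E L \<and> Cod D \<alpha> \<in> Hom D E L}
          (opcone_mors C \<Sigma> D F E)" if "E \<in> Obj D" for E
    using lim that unfolding is_oplimit_def isomorphism_of_categories_iff_bij
    by (auto simp: hom_cat_def opcone_cat_def cone_comp_functor_def)
  show "L \<in> Obj D" "\<pi> \<in> opcones C \<Sigma> D F L" using lim by (auto simp: is_oplimit_def)
  show "\<exists>z\<in>Hom D E L. cone_comp C D \<pi> z = \<theta>" if "E \<in> Obj D" "\<theta> \<in> opcones C \<Sigma> D F E"
    using bij_betw_imp_surj_on [OF bij(1) [OF that(1)]] that(2) by (metis imageE)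
  show inj: "z = z'" if "E \<in> Obj D" "z \<in> Hom D E L" "z' \<in> Hom D E L"
      "cone_comp C D \<pi> z = cone_comp C D \<pi> z'" for z z'
    using bij(1) [OF that(1)] that(2-) by (auto simp: bij_betw_def inj_on_def)
  show "\<exists>\<beta>\<in>Cells D z z'. \<forall>X\<in>Obj C. idc D (leg \<pi> X) \<star>\<^bsub>D\<^esub> \<beta> = mcell \<mu> X"
    if E: "E \<in> Obj D" and z: "z \<in> Hom D E L" "z' \<in> Hom D E L" and \<mu>: "\<mu> \<in> opcone_mors C \<Sigma> D F E"
        "mdom \<mu> = cone_comp C D \<pi> z" "mcod \<mu> = cone_comp C D \<pi> z'"
  proof -
    have "\<mu> \<in> mormap1 (cone_comp_functor C D \<pi>) ` {\<alpha> \<in> Cell D. Dom D \<alpha> \<in> Hom D E L \<and>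
        Cod D \<alpha> \<in> Hom D E L}"
      unfolding bij_betw_imp_surj_on [OF bij(2) [OF E]] by (rule \<mu>(1))
    then obtain \<beta> where \<beta>: "\<beta> \<in> Cell D" "Dom D \<beta> \<in> Hom D E L" "Cod D \<beta> \<in> Hom D E L"
        "mormap1 (cone_comp_functor C D \<pi>) \<beta> = \<mu>"
      by blast
    \<comment> \<open>The preimage \<open>\<beta>\<close> comes with unknown ends; they induce the
      same cones as \<open>z\<close> and \<open>z'\<close>, so \<open>inj\<close> identifies
      them.\<close>
    then have "Dom D \<beta> = z" "Cod D \<beta> = z'"
      using \<mu> z inj [OF E] by (auto simp: cone_comp_functor_def)
    then show ?thesis
      using \<beta> by (intro bexI [of _ \<beta>]) (auto simp: D.Cells_iff cone_comp_functor_def)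
  qed
  show "\<beta> = \<beta>'" if E: "E \<in> Obj D" and z: "z \<in> Hom D E L" "z' \<in> Hom D E L"
      "\<beta> \<in> Cells D z z'" "\<beta>' \<in> Cells D z z'"
      and eq: "\<And>X. X \<in> Obj C \<Longrightarrow> idc D (leg \<pi> X) \<star>\<^bsub>D\<^esub> \<beta> = idc D (leg \<pi> X) \<star>\<^bsub>D\<^esub> \<beta>'"
  proof -
    have "mormap1 (cone_comp_functor C D \<pi>) \<beta> = mormap1 (cone_comp_functor C D \<pi>) \<beta>'"
      using z eq by (auto simp: cone_comp_functor_def D.Cells_iff intro!: restrict_ext)
    then show ?thesis
      using bij(2) [OF E] z by (auto simp: bij_betw_def inj_on_def D.Cells_iff)
  qed
qed

section \<open>Uniqueness of oplimits and transport along isomorphisms\<close>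

lemma cone_comp_ide:
  assumes "\<pi> \<in> opcones C \<Sigma> D F L"
  shows "cone_comp C D \<pi> (ide D L) = \<pi>"
proof -
  note [simp] = opcone_simps [OF assms]
  have "legcell \<pi> f \<star>\<^bsub>D\<^esub> idc D (ide D L) = legcell \<pi> f" if "f \<in> Arr C" for f
    using that by simp
  moreover have "leg \<pi> \<in> extensional (Obj C)" "legcell \<pi> \<in> extensional (Arr C)"
    using assms by (auto simp: opcones_iff)
  ultimately show ?thesis
    by (intro opcone.equality extensionalityI [of _ "Obj C"] extensionalityI [of _ "Arr C"])
      (auto simp: cone_comp_def)
qed

lemma cone_comp_cmp:
  assumes "\<pi> \<in> opcones C \<Sigma> D F L" "u \<in> Hom D E L" "v \<in> Hom D E' E"
  shows "cone_comp C D (cone_comp C D \<pi> u) v = cone_comp C D \<pi> (u \<cdot>\<^bsub>D\<^esub> v)"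
  using opcone_simps [OF assms(1)] assms(2,3)
  by (auto simp: cone_comp_def D.Hom_iff intro!: restrict_ext)

lemma oplimit_unique:
  assumes lim: "is_oplimit C \<Sigma> D F L \<pi>" and lim': "is_oplimit C \<Sigma> D F L' \<pi>'" and \<Sigma>: "\<Sigma> \<subseteq> Arr C"
  obtains u v where "u \<in> Hom D L' L" "v \<in> Hom D L L'" "u \<cdot>\<^bsub>D\<^esub> v = ide D L" "v \<cdot>\<^bsub>D\<^esub> u = ide D L'"
    "cone_comp C D \<pi> u = \<pi>'"
proof -
  note L = is_oplimitD [OF lim] and L' = is_oplimitD [OF lim']
  obtain u where u: "u \<in> Hom D L' L" "cone_comp C D \<pi> u = \<pi>'"
    using L(3) [OF L'(1,2)] by blast
  obtain v where v: "v \<in> Hom D L L'" "cone_comp C D \<pi>' v = \<pi>"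
    using L'(3) [OF L(1,2)] by blast
  have "cone_comp C D \<pi> (u \<cdot>\<^bsub>D\<^esub> v) = cone_comp C D \<pi> (ide D L)"
    using cone_comp_cmp [OF L(2) u(1) v(1)] u v cone_comp_ide [OF L(2)] by simp
  then have "u \<cdot>\<^bsub>D\<^esub> v = ide D L"
    using L(1) u v by (intro L(4) [OF L(1)]) (auto simp: D.Hom_iff)
  moreover have "cone_comp C D \<pi>' (v \<cdot>\<^bsub>D\<^esub> u) = cone_comp C D \<pi>' (ide D L')"
    using cone_comp_cmp [OF L'(2) v(1) u(1)] u v cone_comp_ide [OF L'(2)] by simp
  then have "v \<cdot>\<^bsub>D\<^esub> u = ide D L'"
    using L'(1) u v by (intro L'(4) [OF L'(1)]) (auto simp: D.Hom_iff)
  ultimately show ?thesis using that u v by blast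
qed

text \<open>Factorizations through the new cone are those through \<open>\<pi>\<close> composed with
  \<open>v\<close>. This serves preservation, which concerns an arbitrary limit of algebras, only
  isomorphic to the constructed one.\<close>

lemma oplimit_transport:
  assumes lim: "is_oplimit C \<Sigma> D F L \<pi>" and \<Sigma>: "\<Sigma> \<subseteq> Arr C"
    and u: "u \<in> Hom D L' L" and v: "v \<in> Hom D L L'"
    and uv: "u \<cdot>\<^bsub>D\<^esub> v = ide D L" and vu: "v \<cdot>\<^bsub>D\<^esub> u = ide D L'"
  shows "is_oplimit C \<Sigma> D F L' (cone_comp C D \<pi> u)"
proof -
  note L = is_oplimitD [OF lim]
  note [simp] = opcone_simps [OF L(2)]
  have [simp]: "u \<in> Arr D" "src D u = L'" "trg D u = L" "v \<in> Arr D" "src D v = L" "trg D v = L'"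
    using u v by (auto simp: D.Hom_iff)
  have L': "L' \<in> Obj D" using D.src_Obj [of u] by simp
  have [simp]: "u \<cdot>\<^bsub>D\<^esub> (v \<cdot>\<^bsub>D\<^esub> z) = z" if "z \<in> Arr D" "trg D z = L" for z
    using D.cmp_assoc' [of z v u] uv that by simp
  have [simp]: "v \<cdot>\<^bsub>D\<^esub> (u \<cdot>\<^bsub>D\<^esub> z) = z" if "z \<in> Arr D" "trg D z = L'" for z
    using D.cmp_assoc' [of z u v] vu that by simp
  note cc = cone_comp_cmp [OF L(2) u]
  show ?thesis
  proof (rule is_oplimitI [OF cone_comp_opcone [OF L(2) \<Sigma> u] \<Sigma> L'])
    fix E \<theta> assume E: "E \<in> Obj D" "\<theta> \<in> opcones C \<Sigma> D F E"
    from L(3) [OF E] obtain z where z: "z \<in> Hom D E L" "cone_comp C D \<pi> z = \<theta>" by blast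
    then show "\<exists>z\<in>Hom D E L'. cone_comp C D (cone_comp C D \<pi> u) z = \<theta>"
      by (intro bexI [of _ "v \<cdot>\<^bsub>D\<^esub> z"]) (auto simp: cc [where E' = E] D.Hom_iff)
  next
    fix E z z' assume E: "E \<in> Obj D" and z: "z \<in> Hom D E L'" "z' \<in> Hom D E L'"
      and "cone_comp C D (cone_comp C D \<pi> u) z = cone_comp C D (cone_comp C D \<pi> u) z'"
    then have "cone_comp C D \<pi> (u \<cdot>\<^bsub>D\<^esub> z) = cone_comp C D \<pi> (u \<cdot>\<^bsub>D\<^esub> z')"
      by (simp add: cc)
    then have "u \<cdot>\<^bsub>D\<^esub> z = u \<cdot>\<^bsub>D\<^esub> z'"
      using z by (intro L(4) [OF E]) (auto simp: D.Hom_iff)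
    then have "v \<cdot>\<^bsub>D\<^esub> (u \<cdot>\<^bsub>D\<^esub> z) = v \<cdot>\<^bsub>D\<^esub> (u \<cdot>\<^bsub>D\<^esub> z')" by simp
    then show "z = z'" using z by (simp add: D.Hom_iff)
  next
    fix E z z' \<mu> assume E: "E \<in> Obj D" and z: "z \<in> Hom D E L'" "z' \<in> Hom D E L'"
      and \<mu>: "\<mu> \<in> opcone_mors C \<Sigma> D F E" "mdom \<mu> = cone_comp C D (cone_comp C D \<pi> u) z"
        "mcod \<mu> = cone_comp C D (cone_comp C D \<pi> u) z'"
    have "u \<cdot>\<^bsub>D\<^esub> z \<in> Hom D E L" "u \<cdot>\<^bsub>D\<^esub> z' \<in> Hom D E L" using z by (auto simp: D.Hom_iff)
    from L(5) [OF E this \<mu>(1)] \<mu> z obtain \<beta> where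
      \<beta>: "\<beta> \<in> Cells D (u \<cdot>\<^bsub>D\<^esub> z) (u \<cdot>\<^bsub>D\<^esub> z')" "\<forall>X\<in>Obj C. idc D (leg \<pi> X) \<star>\<^bsub>D\<^esub> \<beta> = mcell \<mu> X"
      by (auto simp: cc)
    \<comment> \<open>The given \<open>\<beta>\<close> lies between composites with
      \<open>u\<close>; whiskering with the inverse \<open>v\<close> brings it back to
      \<open>z\<close> and \<open>z'\<close>.\<close>
    have "idc D v \<star>\<^bsub>D\<^esub> \<beta> \<in> Cells D z z'"
      using \<beta>(1) z by (simp add: D.Cells_iff D.Hom_iff)
    moreover have "idc D (leg (cone_comp C D \<pi> u) X) \<star>\<^bsub>D\<^esub> (idc D v \<star>\<^bsub>D\<^esub> \<beta>) = mcell \<mu> X" if "X \<in> Obj C"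
        for X
    proof -
      have "trg D (Dom D \<beta>) = L" "\<beta> \<in> Cell D" using \<beta>(1) z by (auto simp: D.Cells_iff D.Hom_iff)
      then have "idc D (leg (cone_comp C D \<pi> u) X) \<star>\<^bsub>D\<^esub> (idc D v \<star>\<^bsub>D\<^esub> \<beta>) = idc D (leg \<pi> X) \<star>\<^bsub>D\<^esub> \<beta>"
        using that L(1) by (simp add: cone_comp_def uv)
      then show ?thesis using \<beta>(2) that by simp
    qed
    ultimately show "\<exists>\<beta>\<in>Cells D z z'. \<forall>X\<in>Obj C. idc D (leg (cone_comp C D \<pi> u) X) \<star>\<^bsub>D\<^esub> \<beta> = mcell \<mu> X"
      by blast
  next
    fix E z z' \<beta> \<beta>' assume E: "E \<in> Obj D" and z: "z \<in> Hom D E L'" "z' \<in> Hom D E L'"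
      and \<beta>: "\<beta> \<in> Cells D z z'" "\<beta>' \<in> Cells D z z'"
      and eq: "\<And>X. X \<in> Obj C \<Longrightarrow> idc D (leg (cone_comp C D \<pi> u) X) \<star>\<^bsub>D\<^esub> \<beta> =
          idc D (leg (cone_comp C D \<pi> u) X) \<star>\<^bsub>D\<^esub> \<beta>'"
    have "idc D u \<star>\<^bsub>D\<^esub> \<beta> = idc D u \<star>\<^bsub>D\<^esub> \<beta>'"
      by (rule L(6) [OF E, of "u \<cdot>\<^bsub>D\<^esub> z" "u \<cdot>\<^bsub>D\<^esub> z'"])
        (use z \<beta> eq in \<open>auto simp: D.Hom_iff D.Cells_iff cone_comp_def\<close>)
    then have "idc D v \<star>\<^bsub>D\<^esub> (idc D u \<star>\<^bsub>D\<^esub> \<beta>) = idc D v \<star>\<^bsub>D\<^esub> (idc D u \<star>\<^bsub>D\<^esub> \<beta>')" by simp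
    then show "\<beta> = \<beta>'" using z \<beta> by (simp add: D.Cells_iff D.Hom_iff vu)
  qed
qed

end


section \<open>Algebras and diagrams of algebras\<close>

lemma obmap_id2 [simp]: "obmap id2 X = X" "arrmap id2 f = f" "cellmap id2 \<alpha> = \<alpha>"
  by (simp_all add: id2_def)

lemma obmap_comp2 [simp]:
  "obmap (G \<circ>\<^sub>2 F) X = obmap G (obmap F X)" "arrmap (G \<circ>\<^sub>2 F) f = arrmap G (arrmap F f)"
  "cellmap (G \<circ>\<^sub>2 F) \<alpha> = cellmap G (cellmap F \<alpha>)"
  by (simp_all add: comp2_def)

context two_natural
begin

lemma component_simps [simp]:
  assumes "X \<in> Obj C"
  shows "\<eta> X \<in> Arr D" "src D (\<eta> X) = obmap F X" "trg D (\<eta> X) = obmap G X"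
  using component [OF assms] by (auto simp: F.D.Hom_iff)

text \<open>Oriented so that components move to the left: \<open>i\<close> and \<open>m\<close> then
  stand next to an algebra action, where the algebra laws apply. The second clause, here and in
  \<open>natural_cell'\<close>, carries a tail \<open>z\<close> for use inside right-nested
  composites.\<close>

lemma natural_arr':
  assumes "f \<in> Arr C" "src C f = X"
  shows "arrmap G f \<cdot>\<^bsub>D\<^esub> \<eta> X = \<eta> (trg C f) \<cdot>\<^bsub>D\<^esub> arrmap F f"
    "\<lbrakk>z \<in> Arr D; trg D z = obmap F X\<rbrakk> \<Longrightarrow>
       arrmap G f \<cdot>\<^bsub>D\<^esub> (\<eta> X \<cdot>\<^bsub>D\<^esub> z) = \<eta> (trg C f) \<cdot>\<^bsub>D\<^esub> (arrmap F f \<cdot>\<^bsub>D\<^esub> z)"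
proof -
  show *: "arrmap G f \<cdot>\<^bsub>D\<^esub> \<eta> X = \<eta> (trg C f) \<cdot>\<^bsub>D\<^esub> arrmap F f"
    using natural_arr [of f X "trg C f"] assms by (simp add: F.C.Hom_iff)
  assume "z \<in> Arr D" "trg D z = obmap F X"
  moreover have "X \<in> Obj C" using assms F.C.src_Obj by blast
  ultimately show "arrmap G f \<cdot>\<^bsub>D\<^esub> (\<eta> X \<cdot>\<^bsub>D\<^esub> z) = \<eta> (trg C f) \<cdot>\<^bsub>D\<^esub> (arrmap F f \<cdot>\<^bsub>D\<^esub> z)"
    using F.D.cmp_assoc' [of z "\<eta> X" "arrmap G f"] F.D.cmp_assoc' [of z "arrmap F f"
        "\<eta> (trg C f)"] assms *
    by simp
qed

lemma natural_cell':
  assumes "\<alpha> \<in> Cell C" "src C (Dom C \<alpha>) = X"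
  shows "cellmap G \<alpha> \<star>\<^bsub>D\<^esub> idc D (\<eta> X) = idc D (\<eta> (trg C (Dom C \<alpha>))) \<star>\<^bsub>D\<^esub> cellmap F \<alpha>"
    "\<lbrakk>z \<in> Arr D; trg D z = obmap F X\<rbrakk> \<Longrightarrow>
       cellmap G \<alpha> \<star>\<^bsub>D\<^esub> idc D (\<eta> X \<cdot>\<^bsub>D\<^esub> z) = idc D (\<eta> (trg C (Dom C \<alpha>))) \<star>\<^bsub>D\<^esub> (cellmap F \<alpha> \<star>\<^bsub>D\<^esub> idc D z)"
proof -
  show *: "cellmap G \<alpha> \<star>\<^bsub>D\<^esub> idc D (\<eta> X) = idc D (\<eta> (trg C (Dom C \<alpha>))) \<star>\<^bsub>D\<^esub> cellmap F \<alpha>"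
    using natural_cell [of "Dom C \<alpha>" X "trg C (Dom C \<alpha>)" \<alpha> "Cod C \<alpha>"] assms
    by (simp add: F.C.Hom_iff F.C.Cells_iff)
  assume z: "z \<in> Arr D" "trg D z = obmap F X"
  have X: "X \<in> Obj C" using assms F.C.src_Obj F.C.Dom_Arr by blast
  have "cellmap G \<alpha> \<star>\<^bsub>D\<^esub> idc D (\<eta> X \<cdot>\<^bsub>D\<^esub> z) = (cellmap G \<alpha> \<star>\<^bsub>D\<^esub> idc D (\<eta> X)) \<star>\<^bsub>D\<^esub> idc D z"
    using assms z X by simp
  also have "\<dots> = idc D (\<eta> (trg C (Dom C \<alpha>))) \<star>\<^bsub>D\<^esub> (cellmap F \<alpha> \<star>\<^bsub>D\<^esub> idc D z)"
    unfolding * using assms z X by simp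
  finally show "cellmap G \<alpha> \<star>\<^bsub>D\<^esub> idc D (\<eta> X \<cdot>\<^bsub>D\<^esub> z) =
      idc D (\<eta> (trg C (Dom C \<alpha>))) \<star>\<^bsub>D\<^esub> (cellmap F \<alpha> \<star>\<^bsub>D\<^esub> idc D z)" .
qed

end

context two_monad
begin

lemmas monad_natural [simp] =
  unit.component_simps [unfolded obmap_id2] mult.component_simps [unfolded obmap_comp2]
  unit.natural_arr' [unfolded obmap_id2] mult.natural_arr' [unfolded obmap_comp2]
  unit.natural_cell' [unfolded obmap_id2] mult.natural_cell' [unfolded obmap_comp2]

lemma algebra_simps:
  assumes "X \<in> algebras K T i m"
  shows "carr X \<in> Obj K" "act X \<in> Arr K" "src K (act X) = obmap T (carr X)" "trg K (act X) = carr X"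
    "act X \<cdot>\<^bsub>K\<^esub> i (carr X) = ide K (carr X)"
    "act X \<cdot>\<^bsub>K\<^esub> m (carr X) = act X \<cdot>\<^bsub>K\<^esub> arrmap T (act X)"
    "\<lbrakk>z \<in> Arr K; trg K z = carr X\<rbrakk> \<Longrightarrow> act X \<cdot>\<^bsub>K\<^esub> (i (carr X) \<cdot>\<^bsub>K\<^esub> z) = z"
    "\<lbrakk>z \<in> Arr K; trg K z = obmap T (obmap T (carr X))\<rbrakk> \<Longrightarrow>
       act X \<cdot>\<^bsub>K\<^esub> (m (carr X) \<cdot>\<^bsub>K\<^esub> z) = act X \<cdot>\<^bsub>K\<^esub> (arrmap T (act X) \<cdot>\<^bsub>K\<^esub> z)"
proof -
  show *: "carr X \<in> Obj K" "act X \<in> Arr K" "src K (act X) = obmap T (carr X)"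
      "trg K (act X) = carr X"
    "act X \<cdot>\<^bsub>K\<^esub> i (carr X) = ide K (carr X)"
    "act X \<cdot>\<^bsub>K\<^esub> m (carr X) = act X \<cdot>\<^bsub>K\<^esub> arrmap T (act X)"
    using assms by (auto simp: algebras_def C.Hom_iff)
  show "act X \<cdot>\<^bsub>K\<^esub> (i (carr X) \<cdot>\<^bsub>K\<^esub> z) = z" if "z \<in> Arr K" "trg K z = carr X"
    using C.cmp_assoc' [of z "i (carr X)" "act X"] that * by simp
  show "act X \<cdot>\<^bsub>K\<^esub> (m (carr X) \<cdot>\<^bsub>K\<^esub> z) = act X \<cdot>\<^bsub>K\<^esub> (arrmap T (act X) \<cdot>\<^bsub>K\<^esub> z)"
    if "z \<in> Arr K" "trg K z = obmap T (obmap T (carr X))"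
    using C.cmp_assoc' [of z "m (carr X)" "act X"] that * by simp
qed

lemma wmorphisms_iff:
  "w \<in> wmorphisms K T i m \<Omega> \<longleftrightarrow>
     wsrc w \<in> algebras K T i m \<and> wtrg w \<in> algebras K T i m \<and>
     warr w \<in> Arr K \<and> src K (warr w) = carr (wsrc w) \<and> trg K (warr w) = carr (wtrg w) \<and>
     wstr w \<in> Cell K \<and> Dom K (wstr w) = act (wtrg w) \<cdot>\<^bsub>K\<^esub> arrmap T (warr w) \<and>
     Cod K (wstr w) = warr w \<cdot>\<^bsub>K\<^esub> act (wsrc w) \<and> wstr w \<in> \<Omega> \<and>
     wstr w \<star>\<^bsub>K\<^esub> idc K (i (carr (wsrc w))) = idc K (warr w) \<and>
     wstr w \<star>\<^bsub>K\<^esub> idc K (m (carr (wsrc w))) =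
       (wstr w \<star>\<^bsub>K\<^esub> idc K (arrmap T (act (wsrc w)))) \<bullet>\<^bsub>K\<^esub>
       (idc K (act (wtrg w)) \<star>\<^bsub>K\<^esub> cellmap T (wstr w))"
  by (auto simp: wmorphisms_def Let_def C.Hom_iff C.Cells_iff)

lemma wmorphism_simps:
  assumes "w \<in> wmorphisms K T i m \<Omega>"
  shows "wsrc w \<in> algebras K T i m" "wtrg w \<in> algebras K T i m"
    "warr w \<in> Arr K" "src K (warr w) = carr (wsrc w)" "trg K (warr w) = carr (wtrg w)"
    "wstr w \<in> Cell K" "Dom K (wstr w) = act (wtrg w) \<cdot>\<^bsub>K\<^esub> arrmap T (warr w)"
    "Cod K (wstr w) = warr w \<cdot>\<^bsub>K\<^esub> act (wsrc w)" "wstr w \<in> \<Omega>"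
    "wstr w \<star>\<^bsub>K\<^esub> idc K (i (carr (wsrc w))) = idc K (warr w)"
    "wstr w \<star>\<^bsub>K\<^esub> idc K (m (carr (wsrc w))) =
       (wstr w \<star>\<^bsub>K\<^esub> idc K (arrmap T (act (wsrc w)))) \<bullet>\<^bsub>K\<^esub>
       (idc K (act (wtrg w)) \<star>\<^bsub>K\<^esub> cellmap T (wstr w))"
    "\<lbrakk>z \<in> Arr K; trg K z = carr (wsrc w)\<rbrakk> \<Longrightarrow>
       wstr w \<star>\<^bsub>K\<^esub> idc K (i (carr (wsrc w)) \<cdot>\<^bsub>K\<^esub> z) = idc K (warr w \<cdot>\<^bsub>K\<^esub> z)"
    "\<lbrakk>z \<in> Arr K; trg K z = obmap T (obmap T (carr (wsrc w)))\<rbrakk> \<Longrightarrow>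
       wstr w \<star>\<^bsub>K\<^esub> idc K (m (carr (wsrc w)) \<cdot>\<^bsub>K\<^esub> z) =
       (wstr w \<star>\<^bsub>K\<^esub> idc K (arrmap T (act (wsrc w)) \<cdot>\<^bsub>K\<^esub> z)) \<bullet>\<^bsub>K\<^esub>
       (idc K (act (wtrg w)) \<star>\<^bsub>K\<^esub> (cellmap T (wstr w) \<star>\<^bsub>K\<^esub> idc K z))"
proof -
  show *: "wsrc w \<in> algebras K T i m" "wtrg w \<in> algebras K T i m"
    "warr w \<in> Arr K" "src K (warr w) = carr (wsrc w)" "trg K (warr w) = carr (wtrg w)"
    "wstr w \<in> Cell K" "Dom K (wstr w) = act (wtrg w) \<cdot>\<^bsub>K\<^esub> arrmap T (warr w)"
    "Cod K (wstr w) = warr w \<cdot>\<^bsub>K\<^esub> act (wsrc w)" "wstr w \<in> \<Omega>"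
    "wstr w \<star>\<^bsub>K\<^esub> idc K (i (carr (wsrc w))) = idc K (warr w)"
    "wstr w \<star>\<^bsub>K\<^esub> idc K (m (carr (wsrc w))) =
       (wstr w \<star>\<^bsub>K\<^esub> idc K (arrmap T (act (wsrc w)))) \<bullet>\<^bsub>K\<^esub>
       (idc K (act (wtrg w)) \<star>\<^bsub>K\<^esub> cellmap T (wstr w))"
    using assms by (auto simp: wmorphisms_iff)
  note [simp] = algebra_simps [OF *(1)] algebra_simps [OF *(2)]
  show "wstr w \<star>\<^bsub>K\<^esub> idc K (i (carr (wsrc w)) \<cdot>\<^bsub>K\<^esub> z) = idc K (warr w \<cdot>\<^bsub>K\<^esub> z)"
    if z: "z \<in> Arr K" "trg K z = carr (wsrc w)"
    using C.hcmp_assoc' [of "idc K z" "idc K (i (carr (wsrc w)))" "wstr w"] z * by simp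
  show "wstr w \<star>\<^bsub>K\<^esub> idc K (m (carr (wsrc w)) \<cdot>\<^bsub>K\<^esub> z) =
       (wstr w \<star>\<^bsub>K\<^esub> idc K (arrmap T (act (wsrc w)) \<cdot>\<^bsub>K\<^esub> z)) \<bullet>\<^bsub>K\<^esub>
       (idc K (act (wtrg w)) \<star>\<^bsub>K\<^esub> (cellmap T (wstr w) \<star>\<^bsub>K\<^esub> idc K z))"
    if z: "z \<in> Arr K" "trg K z = obmap T (obmap T (carr (wsrc w)))"
    using C.hcmp_assoc' [of "idc K z" "idc K (m (carr (wsrc w)))" "wstr w"] z * by simp
qed

lemma wcells_iff:
  "x \<in> wcells K T i m \<Omega> \<longleftrightarrow>
     wdom x \<in> wmorphisms K T i m \<Omega> \<and> wcod x \<in> wmorphisms K T i m \<Omega> \<and>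
     wsrc (wcod x) = wsrc (wdom x) \<and> wtrg (wcod x) = wtrg (wdom x) \<and>
     wund x \<in> Cell K \<and> Dom K (wund x) = warr (wdom x) \<and> Cod K (wund x) = warr (wcod x) \<and>
     (wund x \<star>\<^bsub>K\<^esub> idc K (act (wsrc (wdom x)))) \<bullet>\<^bsub>K\<^esub> wstr (wdom x) =
       wstr (wcod x) \<bullet>\<^bsub>K\<^esub> (idc K (act (wtrg (wdom x))) \<star>\<^bsub>K\<^esub> cellmap T (wund x))"
  by (auto simp: wcells_def Let_def C.Cells_iff)

lemma closed_family_simps:
  assumes "closed_family K \<Omega>"
  shows "f \<in> Arr K \<Longrightarrow> idc K f \<in> \<Omega>"
    "\<lbrakk>\<alpha> \<in> \<Omega>; \<beta> \<in> \<Omega>; src K (Dom K \<beta>) = trg K (Dom K \<alpha>)\<rbrakk> \<Longrightarrow> \<beta> \<star>\<^bsub>K\<^esub> \<alpha> \<in> \<Omega>"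
  using assms by (auto simp: closed_family_def)

end

lemma TAlg_sel [simp]:
  "Obj (TAlg K T i m \<Omega>) = algebras K T i m" "Arr (TAlg K T i m \<Omega>) = wmorphisms K T i m \<Omega>"
  "Cell (TAlg K T i m \<Omega>) = wcells K T i m \<Omega>" "src (TAlg K T i m \<Omega>) = wsrc"
      "trg (TAlg K T i m \<Omega>) = wtrg"
  "Dom (TAlg K T i m \<Omega>) = wdom" "Cod (TAlg K T i m \<Omega>) = wcod"
  "ide (TAlg K T i m \<Omega>) X = \<lparr>wsrc = X, wtrg = X, warr = ide K (carr X), wstr = idc K (act X)\<rparr>"
  "idc (TAlg K T i m \<Omega>) w = \<lparr>wdom = w, wcod = w, wund = idc K (warr w)\<rparr>"
  "cmp (TAlg K T i m \<Omega>) = wcomp K T"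
  "vcmp (TAlg K T i m \<Omega>) y x = \<lparr>wdom = wdom x, wcod = wcod y, wund = wund y \<bullet>\<^bsub>K\<^esub> wund x\<rparr>"
  "hcmp (TAlg K T i m \<Omega>) y x = \<lparr>wdom = wcomp K T (wdom y) (wdom x), wcod =
      wcomp K T (wcod y) (wcod x),
                     wund = wund y \<star>\<^bsub>K\<^esub> wund x\<rparr>"
  by (simp_all add: TAlg_def)

lemma Forget_sel [simp]: "obmap Forget = carr" "arrmap Forget = warr" "cellmap Forget = wund"
  by (simp_all add: Forget_def)

lemma wcomp_sel [simp]: "wsrc (wcomp K T w v) = wsrc v" "wtrg (wcomp K T w v) = wtrg w"
  "warr (wcomp K T w v) = warr w \<cdot>\<^bsub>K\<^esub> warr v"
  "wstr (wcomp K T w v) = (idc K (warr w) \<star>\<^bsub>K\<^esub> wstr v) \<bullet>\<^bsub>K\<^esub> (wstr w \<star>\<^bsub>K\<^esub> idc K (arrmap T (warr v)))"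
  by (simp_all add: wcomp_def)

text \<open>\<open>F\<close> is a parameter tied to \<open>Fbar\<close> by \<open>F_eq\<close>
  rather than an abbreviation, so that underlying data of \<open>Fbar\<close> can be rewritten to
  \<open>F\<close>, and \<open>F\<close> interpreted as a 2-functor of its own.\<close>

locale algebra_diagram = two_monad K T i m + Fbar: two_functor A "TAlg K T i m \<Omega>" Fbar
  for K :: "('o, 'm, 'c) cat2" and T i m \<Omega> and A :: "('ao, 'am, 'ac) cat2" and Fbar +
  fixes F
  assumes F_eq: "F = Forget \<circ>\<^sub>2 Fbar"
begin

abbreviation "a X \<equiv> act (obmap Fbar X)"
abbreviation "\<phi> f \<equiv> wstr (arrmap Fbar f)"

lemma Fbar_obmap [simp]: "X \<in> Obj A \<Longrightarrow> obmap Fbar X \<in> algebras K T i m"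
  using Fbar.obmap [of X] by simp

lemma carr_Fbar [simp]: "carr (obmap Fbar X) = obmap F X"
  by (simp add: F_eq)

lemma Fbar_arr [simp]:
  assumes "f \<in> Arr A"
  shows "arrmap Fbar f \<in> wmorphisms K T i m \<Omega>" "wsrc (arrmap Fbar f) = obmap Fbar (src A f)"
    "wtrg (arrmap Fbar f) = obmap Fbar (trg A f)"
  using Fbar.arrmap_simps [OF assms] by simp_all

lemma warr_Fbar [simp]: "warr (arrmap Fbar f) = arrmap F f"
  by (simp add: F_eq)

lemma Fbar_cell [simp]:
  assumes "\<gamma> \<in> Cell A"
  shows "cellmap Fbar \<gamma> \<in> wcells K T i m \<Omega>" "wdom (cellmap Fbar \<gamma>) = arrmap Fbar (Dom A \<gamma>)"
    "wcod (cellmap Fbar \<gamma>) = arrmap Fbar (Cod A \<gamma>)"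
  using Fbar.cellmap_simps [OF assms] by simp_all

lemma wund_Fbar [simp]: "wund (cellmap Fbar \<gamma>) = cellmap F \<gamma>"
  by (simp add: F_eq)

lemma two_functor_F: "two_functor A K F"
proof
  show "obmap F X \<in> Obj K" if "X \<in> Obj A" for X
    using algebra_simps(1) [OF Fbar_obmap [OF that]] by simp
  show "arrmap F f \<in> Hom K (obmap F X) (obmap F Y)" if "f \<in> Hom A X Y" for f X Y
    using that wmorphism_simps [OF Fbar_arr(1), of f] by (auto simp: Fbar.C.Hom_iff C.Hom_iff)
  show "cellmap F \<alpha> \<in> Cells K (arrmap F f) (arrmap F g)" if "\<alpha> \<in> Cells A f g" for \<alpha> f g
    using that Fbar_cell [of \<alpha>] by (auto simp: Fbar.C.Cells_iff C.Cells_iff wcells_iff)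
  show "arrmap F (ide A X) = ide K (obmap F X)" if "X \<in> Obj A" for X
    using arg_cong [OF Fbar.arrmap_ide [OF that], of warr] by simp
  show "arrmap F (g \<cdot>\<^bsub>A\<^esub> f) = arrmap F g \<cdot>\<^bsub>K\<^esub> arrmap F f" if "f \<in> Hom A X Y" "g \<in> Hom A Y Z"
      for X Y Z f g
    using arg_cong [OF Fbar.arrmap_cmp [OF that], of warr] by simp
  show "cellmap F (idc A f) = idc K (arrmap F f)" if "f \<in> Arr A" for f
    using arg_cong [OF Fbar.cellmap_idc [OF that], of wund] by simp
  show "cellmap F (\<beta> \<bullet>\<^bsub>A\<^esub> \<alpha>) = cellmap F \<beta> \<bullet>\<^bsub>K\<^esub> cellmap F \<alpha>"
    if "\<alpha> \<in> Cells A f g" "\<beta> \<in> Cells A g h" for \<alpha> f g \<beta> h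
    using arg_cong [OF Fbar.cellmap_vcmp [OF that], of wund] by simp
  show "cellmap F (\<beta> \<star>\<^bsub>A\<^esub> \<alpha>) = cellmap F \<beta> \<star>\<^bsub>K\<^esub> cellmap F \<alpha>"
    if "f \<in> Hom A X Y" "g \<in> Hom A Y Z" "\<alpha> \<in> Cells A f f'" "\<beta> \<in> Cells A g g'" for f X Y g Z \<alpha> f' \<beta> g'
    using arg_cong [OF Fbar.cellmap_hcmp [OF that], of wund] by simp
qed

sublocale F: two_functor A K F
  by (rule two_functor_F)

lemmas act_simps [simp] = algebra_simps [OF Fbar_obmap, unfolded carr_Fbar]

lemma str_simps [simp]:
  assumes "f \<in> Arr A"
  shows "\<phi> f \<in> Cell K" "Dom K (\<phi> f) = a (trg A f) \<cdot>\<^bsub>K\<^esub> arrmap T (arrmap F f)"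
    "Cod K (\<phi> f) = arrmap F f \<cdot>\<^bsub>K\<^esub> a (src A f)" "\<phi> f \<in> \<Omega>"
  using wmorphism_simps [OF Fbar_arr(1) [OF assms]] assms by auto

lemma str_monad [simp]:
  assumes f: "f \<in> Arr A" and X: "src A f = X"
  shows "\<phi> f \<star>\<^bsub>K\<^esub> idc K (i (obmap F X)) = idc K (arrmap F f)"
    "\<phi> f \<star>\<^bsub>K\<^esub> idc K (m (obmap F X)) =
       (\<phi> f \<star>\<^bsub>K\<^esub> idc K (arrmap T (a X))) \<bullet>\<^bsub>K\<^esub> (idc K (a (trg A f)) \<star>\<^bsub>K\<^esub> cellmap T (\<phi> f))"
    "\<lbrakk>z \<in> Arr K; trg K z = obmap F X\<rbrakk> \<Longrightarrow>
       \<phi> f \<star>\<^bsub>K\<^esub> idc K (i (obmap F X) \<cdot>\<^bsub>K\<^esub> z) = idc K (arrmap F f \<cdot>\<^bsub>K\<^esub> z)"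
    "\<lbrakk>z \<in> Arr K; trg K z = obmap T (obmap T (obmap F X))\<rbrakk> \<Longrightarrow>
       \<phi> f \<star>\<^bsub>K\<^esub> idc K (m (obmap F X) \<cdot>\<^bsub>K\<^esub> z) =
       (\<phi> f \<star>\<^bsub>K\<^esub> idc K (arrmap T (a X) \<cdot>\<^bsub>K\<^esub> z)) \<bullet>\<^bsub>K\<^esub>
       (idc K (a (trg A f)) \<star>\<^bsub>K\<^esub> (cellmap T (\<phi> f) \<star>\<^bsub>K\<^esub> idc K z))"
  using wmorphism_simps(10-) [OF Fbar_arr(1) [OF f]] f X by simp_all

lemma str_ide [simp]: "X \<in> Obj A \<Longrightarrow> \<phi> (ide A X) = idc K (a X)"
  using arg_cong [OF Fbar.arrmap_ide, of X wstr] by simp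

lemma str_cmp:
  assumes "f \<in> Arr A" "g \<in> Arr A" "src A g = trg A f"
  shows "\<phi> (g \<cdot>\<^bsub>A\<^esub> f) = (idc K (arrmap F g) \<star>\<^bsub>K\<^esub> \<phi> f) \<bullet>\<^bsub>K\<^esub> (\<phi> g \<star>\<^bsub>K\<^esub> idc K (arrmap T (arrmap F f)))"
  using arg_cong [OF Fbar.arrmap_cmp, of f "src A f" "trg A f" g "trg A g" wstr] assms
  by (simp add: Fbar.C.Hom_iff)

lemma str_cell:
  assumes "\<gamma> \<in> Cell A"
  shows "(cellmap F \<gamma> \<star>\<^bsub>K\<^esub> idc K (a (src A (Dom A \<gamma>)))) \<bullet>\<^bsub>K\<^esub> \<phi> (Dom A \<gamma>) =
    \<phi> (Cod A \<gamma>) \<bullet>\<^bsub>K\<^esub> (idc K (a (trg A (Dom A \<gamma>))) \<star>\<^bsub>K\<^esub> cellmap T (cellmap F \<gamma>))"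
  using Fbar_cell [OF assms] assms by (simp add: wcells_iff)

end


section \<open>The induced opcone\<close>

text \<open>A \<Sigma>-arrow into \<open>X\<close> joins its source to \<open>X\<close>, so a source
  in \<open>A0\<close> must be the object chosen for the component of \<open>X\<close>; initiality
  then leaves a single arrow. Hence the description in \<open>initial_arr\<close> is
  definite.\<close>

lemma initial_arr_unique:
  assumes pair: "indexing_pair A \<Sigma>" and init: "initial_family A \<Sigma> A0"
    and X: "X \<in> Obj A"
  shows "initial_arr A \<Sigma> A0 X \<in> \<Sigma>" "src A (initial_arr A \<Sigma> A0 X) \<in> A0"
      "trg A (initial_arr A \<Sigma> A0 X) = X"
    and "\<lbrakk>f \<in> \<Sigma>; src A f \<in> A0; trg A f = X\<rbrakk> \<Longrightarrow> f = initial_arr A \<Sigma> A0 X"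
proof -
  let ?C = "sigma_cat A \<Sigma>" and ?P = "\<lambda>f. f \<in> \<Sigma> \<and> src A f \<in> A0 \<and> trg A f = X"
  interpret two_category A using pair by (simp add: indexing_pair_def)
  obtain X0 where X0: "X0 \<in> A0" "X0 \<in> connected_component ?C X"
    and uniq: "\<And>X1. \<lbrakk>X1 \<in> A0; X1 \<in> connected_component ?C X\<rbrakk> \<Longrightarrow> X1 = X0"
    using init X unfolding initial_family_def by metis
  have "X \<in> connected_component ?C X0"
    using X0 X by (auto simp: connected_component_def sigma_cat_def intro: equivclp_sym)
  then have "\<exists>!f. f \<in> Hom1 ?C X0 X"
    using init X0(1) unfolding initial_family_def initial_in_def by blast
  moreover have "?P f \<longleftrightarrow> f \<in> Hom1 ?C X0 X" for f
  proof
    assume f: "?P f"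
    then have "f \<in> Arr A" using pair by (auto simp: indexing_pair_def)
    moreover have "equivclp (\<lambda>U V. Hom1 ?C U V \<noteq> {}) (src A f) X"
      using f by (intro r_into_equivclp) (auto simp: Hom1_def sigma_cat_def)
    ultimately have "src A f \<in> connected_component ?C X"
      using src_Obj by (auto simp: connected_component_def sigma_cat_def intro: equivclp_sym)
    then show "f \<in> Hom1 ?C X0 X"
      using f uniq by (auto simp: Hom1_def sigma_cat_def)
  qed (use X0 in \<open>auto simp: Hom1_def sigma_cat_def\<close>)
  ultimately have ex1: "\<exists>!f. ?P f" by simp
  from theI' [OF this] show "initial_arr A \<Sigma> A0 X \<in> \<Sigma>" "src A (initial_arr A \<Sigma> A0 X) \<in> A0"
    "trg A (initial_arr A \<Sigma> A0 X) = X"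
    by (auto simp: initial_arr_def)
  with ex1 show "f = initial_arr A \<Sigma> A0 X" if "f \<in> \<Sigma>" "src A f \<in> A0" "trg A f = X"
    using that by blast
qed

locale sigma_diagram = algebra_diagram K T i m \<Omega> A Fbar F
  for K :: "('o, 'm, 'c) cat2" and T i m \<Omega> and A :: "('ao, 'am, 'ac) cat2" and Fbar F +
  fixes \<Sigma> A0 L \<pi>
  assumes closed: "closed_family K \<Omega>"
    and pair: "indexing_pair A \<Sigma>"
    and init: "initial_family A \<Sigma> A0"
    and inv: "X \<in> Obj A \<Longrightarrow> is_invertible_cell K (\<phi> (initial_arr A \<Sigma> A0 X))"
    and lim: "is_oplimit A \<Sigma> K F L \<pi>"
    and compat: "compatible A \<Sigma> K F \<Omega> L \<pi>"
begin

abbreviation "P X \<equiv> leg \<pi> X"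
abbreviation "Pc f \<equiv> legcell \<pi> f"
abbreviation "f0 X \<equiv> initial_arr A \<Sigma> A0 X"
abbreviation "p X \<equiv> leg \<pi> (src A (f0 X))"

lemmas L = F.is_oplimitD [OF lim]

lemma L_Obj [simp]: "L \<in> Obj K"
  by (rule L(1))

lemmas \<pi>_simps [simp] = F.opcone_simps [OF L(2)]

lemma \<Sigma>_Arr [simp]: "f \<in> \<Sigma> \<Longrightarrow> f \<in> Arr A"
  using pair by (auto simp: indexing_pair_def)

lemma \<Sigma>_subset: "\<Sigma> \<subseteq> Arr A"
  by auto

lemma f0 [simp]:
  assumes "X \<in> Obj A"
  shows "f0 X \<in> \<Sigma>" "src A (f0 X) \<in> A0" "trg A (f0 X) = X" "f0 X \<in> Arr A" "src A (f0 X) \<in> Obj A"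
  using initial_arr_unique(1-3) [OF pair init assms] by simp_all

text \<open>Closure of \<Sigma> under composition makes the left side a \<Sigma>-arrow from
  \<open>A0\<close>, and such arrows are unique. This is what will make \<open>\<theta>\<close>
  strict along \<Sigma>.\<close>

lemma f0_\<Sigma>:
  assumes "f \<in> \<Sigma>"
  shows "f \<cdot>\<^bsub>A\<^esub> f0 (src A f) = f0 (trg A f)"
proof (rule initial_arr_unique(4) [OF pair init])
  have "f0 (src A f) \<in> \<Sigma>" "src A f = trg A (f0 (src A f))" using assms by simp_all
  then show "f \<cdot>\<^bsub>A\<^esub> f0 (src A f) \<in> \<Sigma>"
    using pair assms unfolding indexing_pair_def by blast
qed (use assms in simp_all)

text \<open>The identity of an object of \<open>A0\<close> is itself a \<Sigma>-arrow from
  \<open>A0\<close>, so the data built from \<open>f0\<close> simplify at these objects.\<close>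

lemma f0_A0 [simp]:
  assumes "X \<in> A0"
  shows "X \<in> Obj A" "f0 X = ide A X"
proof -
  show X: "X \<in> Obj A" using init assms by (auto simp: initial_family_def)
  have "ide A X \<in> \<Sigma>" using pair X by (auto simp: indexing_pair_def)
  then show "f0 X = ide A X"
    using initial_arr_unique(4) [OF pair init X, of "ide A X"] X assms by simp
qed

lemma P_f0: "X \<in> Obj A \<Longrightarrow> P X = arrmap F (f0 X) \<cdot>\<^bsub>K\<^esub> p X"
  using F.opcone_sigma(2) [OF L(2), of "f0 X"] by simp

section \<open>Conjugation by the structure 2-cells of the initial arrows\<close>

definition \<phi>inv :: "'ao \<Rightarrow> 'c" where
  "\<phi>inv X = (SOME \<beta>. \<beta> \<in> Cells K (Cod K (\<phi> (f0 X))) (Dom K (\<phi> (f0 X))) \<and>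
     \<beta> \<bullet>\<^bsub>K\<^esub> \<phi> (f0 X) = idc K (Dom K (\<phi> (f0 X))) \<and> \<phi> (f0 X) \<bullet>\<^bsub>K\<^esub> \<beta> = idc K (Cod K (\<phi> (f0 X))))"

lemma \<phi>inv [simp]:
  assumes "X \<in> Obj A"
  shows "\<phi>inv X \<in> Cell K" "Dom K (\<phi>inv X) = arrmap F (f0 X) \<cdot>\<^bsub>K\<^esub> a (src A (f0 X))"
    "Cod K (\<phi>inv X) = a X \<cdot>\<^bsub>K\<^esub> arrmap T (arrmap F (f0 X))"
    "\<phi>inv X \<bullet>\<^bsub>K\<^esub> \<phi> (f0 X) = idc K (a X \<cdot>\<^bsub>K\<^esub> arrmap T (arrmap F (f0 X)))"
    "\<phi> (f0 X) \<bullet>\<^bsub>K\<^esub> \<phi>inv X = idc K (arrmap F (f0 X) \<cdot>\<^bsub>K\<^esub> a (src A (f0 X)))"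
proof -
  have "\<exists>\<beta>. \<beta> \<in> Cells K (Cod K (\<phi> (f0 X))) (Dom K (\<phi> (f0 X))) \<and>
     \<beta> \<bullet>\<^bsub>K\<^esub> \<phi> (f0 X) = idc K (Dom K (\<phi> (f0 X))) \<and> \<phi> (f0 X) \<bullet>\<^bsub>K\<^esub> \<beta> = idc K (Cod K (\<phi> (f0 X)))"
    using inv [OF assms] unfolding is_invertible_cell_def by blast
  from someI_ex [OF this, folded \<phi>inv_def]
  show "\<phi>inv X \<in> Cell K" "Dom K (\<phi>inv X) = arrmap F (f0 X) \<cdot>\<^bsub>K\<^esub> a (src A (f0 X))"
    "Cod K (\<phi>inv X) = a X \<cdot>\<^bsub>K\<^esub> arrmap T (arrmap F (f0 X))"
    "\<phi>inv X \<bullet>\<^bsub>K\<^esub> \<phi> (f0 X) = idc K (a X \<cdot>\<^bsub>K\<^esub> arrmap T (arrmap F (f0 X)))"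
    "\<phi> (f0 X) \<bullet>\<^bsub>K\<^esub> \<phi>inv X = idc K (arrmap F (f0 X) \<cdot>\<^bsub>K\<^esub> a (src A (f0 X)))"
    using assms by (simp_all add: C.Cells_iff)
qed

text \<open>\<open>t\<close> and \<open>tc\<close> below are the legs and 2-cells of the opcone
  \<open>\<theta>\<close> with vertex \<open>T L\<close>, kept unrestricted until they are
  bundled.\<close>

definition t :: "'ao \<Rightarrow> 'm" where
  "t X = arrmap F (f0 X) \<cdot>\<^bsub>K\<^esub> (a (src A (f0 X)) \<cdot>\<^bsub>K\<^esub> arrmap T (p X))"

definition \<psi> :: "'ao \<Rightarrow> 'c" where
  "\<psi> X = \<phi> (f0 X) \<star>\<^bsub>K\<^esub> idc K (arrmap T (p X))"

definition \<psi>inv :: "'ao \<Rightarrow> 'c" where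
  "\<psi>inv X = \<phi>inv X \<star>\<^bsub>K\<^esub> idc K (arrmap T (p X))"

lemma t_simps [simp]:
  assumes "X \<in> Obj A"
  shows "t X \<in> Arr K" "src K (t X) = obmap T L" "trg K (t X) = obmap F X"
  using assms by (simp_all add: t_def)

lemma \<psi>_simps [simp]:
  assumes "X \<in> Obj A"
  shows "\<psi> X \<in> Cell K" "Dom K (\<psi> X) = a X \<cdot>\<^bsub>K\<^esub> arrmap T (P X)" "Cod K (\<psi> X) = t X" "\<psi> X \<in> \<Omega>"
    "\<psi>inv X \<in> Cell K" "Dom K (\<psi>inv X) = t X" "Cod K (\<psi>inv X) = a X \<cdot>\<^bsub>K\<^esub> arrmap T (P X)"
  using assms closed_family_simps [OF closed]
  by (simp_all add: \<psi>_def \<psi>inv_def t_def P_f0 [OF assms])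

lemma \<psi>_inverse [simp]:
  assumes X: "X \<in> Obj A"
  shows "\<psi>inv X \<bullet>\<^bsub>K\<^esub> \<psi> X = idc K (a X \<cdot>\<^bsub>K\<^esub> arrmap T (P X))" "\<psi> X \<bullet>\<^bsub>K\<^esub> \<psi>inv X = idc K (t X)"
proof -
  have "\<psi>inv X \<bullet>\<^bsub>K\<^esub> \<psi> X = (\<phi>inv X \<bullet>\<^bsub>K\<^esub> \<phi> (f0 X)) \<star>\<^bsub>K\<^esub> idc K (arrmap T (p X))"
    unfolding \<psi>_def \<psi>inv_def using X by (simp del: \<phi>inv(4))
  then show "\<psi>inv X \<bullet>\<^bsub>K\<^esub> \<psi> X = idc K (a X \<cdot>\<^bsub>K\<^esub> arrmap T (P X))"
    using X by (simp add: P_f0 [OF X])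
  have "\<psi> X \<bullet>\<^bsub>K\<^esub> \<psi>inv X = (\<phi> (f0 X) \<bullet>\<^bsub>K\<^esub> \<phi>inv X) \<star>\<^bsub>K\<^esub> idc K (arrmap T (p X))"
    unfolding \<psi>_def \<psi>inv_def using X by (simp del: \<phi>inv(5))
  then show "\<psi> X \<bullet>\<^bsub>K\<^esub> \<psi>inv X = idc K (t X)"
    using X by (simp add: t_def)
qed

text \<open>\<open>\<psi> X\<close> is invertible, so precomposing with it loses nothing. Identities
  between 2-cells out of \<open>t X\<close> are proved after this precomposition, where the inverses
  disappear. The arrow \<open>z\<close> allows for a further whiskering, by \<open>m L\<close> or by
  the image of an arrow under \<open>T\<close>.\<close>

lemma \<psi>_cancel:
  assumes X: "X \<in> Obj A" and z: "z \<in> Arr K" "trg K z = obmap T L"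
    and \<beta>: "\<beta> \<in> Cell K" "Dom K \<beta> = t X \<cdot>\<^bsub>K\<^esub> z" and \<beta>': "\<beta>' \<in> Cell K" "Dom K \<beta>' = t X \<cdot>\<^bsub>K\<^esub> z"
    and eq: "\<beta> \<bullet>\<^bsub>K\<^esub> (\<psi> X \<star>\<^bsub>K\<^esub> idc K z) = \<beta>' \<bullet>\<^bsub>K\<^esub> (\<psi> X \<star>\<^bsub>K\<^esub> idc K z)"
  shows "\<beta> = \<beta>'"
proof -
  have inv: "(\<psi> X \<star>\<^bsub>K\<^esub> idc K z) \<bullet>\<^bsub>K\<^esub> (\<psi>inv X \<star>\<^bsub>K\<^esub> idc K z) = idc K (t X \<cdot>\<^bsub>K\<^esub> z)"
    using C.whisker_vcmp(2) [of "\<psi>inv X" "\<psi> X" z] X z by simp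
  have "\<gamma> = (\<gamma> \<bullet>\<^bsub>K\<^esub> (\<psi> X \<star>\<^bsub>K\<^esub> idc K z)) \<bullet>\<^bsub>K\<^esub> (\<psi>inv X \<star>\<^bsub>K\<^esub> idc K z)"
    if "\<gamma> \<in> Cell K" "Dom K \<gamma> = t X \<cdot>\<^bsub>K\<^esub> z" for \<gamma>
    using X z that by (simp add: inv)
  with \<beta> \<beta>' eq show ?thesis by metis
qed

lemma \<psi>_cancel':
  assumes X: "X \<in> Obj A"
    and \<beta>: "\<beta> \<in> Cell K" "Dom K \<beta> = t X" and \<beta>': "\<beta>' \<in> Cell K" "Dom K \<beta>' = t X"
    and eq: "\<beta> \<bullet>\<^bsub>K\<^esub> \<psi> X = \<beta>' \<bullet>\<^bsub>K\<^esub> \<psi> X"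
  shows "\<beta> = \<beta>'"
  using \<psi>_cancel [OF X, of "ide K (obmap T L)" \<beta> \<beta>'] assms by simp

text \<open>Here \<open>f0 X\<close> is an identity, and the structure 2-cell of an identity is an
  identity.\<close>

lemma t_A0:
  assumes "X \<in> A0"
  shows "t X = a X \<cdot>\<^bsub>K\<^esub> arrmap T (P X)" "\<psi> X = idc K (a X \<cdot>\<^bsub>K\<^esub> arrmap T (P X))"
  using assms by (simp_all add: t_def \<psi>_def)

text \<open>\<open>\<chi> f\<close> is what the structure 2-cell of the composite of \<open>Fbar f\<close> with \<open>(P X, \<psi> X)\<close> will be once
  \<open>L\<close> carries an action.\<close>

definition \<chi> :: "'am \<Rightarrow> 'c" where
  "\<chi> f = (idc K (arrmap F f) \<star>\<^bsub>K\<^esub> \<psi> (src A f)) \<bullet>\<^bsub>K\<^esub> (\<phi> f \<star>\<^bsub>K\<^esub> idc K (arrmap T (P (src A f))))"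

text \<open>Conjugation by \<open>\<psi>\<close> of the 2-cell that \<open>\<phi> f\<close> and
  \<open>T\<close> of \<open>Pc f\<close> give on the op-lax cone
  \<open>a X \<cdot> T (P X)\<close>; the factor \<open>\<psi> (src A f)\<close> is contained in
  \<open>\<chi> f\<close>.\<close>

definition tc :: "'am \<Rightarrow> 'c" where
  "tc f = \<chi> f \<bullet>\<^bsub>K\<^esub> ((idc K (a (trg A f)) \<star>\<^bsub>K\<^esub> cellmap T (Pc f)) \<bullet>\<^bsub>K\<^esub> \<psi>inv (trg A f))"

lemma \<chi>_simps [simp]:
  assumes "f \<in> Arr A"
  shows "\<chi> f \<in> Cell K"
    "Dom K (\<chi> f) = a (trg A f) \<cdot>\<^bsub>K\<^esub> (arrmap T (arrmap F f) \<cdot>\<^bsub>K\<^esub> arrmap T (P (src A f)))"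
    "Cod K (\<chi> f) = arrmap F f \<cdot>\<^bsub>K\<^esub> t (src A f)"
  using assms by (simp_all add: \<chi>_def)

lemma tc_simps [simp]:
  assumes "f \<in> Arr A"
  shows "tc f \<in> Cell K" "Dom K (tc f) = t (trg A f)" "Cod K (tc f) = arrmap F f \<cdot>\<^bsub>K\<^esub> t (src A f)"
  using assms by (simp_all add: tc_def)

text \<open>The definition freed of \<open>\<psi>inv\<close>. Together with
  \<open>\<psi>_cancel'\<close> it yields the composition and 2-cell laws for
  \<open>tc\<close>.\<close>

lemma tc_\<psi>:
  assumes "f \<in> Arr A"
  shows "tc f \<bullet>\<^bsub>K\<^esub> \<psi> (trg A f) = \<chi> f \<bullet>\<^bsub>K\<^esub> (idc K (a (trg A f)) \<star>\<^bsub>K\<^esub> cellmap T (Pc f))"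
  using assms by (simp add: tc_def)

text \<open>\<open>f0\<close> at the target is \<open>f\<close> after \<open>f0\<close> at the
  source, so the composition law for structure 2-cells splits \<open>\<psi> (trg A f)\<close> into
  the two factors of \<open>\<chi> f\<close>.\<close>

lemma \<chi>_\<Sigma>:
  assumes f: "f \<in> \<Sigma>"
  shows "\<chi> f = \<psi> (trg A f)"
proof -
  let ?X = "src A f"
  have X: "?X \<in> Obj A" using f by simp
  have s: "src A (f0 (trg A f)) = src A (f0 ?X)"
    unfolding f0_\<Sigma> [OF f, symmetric] using f by simp
  have "\<psi> (trg A f) = \<phi> (f \<cdot>\<^bsub>A\<^esub> f0 ?X) \<star>\<^bsub>K\<^esub> idc K (arrmap T (p ?X))"
    by (simp add: \<psi>_def f0_\<Sigma> [OF f] s)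
  also have "\<dots> = \<chi> f"
    using f by (simp add: str_cmp \<chi>_def \<psi>_def P_f0 [OF X])
  finally show ?thesis by simp
qed

text \<open>\<open>Pc f\<close> is an identity and \<open>\<chi> f\<close> is \<open>\<psi>\<close>
  at the target, which cancels against \<open>\<psi>inv\<close>.\<close>

lemma tc_\<Sigma>:
  assumes f: "f \<in> \<Sigma>"
  shows "tc f = idc K (t (trg A f))"
proof -
  have "Pc f = idc K (P (trg A f))"
    by (rule F.opcone_sigma(1) [OF L(2) _ f]) (simp add: f)
  then show ?thesis
    using f by (simp add: tc_def \<chi>_\<Sigma>)
qed

lemma tc_ide: "X \<in> Obj A \<Longrightarrow> tc (ide A X) = idc K (t X)"
  using pair tc_\<Sigma> [of "ide A X"] by (simp add: indexing_pair_def)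

text \<open>After precomposition with \<open>\<psi>\<close>, the cell \<open>\<chi>\<close> of the
  composite splits off a whiskering of \<open>\<phi> g\<close>. Exchanging this with
  \<open>T\<close> of \<open>Pc f\<close> brings the factors for \<open>f\<close> together, and
  those for \<open>g\<close> remain.\<close>

lemma tc_cmp:
  assumes f: "f \<in> Arr A" and g: "g \<in> Arr A" and gf: "src A g = trg A f"
  shows "tc (g \<cdot>\<^bsub>A\<^esub> f) = (idc K (arrmap F g) \<star>\<^bsub>K\<^esub> tc f) \<bullet>\<^bsub>K\<^esub> tc g"
proof (rule \<psi>_cancel' [of "trg A g"])
  let ?X = "src A f" and ?Y = "trg A f" and ?Z = "trg A g"
  note [simp] = assms
  have 1: "\<chi> (g \<cdot>\<^bsub>A\<^esub> f) = (idc K (arrmap F g) \<star>\<^bsub>K\<^esub> \<chi> f) \<bullet>\<^bsub>K\<^esub>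
      (\<phi> g \<star>\<^bsub>K\<^esub> idc K (arrmap T (arrmap F f) \<cdot>\<^bsub>K\<^esub> arrmap T (P ?X)))"
    by (simp add: \<chi>_def str_cmp)
  have 2: "(\<phi> g \<star>\<^bsub>K\<^esub> idc K (arrmap T (arrmap F f) \<cdot>\<^bsub>K\<^esub> arrmap T (P ?X))) \<bullet>\<^bsub>K\<^esub>
      (idc K (a ?Z \<cdot>\<^bsub>K\<^esub> arrmap T (arrmap F g)) \<star>\<^bsub>K\<^esub> cellmap T (Pc f)) =
      (idc K (arrmap F g \<cdot>\<^bsub>K\<^esub> a ?Y) \<star>\<^bsub>K\<^esub> cellmap T (Pc f)) \<bullet>\<^bsub>K\<^esub> (\<phi> g \<star>\<^bsub>K\<^esub> idc K (arrmap T (P ?Y)))"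
    using C.exchange [of "cellmap T (Pc f)" "\<phi> g"] by simp
  \<comment> \<open>\<open>tc_\<psi>\<close> for \<open>f\<close>, whiskered by \<open>F g\<close>,
    trades \<open>\<chi> f\<close> for \<open>tc f\<close> and releases the \<open>\<psi>\<close> at
    the middle object that \<open>\<chi> g\<close> needs.\<close>
  have 3: "(idc K (arrmap F g) \<star>\<^bsub>K\<^esub> tc f) \<bullet>\<^bsub>K\<^esub> (idc K (arrmap F g) \<star>\<^bsub>K\<^esub> \<psi> ?Y) =
      (idc K (arrmap F g) \<star>\<^bsub>K\<^esub> \<chi> f) \<bullet>\<^bsub>K\<^esub> (idc K (arrmap F g \<cdot>\<^bsub>K\<^esub> a ?Y) \<star>\<^bsub>K\<^esub> cellmap T (Pc f))"
    using arg_cong [OF tc_\<psi> [OF f], of "\<lambda>x. idc K (arrmap F g) \<star>\<^bsub>K\<^esub> x"] by simp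
  have "tc (g \<cdot>\<^bsub>A\<^esub> f) \<bullet>\<^bsub>K\<^esub> \<psi> ?Z = \<chi> (g \<cdot>\<^bsub>A\<^esub> f) \<bullet>\<^bsub>K\<^esub> (idc K (a ?Z) \<star>\<^bsub>K\<^esub> cellmap T (Pc (g \<cdot>\<^bsub>A\<^esub> f)))"
    using tc_\<psi> [of "g \<cdot>\<^bsub>A\<^esub> f"] by simp
  also have "\<dots> = (idc K (arrmap F g) \<star>\<^bsub>K\<^esub> \<chi> f) \<bullet>\<^bsub>K\<^esub>
      ((idc K (arrmap F g \<cdot>\<^bsub>K\<^esub> a ?Y) \<star>\<^bsub>K\<^esub> cellmap T (Pc f)) \<bullet>\<^bsub>K\<^esub>
       ((\<phi> g \<star>\<^bsub>K\<^esub> idc K (arrmap T (P ?Y))) \<bullet>\<^bsub>K\<^esub> (idc K (a ?Z) \<star>\<^bsub>K\<^esub> cellmap T (Pc g))))"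
    by (simp add: 1 C.vcmp_square [OF 2])
  also have "\<dots> = (idc K (arrmap F g) \<star>\<^bsub>K\<^esub> tc f) \<bullet>\<^bsub>K\<^esub>
      ((idc K (arrmap F g) \<star>\<^bsub>K\<^esub> \<psi> ?Y) \<bullet>\<^bsub>K\<^esub>
       ((\<phi> g \<star>\<^bsub>K\<^esub> idc K (arrmap T (P ?Y))) \<bullet>\<^bsub>K\<^esub> (idc K (a ?Z) \<star>\<^bsub>K\<^esub> cellmap T (Pc g))))"
    by (rule C.vcmp_square [OF 3 [symmetric]]) simp_all
  also have "\<dots> = (idc K (arrmap F g) \<star>\<^bsub>K\<^esub> tc f) \<bullet>\<^bsub>K\<^esub> (\<chi> g \<bullet>\<^bsub>K\<^esub> (idc K (a ?Z) \<star>\<^bsub>K\<^esub> cellmap T (Pc g)))"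
    by (simp add: \<chi>_def)
  also have "\<dots> = ((idc K (arrmap F g) \<star>\<^bsub>K\<^esub> tc f) \<bullet>\<^bsub>K\<^esub> tc g) \<bullet>\<^bsub>K\<^esub> \<psi> ?Z"
    by (simp add: tc_\<psi>)
  finally show "tc (g \<cdot>\<^bsub>A\<^esub> f) \<bullet>\<^bsub>K\<^esub> \<psi> ?Z = ((idc K (arrmap F g) \<star>\<^bsub>K\<^esub> tc f) \<bullet>\<^bsub>K\<^esub> tc g) \<bullet>\<^bsub>K\<^esub> \<psi> ?Z" .
qed (use assms in simp_all)

text \<open>The 2-cell \<open>F \<gamma>\<close> passes the structure 2-cells by the algebra 2-cell
  condition on \<open>Fbar \<gamma>\<close>, which is \<open>e1\<close>, and passes
  \<open>\<psi>\<close> by exchange, which is \<open>e2\<close>.\<close>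

lemma tc_cell:
  assumes \<gamma>: "\<gamma> \<in> Cell A"
  shows "tc (Cod A \<gamma>) = (cellmap F \<gamma> \<star>\<^bsub>K\<^esub> idc K (t (src A (Dom A \<gamma>)))) \<bullet>\<^bsub>K\<^esub> tc (Dom A \<gamma>)"
proof (rule \<psi>_cancel' [of "trg A (Dom A \<gamma>)"])
  let ?X = "src A (Dom A \<gamma>)" and ?Y = "trg A (Dom A \<gamma>)" and ?f = "Dom A \<gamma>" and ?g = "Cod A \<gamma>"
  note [simp] = \<gamma>
  have 1: "\<chi> ?g \<bullet>\<^bsub>K\<^esub> (idc K (a ?Y) \<star>\<^bsub>K\<^esub> (cellmap T (cellmap F \<gamma>) \<star>\<^bsub>K\<^esub> idc K (arrmap T (P ?X)))) =
    (cellmap F \<gamma> \<star>\<^bsub>K\<^esub> idc K (t ?X)) \<bullet>\<^bsub>K\<^esub> \<chi> ?f"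
  proof -
    have e1: "(\<phi> ?g \<star>\<^bsub>K\<^esub> idc K (arrmap T (P ?X))) \<bullet>\<^bsub>K\<^esub>
        (idc K (a ?Y) \<star>\<^bsub>K\<^esub> (cellmap T (cellmap F \<gamma>) \<star>\<^bsub>K\<^esub> idc K (arrmap T (P ?X)))) =
       (cellmap F \<gamma> \<star>\<^bsub>K\<^esub> idc K (a ?X \<cdot>\<^bsub>K\<^esub> arrmap T (P ?X))) \<bullet>\<^bsub>K\<^esub> (\<phi> ?f \<star>\<^bsub>K\<^esub> idc K (arrmap T (P ?X)))"
      using arg_cong [OF str_cell [OF \<gamma>], of "\<lambda>x. x \<star>\<^bsub>K\<^esub> idc K (arrmap T (P ?X))"] by simp
    have e2: "(idc K (arrmap F ?g) \<star>\<^bsub>K\<^esub> \<psi> ?X) \<bullet>\<^bsub>K\<^esub> (cellmap F \<gamma> \<star>\<^bsub>K\<^esub> idc K (a ?X \<cdot>\<^bsub>K\<^esub> arrmap T (P ?X))) =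
       (cellmap F \<gamma> \<star>\<^bsub>K\<^esub> idc K (t ?X)) \<bullet>\<^bsub>K\<^esub> (idc K (arrmap F ?f) \<star>\<^bsub>K\<^esub> \<psi> ?X)"
      using C.exchange [of "\<psi> ?X" "cellmap F \<gamma>"] by simp
    show ?thesis
      by (simp add: \<chi>_def e1 C.vcmp_square [OF e2])
  qed
  have "tc ?g \<bullet>\<^bsub>K\<^esub> \<psi> ?Y = \<chi> ?g \<bullet>\<^bsub>K\<^esub> (idc K (a ?Y) \<star>\<^bsub>K\<^esub> cellmap T (Pc ?g))"
    using tc_\<psi> [of ?g] by simp
  also have "\<dots> = (cellmap F \<gamma> \<star>\<^bsub>K\<^esub> idc K (t ?X)) \<bullet>\<^bsub>K\<^esub> (\<chi> ?f \<bullet>\<^bsub>K\<^esub> (idc K (a ?Y) \<star>\<^bsub>K\<^esub> cellmap T (Pc ?f)))"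
    by (simp add: F.opcone_cell [OF L(2)] C.vcmp_square [OF 1])
  also have "\<dots> = ((cellmap F \<gamma> \<star>\<^bsub>K\<^esub> idc K (t ?X)) \<bullet>\<^bsub>K\<^esub> tc ?f) \<bullet>\<^bsub>K\<^esub> \<psi> ?Y"
    by (simp add: tc_\<psi>)
  finally show "tc ?g \<bullet>\<^bsub>K\<^esub> \<psi> ?Y = ((cellmap F \<gamma> \<star>\<^bsub>K\<^esub> idc K (t ?X)) \<bullet>\<^bsub>K\<^esub> tc ?f) \<bullet>\<^bsub>K\<^esub> \<psi> ?Y" .
qed (use \<gamma> in simp_all)

section \<open>The opcone \<theta> and the action it induces\<close>

definition \<theta> :: "('ao, 'am, 'm, 'c) opcone" where
  "\<theta> = \<lparr>leg = (\<lambda>X\<in>Obj A. t X), legcell = (\<lambda>f\<in>Arr A. tc f)\<rparr>"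

lemma \<theta>_opcone: "\<theta> \<in> opcones A \<Sigma> K F (obmap T L)"
  unfolding F.opcones_iff \<theta>_def
  by (auto simp: tc_ide tc_cmp tc_cell tc_\<Sigma> is_identity_cell_def intro!: bexI [of _ "t _"])

definition l :: 'm where
  "l = (SOME l. l \<in> Hom K (obmap T L) L \<and> cone_comp A K \<pi> l = \<theta>)"

lemma l_spec: "l \<in> Hom K (obmap T L) L" "cone_comp A K \<pi> l = \<theta>"
proof -
  have "\<exists>l. l \<in> Hom K (obmap T L) L \<and> cone_comp A K \<pi> l = \<theta>"
    using L(3) [OF _ \<theta>_opcone] by auto
  from someI_ex [OF this, folded l_def]
  show "l \<in> Hom K (obmap T L) L" "cone_comp A K \<pi> l = \<theta>" by auto
qed

lemma l_simps [simp]: "l \<in> Arr K" "src K l = obmap T L" "trg K l = L"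
  using l_spec(1) by (auto simp: C.Hom_iff)

lemma t_eq: "X \<in> Obj A \<Longrightarrow> t X = P X \<cdot>\<^bsub>K\<^esub> l"
  using fun_cong [OF arg_cong [OF l_spec(2), of leg], of X] by (simp add: cone_comp_def \<theta>_def)

lemma tc_eq: "f \<in> Arr A \<Longrightarrow> tc f = Pc f \<star>\<^bsub>K\<^esub> idc K l"
  using fun_cong [OF arg_cong [OF l_spec(2), of legcell], of f] by (simp add: cone_comp_def \<theta>_def)


section \<open>The lifted opcone\<close>

text \<open>From here \<open>t X\<close> normalises to \<open>P X \<cdot> l\<close>; where the
  formula through the initial object is wanted, \<open>t_def\<close> is unfolded first.\<close>

declare t_eq [simp]

section \<open>The algebra axioms for the induced action\<close>

lemma P_l_A0: "X \<in> A0 \<Longrightarrow> P X \<cdot>\<^bsub>K\<^esub> l = a X \<cdot>\<^bsub>K\<^esub> arrmap T (P X)"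
  using t_A0(1) [of X] by simp

lemma T_P_l_A0:
  assumes "X \<in> A0"
  shows "arrmap T (P X) \<cdot>\<^bsub>K\<^esub> arrmap T l = arrmap T (a X) \<cdot>\<^bsub>K\<^esub> arrmap T (arrmap T (P X))"
  using arg_cong [OF P_l_A0 [OF assms], of "arrmap T"] assms by simp

text \<open>\<open>\<psi>_unit\<close> and \<open>\<psi>_mult\<close> are the axioms of the
  structure 2-cell of \<open>Fbar (f0 X)\<close>, whiskered by \<open>p X\<close>. For the
  multiplication, \<open>T_P_l_A0\<close> at the initial object rewrites the whiskering arrow to
  \<open>T (p X) \<cdot> T l\<close>.\<close>

lemma \<psi>_unit:
  assumes X: "X \<in> Obj A"
  shows "\<psi> X \<star>\<^bsub>K\<^esub> idc K (i L) = idc K (P X)"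
  using X by (simp add: \<psi>_def P_f0 [OF X])

lemma \<psi>_mult:
  assumes X: "X \<in> Obj A"
  shows "\<psi> X \<star>\<^bsub>K\<^esub> idc K (m L) = (\<psi> X \<star>\<^bsub>K\<^esub> idc K (arrmap T l)) \<bullet>\<^bsub>K\<^esub> (idc K (a X) \<star>\<^bsub>K\<^esub> cellmap T (\<psi> X))"
  using X by (simp add: \<psi>_def T_P_l_A0)

text \<open>Read through \<open>t_def\<close>, this is the unit law of the algebra at the initial
  object, composed with the initial arrow. \<open>P_l_mult\<close> is the analogue for the
  multiplication.\<close>

lemma P_l_unit:
  assumes X: "X \<in> Obj A"
  shows "P X \<cdot>\<^bsub>K\<^esub> (l \<cdot>\<^bsub>K\<^esub> i L) = P X"
proof -
  have "P X \<cdot>\<^bsub>K\<^esub> (l \<cdot>\<^bsub>K\<^esub> i L) = t X \<cdot>\<^bsub>K\<^esub> i L" using X by simp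
  also have "\<dots> = P X" unfolding t_def using X by (simp add: P_f0 [OF X])
  finally show ?thesis .
qed

lemma P_l_mult:
  assumes X: "X \<in> Obj A"
  shows "P X \<cdot>\<^bsub>K\<^esub> (l \<cdot>\<^bsub>K\<^esub> m L) = P X \<cdot>\<^bsub>K\<^esub> (l \<cdot>\<^bsub>K\<^esub> arrmap T l)"
proof -
  have "P X \<cdot>\<^bsub>K\<^esub> (l \<cdot>\<^bsub>K\<^esub> m L) = t X \<cdot>\<^bsub>K\<^esub> m L" using X by simp
  also have "\<dots> = t X \<cdot>\<^bsub>K\<^esub> arrmap T l" unfolding t_def using X by (simp add: T_P_l_A0)
  finally show ?thesis using X by simp
qed

text \<open>Besides encoding \<open>tc\<close>, this is the condition for \<open>Pc f\<close> to be
  an algebra 2-cell from the projection at \<open>trg A f\<close> to \<open>Fbar f\<close> composed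
  with the one at \<open>src A f\<close>.\<close>

lemma Pc_\<psi>:
  assumes f: "f \<in> Arr A"
  shows "(Pc f \<star>\<^bsub>K\<^esub> idc K l) \<bullet>\<^bsub>K\<^esub> \<psi> (trg A f) = \<chi> f \<bullet>\<^bsub>K\<^esub> (idc K (a (trg A f)) \<star>\<^bsub>K\<^esub> cellmap T (Pc f))"
  using tc_\<psi> [OF f] tc_eq [OF f] by simp

text \<open>Whiskering \<open>Pc_\<psi>\<close> with \<open>i L\<close> turns \<open>\<psi>\<close>
  and \<open>\<chi> f\<close> into identities, and naturality of the unit turns the last factor into
  \<open>Pc f\<close>.\<close>

lemma Pc_l_unit:
  assumes f: "f \<in> Arr A"
  shows "Pc f \<star>\<^bsub>K\<^esub> idc K (l \<cdot>\<^bsub>K\<^esub> i L) = Pc f"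
proof -
  have "((Pc f \<star>\<^bsub>K\<^esub> idc K l) \<bullet>\<^bsub>K\<^esub> \<psi> (trg A f)) \<star>\<^bsub>K\<^esub> idc K (i L) =
      (\<chi> f \<bullet>\<^bsub>K\<^esub> (idc K (a (trg A f)) \<star>\<^bsub>K\<^esub> cellmap T (Pc f))) \<star>\<^bsub>K\<^esub> idc K (i L)"
    using Pc_\<psi> [OF f] by simp
  then show ?thesis
    unfolding \<chi>_def using f by (simp add: \<psi>_unit P_l_unit)
qed

text \<open>The multiplication axiom for a composite of \<omega>-morphisms. It cannot be quoted from
  the 2-category of algebras, since \<open>L\<close> is not yet known to carry an algebra. The
  axioms of the two factors are joined by exchanging \<open>\<phi> f\<close> with \<open>T\<close>
  of \<open>\<psi>\<close>.\<close>

lemma \<chi>_mult: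
  assumes f: "f \<in> Arr A"
  shows "\<chi> f \<star>\<^bsub>K\<^esub> idc K (m L) = (\<chi> f \<star>\<^bsub>K\<^esub> idc K (arrmap T l)) \<bullet>\<^bsub>K\<^esub>
      (idc K (a (trg A f)) \<star>\<^bsub>K\<^esub> cellmap T (\<chi> f))"
proof -
  let ?X = "src A f" and ?Y = "trg A f"
  have e: "(idc K (arrmap F f \<cdot>\<^bsub>K\<^esub> a ?X) \<star>\<^bsub>K\<^esub> cellmap T (\<psi> ?X)) \<bullet>\<^bsub>K\<^esub>
      (\<phi> f \<star>\<^bsub>K\<^esub> idc K (arrmap T (a ?X) \<cdot>\<^bsub>K\<^esub> arrmap T (arrmap T (P ?X)))) =
      (\<phi> f \<star>\<^bsub>K\<^esub> idc K (arrmap T (P ?X) \<cdot>\<^bsub>K\<^esub> arrmap T l)) \<bullet>\<^bsub>K\<^esub>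
      (idc K (a ?Y \<cdot>\<^bsub>K\<^esub> arrmap T (arrmap F f)) \<star>\<^bsub>K\<^esub> cellmap T (\<psi> ?X))"
    using C.exchange [of "cellmap T (\<psi> ?X)" "\<phi> f"] f by simp
  show ?thesis
    unfolding \<chi>_def using f by (simp add: \<psi>_mult C.vcmp_square [OF e])
qed

text \<open>Precomposed with \<open>\<psi>\<close> whiskered by \<open>m L\<close>, both sides
  become the same pasting: \<open>Pc_\<psi>\<close> is used once whiskered by \<open>m L\<close>,
  once whiskered by \<open>T l\<close>, and once under \<open>T\<close>.\<close>

lemma Pc_l_mult:
  assumes f: "f \<in> Arr A"
  shows "Pc f \<star>\<^bsub>K\<^esub> idc K (l \<cdot>\<^bsub>K\<^esub> m L) = Pc f \<star>\<^bsub>K\<^esub> idc K (l \<cdot>\<^bsub>K\<^esub> arrmap T l)"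
proof (rule \<psi>_cancel [of "trg A f" "m L"])
  let ?Y = "trg A f"
  have 1: "(Pc f \<star>\<^bsub>K\<^esub> idc K (l \<cdot>\<^bsub>K\<^esub> z)) \<bullet>\<^bsub>K\<^esub> (\<psi> ?Y \<star>\<^bsub>K\<^esub> idc K z) =
      (\<chi> f \<star>\<^bsub>K\<^esub> idc K z) \<bullet>\<^bsub>K\<^esub> (idc K (a ?Y) \<star>\<^bsub>K\<^esub> (cellmap T (Pc f) \<star>\<^bsub>K\<^esub> idc K z))"
    if "z \<in> Arr K" "trg K z = obmap T L" for z
    using arg_cong [OF Pc_\<psi> [OF f], of "\<lambda>x. x \<star>\<^bsub>K\<^esub> idc K z"] that f by simp
  have 2: "(idc K (a ?Y) \<star>\<^bsub>K\<^esub> (cellmap T (Pc f) \<star>\<^bsub>K\<^esub> idc K (arrmap T l))) \<bullet>\<^bsub>K\<^esub>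
      (idc K (a ?Y) \<star>\<^bsub>K\<^esub> cellmap T (\<psi> ?Y)) =
      (idc K (a ?Y) \<star>\<^bsub>K\<^esub> cellmap T (\<chi> f)) \<bullet>\<^bsub>K\<^esub> (idc K (a ?Y \<cdot>\<^bsub>K\<^esub> arrmap T (a ?Y)) \<star>\<^bsub>K\<^esub> cellmap T (cellmap T
          (Pc f)))"
    using arg_cong [OF Pc_\<psi> [OF f], of "\<lambda>x. idc K (a ?Y) \<star>\<^bsub>K\<^esub> cellmap T x"] f by simp
  have "(Pc f \<star>\<^bsub>K\<^esub> idc K (l \<cdot>\<^bsub>K\<^esub> m L)) \<bullet>\<^bsub>K\<^esub> (\<psi> ?Y \<star>\<^bsub>K\<^esub> idc K (m L)) =
      (\<chi> f \<star>\<^bsub>K\<^esub> idc K (arrmap T l)) \<bullet>\<^bsub>K\<^esub> ((idc K (a ?Y) \<star>\<^bsub>K\<^esub> cellmap T (\<chi> f)) \<bullet>\<^bsub>K\<^esub>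
       (idc K (a ?Y \<cdot>\<^bsub>K\<^esub> arrmap T (a ?Y)) \<star>\<^bsub>K\<^esub> cellmap T (cellmap T (Pc f))))"
    using f by (simp add: 1 \<chi>_mult)
  also have "\<dots> =
      ((\<chi> f \<star>\<^bsub>K\<^esub> idc K (arrmap T l)) \<bullet>\<^bsub>K\<^esub> (idc K (a ?Y) \<star>\<^bsub>K\<^esub> (cellmap T (Pc f) \<star>\<^bsub>K\<^esub> idc K (arrmap T l))))
       \<bullet>\<^bsub>K\<^esub> (idc K (a ?Y) \<star>\<^bsub>K\<^esub> cellmap T (\<psi> ?Y))"
    using f by (simp add: 2)
  also have "\<dots> = (Pc f \<star>\<^bsub>K\<^esub> idc K (l \<cdot>\<^bsub>K\<^esub> arrmap T l)) \<bullet>\<^bsub>K\<^esub>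
      ((\<psi> ?Y \<star>\<^bsub>K\<^esub> idc K (arrmap T l)) \<bullet>\<^bsub>K\<^esub> (idc K (a ?Y) \<star>\<^bsub>K\<^esub> cellmap T (\<psi> ?Y)))"
    using 1 [of "arrmap T l", symmetric] f by simp
  also have "\<dots> = (Pc f \<star>\<^bsub>K\<^esub> idc K (l \<cdot>\<^bsub>K\<^esub> arrmap T l)) \<bullet>\<^bsub>K\<^esub> (\<psi> ?Y \<star>\<^bsub>K\<^esub> idc K (m L))"
    using f by (simp add: \<psi>_mult)
  finally show "(Pc f \<star>\<^bsub>K\<^esub> idc K (l \<cdot>\<^bsub>K\<^esub> m L)) \<bullet>\<^bsub>K\<^esub> (\<psi> ?Y \<star>\<^bsub>K\<^esub> idc K (m L)) =
      (Pc f \<star>\<^bsub>K\<^esub> idc K (l \<cdot>\<^bsub>K\<^esub> arrmap T l)) \<bullet>\<^bsub>K\<^esub> (\<psi> ?Y \<star>\<^bsub>K\<^esub> idc K (m L))" .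
qed (use f in \<open>simp_all add: P_l_mult\<close>)

text \<open>The two algebra axioms hold because both sides induce the same cone. The comparison has
  a part on legs and a part on 2-cells, hence the preceding lemmas on \<open>P\<close> and on
  \<open>Pc\<close>.\<close>

lemma l_unit: "l \<cdot>\<^bsub>K\<^esub> i L = ide K L"
proof (rule L(4) [of L])
  show "cone_comp A K \<pi> (l \<cdot>\<^bsub>K\<^esub> i L) = cone_comp A K \<pi> (ide K L)"
    by (auto simp: cone_comp_def P_l_unit Pc_l_unit intro!: restrict_ext)
qed (auto simp: C.Hom_iff)

lemma l_mult: "l \<cdot>\<^bsub>K\<^esub> m L = l \<cdot>\<^bsub>K\<^esub> arrmap T l"
proof (rule L(4) [of "obmap T (obmap T L)"])
  show "cone_comp A K \<pi> (l \<cdot>\<^bsub>K\<^esub> m L) = cone_comp A K \<pi> (l \<cdot>\<^bsub>K\<^esub> arrmap T l)"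
    by (auto simp: cone_comp_def P_l_mult Pc_l_mult intro!: restrict_ext)
qed (auto simp: C.Hom_iff)

section \<open>The limit algebra and its projections\<close>

definition Lbar :: "('o, 'm) alg" where
  "Lbar = \<lparr>carr = L, act = l\<rparr>"

lemma Lbar_sel [simp]: "carr Lbar = L" "act Lbar = l"
  by (simp_all add: Lbar_def)

lemma Lbar_algebra [simp]: "Lbar \<in> algebras K T i m"
  using l_unit l_mult by (simp add: algebras_def C.Hom_iff)

definition Pbar :: "'ao \<Rightarrow> ('o, 'm, 'c) wmor" where
  "Pbar X = \<lparr>wsrc = Lbar, wtrg = obmap Fbar X, warr = P X, wstr = \<psi> X\<rparr>"

lemma Pbar_sel [simp]: "wsrc (Pbar X) = Lbar" "wtrg (Pbar X) = obmap Fbar X" "warr (Pbar X) = P X"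
    "wstr (Pbar X) = \<psi> X"
  by (simp_all add: Pbar_def)

lemma Pbar_wmorphism [simp]: "X \<in> Obj A \<Longrightarrow> Pbar X \<in> wmorphisms K T i m \<Omega>"
  by (simp add: wmorphisms_iff \<psi>_unit \<psi>_mult)

text \<open>Allows the structure 2-cell of this composite to be treated as the single cell
  \<open>\<chi> f\<close>, for which the laws above are stated; the expansion
  \<open>wcomp_sel(4)\<close> is then switched off.\<close>

lemma wstr_Fbar_Pbar: "wstr (wcomp K T (arrmap Fbar f) (Pbar (src A f))) = \<chi> f"
  by (simp add: \<chi>_def)

text \<open>That algebras and \<omega>-morphisms form a 2-category is contained in the hypothesis
  that \<open>Fbar\<close> is a 2-functor into it; closure and associativity are taken from
  there.\<close>

lemma wcomp_closed [simp]:
  assumes "v \<in> wmorphisms K T i m \<Omega>" "w \<in> wmorphisms K T i m \<Omega>" "wsrc w = wtrg v"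
  shows "wcomp K T w v \<in> wmorphisms K T i m \<Omega>"
  using Fbar.D.cmp_simps(1) [of v w] assms by simp

lemma wcomp_assoc:
  assumes "u \<in> wmorphisms K T i m \<Omega>" "v \<in> wmorphisms K T i m \<Omega>" "w \<in> wmorphisms K T i m \<Omega>"
    "wsrc v = wtrg u" "wsrc w = wtrg v"
  shows "wcomp K T (wcomp K T w v) u = wcomp K T w (wcomp K T v u)"
  using Fbar.D.cmp_assoc' [of u v w] assms by simp

definition \<pi>bar :: "('ao, 'am, ('o, 'm, 'c) wmor, ('o, 'm, 'c) wcell) opcone" where
  "\<pi>bar = \<lparr>leg = (\<lambda>X\<in>Obj A. Pbar X),
     legcell = (\<lambda>f\<in>Arr A. \<lparr>wdom = Pbar (trg A f), wcod = wcomp K T (arrmap Fbar f) (Pbar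
         (src A f)), wund = Pc f\<rparr>)\<rparr>"

lemma \<pi>bar_opcone: "\<pi>bar \<in> opcones A \<Sigma> (TAlg K T i m \<Omega>) Fbar Lbar"
proof -
  have cell: "\<lparr>wdom = Pbar (trg A f), wcod = wcomp K T (arrmap Fbar f) (Pbar (src A f)), wund =
      Pc f\<rparr> \<in> wcells K T i m \<Omega>"
    if f: "f \<in> Arr A" for f
    using Pc_\<psi> [OF f] f wstr_Fbar_Pbar [of f] by (simp add: wcells_iff del: wcomp_sel(4))
  have comp_ide: "wcomp K T \<lparr>wsrc = obmap Fbar X, wtrg = obmap Fbar X, warr =
      ide K (obmap F X), wstr = idc K (a X)\<rparr> (Pbar X) = Pbar X"
    if "X \<in> Obj A" for X
    using Fbar.D.cmp_ide(2) [of "Pbar X" "obmap Fbar X"] that by simp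
  \<comment> \<open>Equality of \<omega>-morphisms: the underlying arrows agree since
    \<open>\<pi>\<close> is strict on \<Sigma>, the structure 2-cells by
    \<open>\<chi>_\<Sigma>\<close>.\<close>
  have comp_\<Sigma>: "wcomp K T (arrmap Fbar f) (Pbar (src A f)) = Pbar (trg A f)" if f: "f \<in> \<Sigma>" for f
    using F.opcone_sigma(2) [OF L(2) _ f] wstr_Fbar_Pbar [of f] \<chi>_\<Sigma> [OF f] f
    by (intro wmor.equality) (simp_all del: wcomp_sel(4))
  have Pc_\<Sigma>: "Pc f = idc K (P (trg A f))" if "f \<in> \<Sigma>" for f
    using F.opcone_sigma(1) [OF L(2) _ that] that by simp
  show ?thesis
    unfolding Fbar.opcones_iff \<pi>bar_def
    using F.opcone_cell [OF L(2)]
    by (auto simp: cell comp_ide wcomp_assoc comp_\<Sigma> Pc_\<Sigma> is_identity_cell_def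
        simp del: wcomp_sel(4) intro!: bexI [of _ "Pbar _"])
qed

lemma image_\<pi>bar: "image_cone A Forget \<pi>bar = \<pi>"
proof -
  have "leg \<pi> \<in> extensional (Obj A)" "legcell \<pi> \<in> extensional (Arr A)"
    using L(2) by (auto simp: F.opcones_iff)
  then show ?thesis
    by (intro opcone.equality extensionalityI [of _ "Obj A"] extensionalityI [of _ "Arr A"])
      (auto simp: image_cone_def \<pi>bar_def)
qed

section \<open>Reduction to the initial objects\<close>

lemma faithful_A0:
  assumes \<beta>: "\<beta> \<in> Cell K" "\<beta>' \<in> Cell K" "Dom K \<beta>' = Dom K \<beta>" "Cod K \<beta>' = Cod K \<beta>"
      "trg K (Dom K \<beta>) = L"
    and eq: "\<And>X. X \<in> A0 \<Longrightarrow> idc K (P X) \<star>\<^bsub>K\<^esub> \<beta> = idc K (P X) \<star>\<^bsub>K\<^esub> \<beta>'"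
  shows "\<beta> = \<beta>'"
proof (rule L(6) [of "src K (Dom K \<beta>)" "Dom K \<beta>" "Cod K \<beta>"])
  fix X assume X: "X \<in> Obj A"
  \<comment> \<open>Whiskering by \<open>P X\<close> factors through whiskering by
    \<open>p X\<close>, as \<open>P X\<close> is \<open>F (f0 X)\<close> after \<open>p X\<close>;
    the hypothesis at \<open>A0\<close> therefore suffices.\<close>
  have "idc K (arrmap F (f0 X)) \<star>\<^bsub>K\<^esub> (idc K (p X) \<star>\<^bsub>K\<^esub> \<beta>) =
      idc K (arrmap F (f0 X)) \<star>\<^bsub>K\<^esub> (idc K (p X) \<star>\<^bsub>K\<^esub> \<beta>')"
    using eq X by simp
  then show "idc K (P X) \<star>\<^bsub>K\<^esub> \<beta> = idc K (P X) \<star>\<^bsub>K\<^esub> \<beta>'"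
    using \<beta> X by (simp add: P_f0 [OF X])
qed (use \<beta> in \<open>auto simp: C.Hom_iff C.Cells_iff\<close>)

text \<open>Membership in \<open>\<Omega>'\<close> passes from the initial objects to all
  \<open>X\<close> by whiskering with the identity on \<open>F (f0 X)\<close>, which lies in
  \<open>\<Omega>'\<close>. Compatibility then applies to the opcone morphism that
  \<open>\<beta>\<close> itself induces.\<close>

lemma compatible_A0:
  assumes closed': "closed_family K \<Omega>'" and compat': "compatible A \<Sigma> K F \<Omega>' L \<pi>"
    and \<beta>: "\<beta> \<in> Cell K" "trg K (Dom K \<beta>) = L"
    and A0: "\<And>X. X \<in> A0 \<Longrightarrow> idc K (P X) \<star>\<^bsub>K\<^esub> \<beta> \<in> \<Omega>'"
  shows "\<beta> \<in> \<Omega>'"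
proof -
  let ?E = "src K (Dom K \<beta>)"
  have "idc K (P X) \<star>\<^bsub>K\<^esub> \<beta> \<in> \<Omega>'" if X: "X \<in> Obj A" for X
  proof -
    have "idc K (arrmap F (f0 X)) \<star>\<^bsub>K\<^esub> (idc K (p X) \<star>\<^bsub>K\<^esub> \<beta>) \<in> \<Omega>'"
      by (rule closed_family_simps(2) [OF closed'])
        (use X \<beta> A0 closed_family_simps(1) [OF closed'] in simp_all)
    then show ?thesis using X \<beta> by (simp add: P_f0 [OF X])
  qed
  moreover have "mormap1 (cone_comp_functor A K \<pi>) \<beta> \<in> Mor (opcone_cat A \<Sigma> K F ?E)"
    using F.cone_comp_mor [OF L(2) \<Sigma>_subset, of \<beta> ?E] \<beta> by (simp add: opcone_cat_def C.Hom_iff)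
  moreover have "\<beta> \<in> Mor (hom_cat K ?E L)"
    using \<beta> by (simp add: hom_cat_def C.Hom_iff)
  moreover have "?E \<in> Obj K" using \<beta> by simp
  ultimately show ?thesis
    using compat' unfolding compatible_def by (auto simp: cone_comp_functor_def)
qed

text \<open>The other factor of the composite structure 2-cell is a whiskering of
  \<open>\<psi> X\<close>, an identity on \<open>A0\<close>.\<close>

lemma wstr_Pbar_A0:
  assumes "X \<in> A0" "z \<in> wmorphisms K T i m \<Omega>" "wtrg z = Lbar"
  shows "wstr (wcomp K T (Pbar X) z) = idc K (P X) \<star>\<^bsub>K\<^esub> wstr z"
  \<comment> \<open>Left nesting exposes \<open>P X \<cdot> l\<close>, which \<open>P_l_A0\<close>
    rewrites.\<close>
  using wmorphism_simps [OF assms(2)] assms by (simp add: t_A0(2) P_l_A0 flip: C.cmp_assoc')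

lemma detects:
  assumes "closed_family K \<Omega>'" "compatible A \<Sigma> K F \<Omega>' L \<pi>"
  shows "jointly_detects K T i m \<Omega> \<Omega>' A0 (leg \<pi>bar) Lbar"
  unfolding jointly_detects_def
proof (intro ballI impI)
  fix Z z
  assume z: "z \<in> Hom (TAlg K T i m \<Omega>) Z Lbar"
    and A0: "\<forall>x\<in>A0. wstr (leg \<pi>bar x \<cdot>\<^bsub>TAlg K T i m \<Omega>\<^esub> z) \<in> \<Omega>'"
  have z': "z \<in> wmorphisms K T i m \<Omega>" "wtrg z = Lbar" using z by (auto simp: Fbar.D.Hom_iff)
  show "wstr z \<in> \<Omega>'"
    by (rule compatible_A0 [OF assms])
      (use A0 z' wmorphism_simps [OF z'(1)] wstr_Pbar_A0 [OF _ z']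
          in \<open>auto simp: \<pi>bar_def simp del: wcomp_sel(4)\<close>)
qed

end


section \<open>Universality of the lifted opcone\<close>

context algebra_diagram
begin

lemma image_opcone:
  assumes \<theta>: "\<theta> \<in> opcones A \<Sigma> (TAlg K T i m \<Omega>) Fbar E" and \<Sigma>: "\<Sigma> \<subseteq> Arr A"
  shows "image_cone A Forget \<theta> \<in> opcones A \<Sigma> K F (carr E)"
proof -
  have leg: "leg \<theta> X \<in> wmorphisms K T i m \<Omega>" "wsrc (leg \<theta> X) = E" "wtrg (leg \<theta> X) = obmap Fbar X"
    if "X \<in> Obj A" for X
    using Fbar.opcone_simps(1-3) [OF \<theta> that] by simp_all
  have warr: "warr (leg \<theta> X) \<in> Arr K" "src K (warr (leg \<theta> X)) = carr E"
      "trg K (warr (leg \<theta> X)) = obmap F X"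
    if "X \<in> Obj A" for X
    using wmorphism_simps [OF leg(1) [OF that]] leg [OF that] by auto
  have "legcell \<theta> f \<in> wcells K T i m \<Omega>" "wdom (legcell \<theta> f) = leg \<theta> (trg A f)"
    "wcod (legcell \<theta> f) = wcomp K T (arrmap Fbar f) (leg \<theta> (src A f))" if "f \<in> Arr A" for f
    using Fbar.opcone_simps(4-6) [OF \<theta> that] by simp_all
  then have wund: "wund (legcell \<theta> f) \<in> Cell K"
      "Dom K (wund (legcell \<theta> f)) = warr (leg \<theta> (trg A f))"
    "Cod K (wund (legcell \<theta> f)) = arrmap F f \<cdot>\<^bsub>K\<^esub> warr (leg \<theta> (src A f))" if "f \<in> Arr A" for f
    using that by (auto simp: wcells_iff)
  have "wund (legcell \<theta> f) = idc K (warr (leg \<theta> (trg A f)))" if "f \<in> \<Sigma>" for f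
    using Fbar.opcone_sigma(1) [OF \<theta> _ that] that \<Sigma> by auto
  then show ?thesis
    unfolding F.opcones_iff image_cone_def
    using Fbar.opcone_simps(7,8) [OF \<theta>] Fbar.opcone_cell [OF \<theta>] warr wund \<Sigma>
    by (auto simp: is_identity_cell_def subset_iff)
qed

end

section \<open>Existence of the induced \<omega>-morphism\<close>

context sigma_diagram
begin

context
  fixes E \<theta>'
  assumes \<theta>': "\<theta>' \<in> opcones A \<Sigma> (TAlg K T i m \<Omega>) Fbar E" and E: "E \<in> algebras K T i m"
begin

private abbreviation "q X \<equiv> leg \<theta>' X"

private lemma q [simp]:
  assumes "X \<in> Obj A"
  shows "q X \<in> wmorphisms K T i m \<Omega>" "wsrc (q X) = E" "wtrg (q X) = obmap Fbar X"
  using Fbar.opcone_simps(1-3) [OF \<theta>' assms] by simp_all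

text \<open>The underlying arrow \<open>z\<close> comes from the underlying opcone, its structure
  2-cell \<open>\<beta>\<close> from the 2-dimensional universal property applied to a family
  \<open>\<alpha>\<close>. The axioms of \<open>zbar\<close> are then inherited from the legs of
  \<open>\<theta>'\<close> at \<open>A0\<close>.\<close>

lemma lift_exists: "\<exists>zbar \<in> Hom (TAlg K T i m \<Omega>) E Lbar. cone_comp A (TAlg K T i m \<Omega>) \<pi>bar zbar =
    \<theta>'"
proof -
  note [simp] = algebra_simps [OF E]
  have wq [simp]: "warr (q X) \<in> Arr K" "src K (warr (q X)) = carr E"
      "trg K (warr (q X)) = obmap F X"
    "wstr (q X) \<in> Cell K" "Dom K (wstr (q X)) = a X \<cdot>\<^bsub>K\<^esub> arrmap T (warr (q X))"
    "Cod K (wstr (q X)) = warr (q X) \<cdot>\<^bsub>K\<^esub> act E" "wstr (q X) \<in> \<Omega>" if "X \<in> Obj A" for X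
    using wmorphism_simps [OF q(1) [OF that]] q [OF that] by simp_all
  have qc: "legcell \<theta>' f \<in> wcells K T i m \<Omega>" "wdom (legcell \<theta>' f) = q (trg A f)"
    "wcod (legcell \<theta>' f) = wcomp K T (arrmap Fbar f) (q (src A f))" if "f \<in> Arr A" for f
    using Fbar.opcone_simps(4-6) [OF \<theta>' that] by simp_all
  have "image_cone A Forget \<theta>' \<in> opcones A \<Sigma> K F (carr E)"
    by (rule image_opcone [OF \<theta>' \<Sigma>_subset])
  from L(3) [OF _ this] obtain z where z: "z \<in> Hom K (carr E) L"
      and cz: "cone_comp A K \<pi> z = image_cone A Forget \<theta>'"
    by auto
  have [simp]: "z \<in> Arr K" "src K z = carr E" "trg K z = L" using z by (auto simp: C.Hom_iff)
  have Pz: "P X \<cdot>\<^bsub>K\<^esub> z = warr (q X)" if "X \<in> Obj A" for X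
    using fun_cong [OF arg_cong [OF cz, of leg], of X] that
        by (simp add: cone_comp_def image_cone_def)
  have TPz: "arrmap T (P X) \<cdot>\<^bsub>K\<^esub> arrmap T z = arrmap T (warr (q X))" if "X \<in> Obj A" for X
    using arg_cong [OF Pz [OF that], of "arrmap T"] that by simp
  have Pcz: "Pc f \<star>\<^bsub>K\<^esub> idc K z = wund (legcell \<theta>' f)" if "f \<in> Arr A" for f
    using fun_cong [OF arg_cong [OF cz, of legcell], of f] that
        by (simp add: cone_comp_def image_cone_def)
  have wsq: "(wund (legcell \<theta>' f) \<star>\<^bsub>K\<^esub> idc K (act E)) \<bullet>\<^bsub>K\<^esub> wstr (q (trg A f)) =
      wstr (wcomp K T (arrmap Fbar f) (q (src A f))) \<bullet>\<^bsub>K\<^esub> (idc K (a (trg A f)) \<star>\<^bsub>K\<^esub> cellmap T (wund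
          (legcell \<theta>' f)))"
    if "f \<in> Arr A" for f
    using qc [OF that] that by (simp add: wcells_iff)
  \<comment> \<open>The only candidate for the whiskering of \<open>\<beta>\<close> by
    \<open>P X\<close>: at an initial object the projection is strict, so it must be the structure
    2-cell of the leg, and \<open>P X\<close> is \<open>F (f0 X)\<close> after
    \<open>p X\<close>.\<close>
  define \<alpha> where "\<alpha> X = idc K (arrmap F (f0 X)) \<star>\<^bsub>K\<^esub> wstr (q (src A (f0 X)))" for X
  have Plz: "P X \<cdot>\<^bsub>K\<^esub> (l \<cdot>\<^bsub>K\<^esub> arrmap T z) =
      arrmap F (f0 X) \<cdot>\<^bsub>K\<^esub> (a (src A (f0 X)) \<cdot>\<^bsub>K\<^esub> arrmap T (warr (q (src A
          (f0 X)))))" if X: "X \<in> Obj A" for X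
  proof -
    have "P X \<cdot>\<^bsub>K\<^esub> (l \<cdot>\<^bsub>K\<^esub> arrmap T z) = t X \<cdot>\<^bsub>K\<^esub> arrmap T z" using X by simp
    then show ?thesis unfolding t_def using X by (simp add: TPz)
  qed
  have q_f0: "warr (q X) = arrmap F (f0 X) \<cdot>\<^bsub>K\<^esub> warr (q (src A (f0 X)))" if X: "X \<in> Obj A" for X
    using X by (simp add: P_f0 [OF X] flip: Pz)
  have \<alpha>_simps [simp]: "\<alpha> X \<in> Cell K" "Dom K (\<alpha> X) = P X \<cdot>\<^bsub>K\<^esub> (l \<cdot>\<^bsub>K\<^esub> arrmap T z)"
    "Cod K (\<alpha> X) = warr (q X) \<cdot>\<^bsub>K\<^esub> act E" if X: "X \<in> Obj A" for X
    using X by (simp_all add: \<alpha>_def Plz q_f0 [OF X])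
  \<comment> \<open>Strictness of \<open>\<theta>'\<close> along \<open>f0 X\<close> holds between
    \<omega>-morphisms, so it also splits their structure 2-cells; the second factor is
    \<open>\<psi> X\<close> whiskered by \<open>T z\<close>.\<close>
  have \<alpha>\<psi>: "\<alpha> X \<bullet>\<^bsub>K\<^esub> (\<psi> X \<star>\<^bsub>K\<^esub> idc K (arrmap T z)) = wstr (q X)" if X: "X \<in> Obj A" for X
  proof -
    have "q X = wcomp K T (arrmap Fbar (f0 X)) (q (src A (f0 X)))"
      using Fbar.opcone_sigma(2) [OF \<theta>', of "f0 X"] X by simp
    then have "wstr (q X) = (idc K (arrmap F (f0 X)) \<star>\<^bsub>K\<^esub> wstr (q (src A (f0 X)))) \<bullet>\<^bsub>K\<^esub>
        (\<phi> (f0 X) \<star>\<^bsub>K\<^esub> idc K (arrmap T (warr (q (src A (f0 X))))))"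
      by (metis wcomp_sel(4) warr_Fbar)
    then show ?thesis
      using X by (simp add: \<alpha>_def \<psi>_def TPz)
  qed
  define \<mu> where "\<mu> = \<lparr>mdom = cone_comp A K \<pi> (l \<cdot>\<^bsub>K\<^esub> arrmap T z), mcod =
      cone_comp A K \<pi> (z \<cdot>\<^bsub>K\<^esub> act E),
    mcell = (\<lambda>X\<in>Obj A. \<alpha> X)\<rparr>"
  \<comment> \<open>Naturality of \<open>\<alpha>\<close>, which makes it a morphism of opcones.
    After cancelling \<open>\<psi>\<close> it becomes the algebra 2-cell condition
    \<open>wsq\<close> on the 2-cells of \<open>\<theta>'\<close>.\<close>
  have nat: "(idc K (arrmap F f) \<star>\<^bsub>K\<^esub> \<alpha> (src A f)) \<bullet>\<^bsub>K\<^esub> (Pc f \<star>\<^bsub>K\<^esub> idc K (l \<cdot>\<^bsub>K\<^esub> arrmap T z)) =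
      (Pc f \<star>\<^bsub>K\<^esub> idc K (z \<cdot>\<^bsub>K\<^esub> act E)) \<bullet>\<^bsub>K\<^esub> \<alpha> (trg A f)" if f: "f \<in> Arr A" for f
  proof (rule \<psi>_cancel [of "trg A f" "arrmap T z"])
    let ?X = "src A f" and ?Y = "trg A f"
    note [simp] = f
    have 1: "(Pc f \<star>\<^bsub>K\<^esub> idc K (l \<cdot>\<^bsub>K\<^esub> arrmap T z)) \<bullet>\<^bsub>K\<^esub> (\<psi> ?Y \<star>\<^bsub>K\<^esub> idc K (arrmap T z)) =
        (\<chi> f \<star>\<^bsub>K\<^esub> idc K (arrmap T z)) \<bullet>\<^bsub>K\<^esub> (idc K (a ?Y) \<star>\<^bsub>K\<^esub> cellmap T (wund (legcell \<theta>' f)))"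
      using arg_cong [OF Pc_\<psi> [OF f], of "\<lambda>x. x \<star>\<^bsub>K\<^esub> idc K (arrmap T z)"] by (simp flip: Pcz)
    \<comment> \<open>The \<open>\<psi>\<close> inside \<open>\<chi> f\<close> merges with
      \<open>\<alpha>\<close> into the structure 2-cell of the leg at the source, which leaves that
      of its composite with \<open>Fbar f\<close>.\<close>
    have 2: "(idc K (arrmap F f) \<star>\<^bsub>K\<^esub> \<alpha> ?X) \<bullet>\<^bsub>K\<^esub> (\<chi> f \<star>\<^bsub>K\<^esub> idc K (arrmap T z)) =
        wstr (wcomp K T (arrmap Fbar f) (q ?X))"
    proof -
      have "(idc K (arrmap F f) \<star>\<^bsub>K\<^esub> \<alpha> ?X) \<bullet>\<^bsub>K\<^esub> (\<chi> f \<star>\<^bsub>K\<^esub> idc K (arrmap T z)) =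
        (idc K (arrmap F f) \<star>\<^bsub>K\<^esub> (\<alpha> ?X \<bullet>\<^bsub>K\<^esub> (\<psi> ?X \<star>\<^bsub>K\<^esub> idc K (arrmap T z)))) \<bullet>\<^bsub>K\<^esub> (\<phi> f \<star>\<^bsub>K\<^esub> idc K (arrmap T
            (warr (q ?X))))"
        unfolding \<chi>_def by (simp add: TPz)
      then show ?thesis by (simp add: \<alpha>\<psi>)
    qed
    have 3: "(wund (legcell \<theta>' f) \<star>\<^bsub>K\<^esub> idc K (act E)) = Pc f \<star>\<^bsub>K\<^esub> idc K (z \<cdot>\<^bsub>K\<^esub> act E)"
      by (simp flip: Pcz)
    have "((idc K (arrmap F f) \<star>\<^bsub>K\<^esub> \<alpha> ?X) \<bullet>\<^bsub>K\<^esub> (Pc f \<star>\<^bsub>K\<^esub> idc K (l \<cdot>\<^bsub>K\<^esub> arrmap T z))) \<bullet>\<^bsub>K\<^esub>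
        (\<psi> ?Y \<star>\<^bsub>K\<^esub> idc K (arrmap T z)) =
      ((idc K (arrmap F f) \<star>\<^bsub>K\<^esub> \<alpha> ?X) \<bullet>\<^bsub>K\<^esub> (\<chi> f \<star>\<^bsub>K\<^esub> idc K (arrmap T z))) \<bullet>\<^bsub>K\<^esub>
        (idc K (a ?Y) \<star>\<^bsub>K\<^esub> cellmap T (wund (legcell \<theta>' f)))"
      by (simp add: 1 flip: Pcz)
    also have "\<dots> = (wund (legcell \<theta>' f) \<star>\<^bsub>K\<^esub> idc K (act E)) \<bullet>\<^bsub>K\<^esub> wstr (q ?Y)"
      unfolding 2 wsq [OF f] ..
    also have "\<dots> = ((Pc f \<star>\<^bsub>K\<^esub> idc K (z \<cdot>\<^bsub>K\<^esub> act E)) \<bullet>\<^bsub>K\<^esub> \<alpha> ?Y) \<bullet>\<^bsub>K\<^esub> (\<psi> ?Y \<star>\<^bsub>K\<^esub> idc K (arrmap T z))"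
      unfolding 3 by (simp add: \<alpha>\<psi> Pz flip: C.cmp_assoc')
    finally show "((idc K (arrmap F f) \<star>\<^bsub>K\<^esub> \<alpha> ?X) \<bullet>\<^bsub>K\<^esub> (Pc f \<star>\<^bsub>K\<^esub> idc K (l \<cdot>\<^bsub>K\<^esub> arrmap T z))) \<bullet>\<^bsub>K\<^esub>
        (\<psi> ?Y \<star>\<^bsub>K\<^esub> idc K (arrmap T z)) =
      ((Pc f \<star>\<^bsub>K\<^esub> idc K (z \<cdot>\<^bsub>K\<^esub> act E)) \<bullet>\<^bsub>K\<^esub> \<alpha> ?Y) \<bullet>\<^bsub>K\<^esub> (\<psi> ?Y \<star>\<^bsub>K\<^esub> idc K (arrmap T z))" .
  qed (use f in \<open>simp_all add: Pz flip: C.cmp_assoc'\<close>)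
  have hom: "l \<cdot>\<^bsub>K\<^esub> arrmap T z \<in> Hom K (obmap T (carr E)) L" "z \<cdot>\<^bsub>K\<^esub> act E \<in> Hom K (obmap T (carr E)) L"
    by (simp_all add: C.Hom_iff)
  have Pze: "P X \<cdot>\<^bsub>K\<^esub> (z \<cdot>\<^bsub>K\<^esub> act E) = warr (q X) \<cdot>\<^bsub>K\<^esub> act E" if "X \<in> Obj A" for X
    using that by (simp flip: Pz)
  have \<mu>: "\<mu> \<in> opcone_mors A \<Sigma> K F (obmap T (carr E))"
    unfolding F.opcone_mors_iff \<mu>_def
    using F.cone_comp_opcone [OF L(2) \<Sigma>_subset hom(1)] F.cone_comp_opcone [OF L(2) \<Sigma>_subset hom(2)]
        nat
    by (auto simp: cone_comp_def Pze)
  obtain \<beta> where \<beta>: "\<beta> \<in> Cells K (l \<cdot>\<^bsub>K\<^esub> arrmap T z) (z \<cdot>\<^bsub>K\<^esub> act E)"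
      and P\<beta>: "\<And>X. X \<in> Obj A \<Longrightarrow> idc K (P X) \<star>\<^bsub>K\<^esub> \<beta> = \<alpha> X"
    using L(5) [OF _ hom \<mu>] by (auto simp: \<mu>_def)
  have [simp]: "\<beta> \<in> Cell K" "Dom K \<beta> = l \<cdot>\<^bsub>K\<^esub> arrmap T z" "Cod K \<beta> = z \<cdot>\<^bsub>K\<^esub> act E"
    using \<beta> by (auto simp: C.Cells_iff)
  have P\<beta>_A0: "idc K (P X) \<star>\<^bsub>K\<^esub> \<beta> = wstr (q X)" if "X \<in> A0" for X
    using P\<beta> [of X] that by (simp add: \<alpha>_def)
  \<comment> \<open>At \<open>A0\<close> the composites of \<open>\<beta>\<close> with the
    projections are structure 2-cells of legs of \<open>\<theta>'\<close>, which lie in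
    \<Omega>.\<close>
  have \<beta>\<Omega>: "\<beta> \<in> \<Omega>"
    by (rule compatible_A0 [OF closed compat]) (simp_all add: P\<beta>_A0)
  have q_monad: "wstr (q X) \<star>\<^bsub>K\<^esub> idc K (i (carr E)) = idc K (warr (q X))"
    "wstr (q X) \<star>\<^bsub>K\<^esub> idc K (m (carr E)) =
       (wstr (q X) \<star>\<^bsub>K\<^esub> idc K (arrmap T (act E))) \<bullet>\<^bsub>K\<^esub> (idc K (a X) \<star>\<^bsub>K\<^esub> cellmap T (wstr
           (q X)))" if "X \<in> Obj A" for X
    using wmorphism_simps(10,11) [OF q(1) [OF that]] that by simp_all
  have P\<beta>z: "idc K (P X) \<star>\<^bsub>K\<^esub> (\<beta> \<star>\<^bsub>K\<^esub> idc K y) = wstr (q X) \<star>\<^bsub>K\<^esub> idc K y"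
    if "X \<in> A0" "y \<in> Arr K" "trg K y = obmap T (carr E)" for X y
    using that by (simp flip: P\<beta>_A0)
  have \<beta>_unit: "\<beta> \<star>\<^bsub>K\<^esub> idc K (i (carr E)) = idc K z"
  proof (rule faithful_A0)
    have "l \<cdot>\<^bsub>K\<^esub> (i L \<cdot>\<^bsub>K\<^esub> z) = z"
      using C.cmp_assoc' [of z "i L" l] l_unit by simp
    then show "Dom K (idc K z) = Dom K (\<beta> \<star>\<^bsub>K\<^esub> idc K (i (carr E)))" by simp
    show "idc K (P X) \<star>\<^bsub>K\<^esub> (\<beta> \<star>\<^bsub>K\<^esub> idc K (i (carr E))) = idc K (P X) \<star>\<^bsub>K\<^esub> idc K z" if "X \<in> A0" for X
      using that by (simp add: P\<beta>z q_monad Pz)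
  qed simp_all
  have \<beta>_mult: "\<beta> \<star>\<^bsub>K\<^esub> idc K (m (carr E)) = (\<beta> \<star>\<^bsub>K\<^esub> idc K (arrmap T (act E))) \<bullet>\<^bsub>K\<^esub>
      (idc K l \<star>\<^bsub>K\<^esub> cellmap T \<beta>)"
  proof (rule faithful_A0)
    have "l \<cdot>\<^bsub>K\<^esub> (m L \<cdot>\<^bsub>K\<^esub> arrmap T (arrmap T z)) = l \<cdot>\<^bsub>K\<^esub> (arrmap T l \<cdot>\<^bsub>K\<^esub> arrmap T (arrmap T z))"
      using C.cmp_assoc' [of "arrmap T (arrmap T z)" "m L" l] l_mult by simp
    then show "Dom K ((\<beta> \<star>\<^bsub>K\<^esub> idc K (arrmap T (act E))) \<bullet>\<^bsub>K\<^esub> (idc K l \<star>\<^bsub>K\<^esub> cellmap T \<beta>)) =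
        Dom K (\<beta> \<star>\<^bsub>K\<^esub> idc K (m (carr E)))"
      by simp
    fix X assume X: "X \<in> A0"
    \<comment> \<open>Strictness of the projection at \<open>X\<close> replaces
      \<open>P X \<cdot> l\<close> by \<open>a X \<cdot> T (P X)\<close>, so that
      \<open>T \<beta>\<close> too is seen only through \<open>P X\<close> whiskered with
      \<open>\<beta>\<close>.\<close>
    have "idc K (P X \<cdot>\<^bsub>K\<^esub> l) \<star>\<^bsub>K\<^esub> cellmap T \<beta> = idc K (a X) \<star>\<^bsub>K\<^esub> cellmap T (idc K (P X) \<star>\<^bsub>K\<^esub> \<beta>)"
      using X by (simp add: P_l_A0)
    then have "idc K (P X \<cdot>\<^bsub>K\<^esub> l) \<star>\<^bsub>K\<^esub> cellmap T \<beta> = idc K (a X) \<star>\<^bsub>K\<^esub> cellmap T (wstr (q X))"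
      using P\<beta>_A0 [OF X] by simp
    then show "idc K (P X) \<star>\<^bsub>K\<^esub> (\<beta> \<star>\<^bsub>K\<^esub> idc K (m (carr E))) =
        idc K (P X) \<star>\<^bsub>K\<^esub> ((\<beta> \<star>\<^bsub>K\<^esub> idc K (arrmap T (act E))) \<bullet>\<^bsub>K\<^esub> (idc K l \<star>\<^bsub>K\<^esub> cellmap T \<beta>))"
      using X by (simp add: P\<beta>z q_monad)
  qed simp_all
  define zbar where "zbar = \<lparr>wsrc = E, wtrg = Lbar, warr = z, wstr = \<beta>\<rparr>"
  have zbar: "zbar \<in> wmorphisms K T i m \<Omega>"
    by (simp add: zbar_def wmorphisms_iff E \<beta>\<Omega> \<beta>_unit \<beta>_mult)
  \<comment> \<open>The structure 2-cell of the composite is \<open>\<alpha> X\<close> after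
    \<open>\<psi> X\<close> whiskered by \<open>T z\<close>, which \<open>\<alpha>\<psi>\<close>
    identifies at every object and not only on \<open>A0\<close>.\<close>
  have leg: "wcomp K T (Pbar X) zbar = q X" if "X \<in> Obj A" for X
    using that by (intro wmor.equality) (simp_all add: zbar_def Pz P\<beta> \<alpha>\<psi>)
  have "hcmp (TAlg K T i m \<Omega>) (legcell \<pi>bar f) (idc (TAlg K T i m \<Omega>) zbar) = legcell \<theta>' f"
      if f: "f \<in> Arr A" for f
  proof -
    \<comment> \<open>An algebra 2-cell records its ends, so these have to be compared as
      \<omega>-morphisms besides the underlying 2-cells.\<close>
    have "wcomp K T (wcomp K T (arrmap Fbar f) (Pbar (src A f))) zbar = wcod (legcell \<theta>' f)"
      using f zbar qc [OF f] leg by (simp add: wcomp_assoc zbar_def)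
    then show ?thesis
      using f qc [OF f] leg by (intro wcell.equality) (simp_all add: \<pi>bar_def zbar_def Pcz)
  qed
  moreover have "leg \<theta>' \<in> extensional (Obj A)" "legcell \<theta>' \<in> extensional (Arr A)"
    using \<theta>' by (auto simp: Fbar.opcones_iff)
  ultimately have "cone_comp A (TAlg K T i m \<Omega>) \<pi>bar zbar = \<theta>'"
    by (intro opcone.equality extensionalityI [of _ "Obj A"] extensionalityI [of _ "Arr A"])
      (auto simp: cone_comp_def \<pi>bar_def leg)
  moreover have "zbar \<in> Hom (TAlg K T i m \<Omega>) E Lbar"
    using zbar by (simp add: Fbar.D.Hom_iff zbar_def)
  ultimately show ?thesis by blast
qed

end

text \<open>By \<open>wstr_Pbar_A0\<close>, composition with a projection at \<open>A0\<close> acts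
  on structure 2-cells as plain whiskering, and these whiskerings are jointly faithful.\<close>

lemma wstr_faithful:
  assumes z: "z \<in> wmorphisms K T i m \<Omega>" "wtrg z = Lbar"
      and z': "z' \<in> wmorphisms K T i m \<Omega>" "wtrg z' = Lbar"
    and "wsrc z = wsrc z'" "warr z = warr z'"
    and eq: "\<And>X. X \<in> A0 \<Longrightarrow> wcomp K T (Pbar X) z = wcomp K T (Pbar X) z'"
  shows "z = z'"
proof -
  have "wstr z = wstr z'"
  proof (rule faithful_A0)
    show "idc K (P X) \<star>\<^bsub>K\<^esub> wstr z = idc K (P X) \<star>\<^bsub>K\<^esub> wstr z'" if "X \<in> A0" for X
      using arg_cong [OF eq [OF that], of wstr] wstr_Pbar_A0 [OF that z] wstr_Pbar_A0 [OF that z']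
      by (simp del: wcomp_sel(4))
  qed (use assms wmorphism_simps [OF z(1)] wmorphism_simps [OF z'(1)] algebra_simps [of "wsrc z'"]
      in simp_all)
  then show ?thesis using assms by (intro wmor.equality) simp_all
qed

section \<open>Underlying cones and the 2-dimensional universal property\<close>

lemma cone_comp_\<pi>bar:
  assumes "cone_comp A (TAlg K T i m \<Omega>) \<pi>bar z = \<theta>'"
  shows "X \<in> Obj A \<Longrightarrow> leg \<theta>' X = wcomp K T (Pbar X) z"
    and "cone_comp A K \<pi> (warr z) = image_cone A Forget \<theta>'"
  using assms by (auto simp: cone_comp_def image_cone_def \<pi>bar_def intro!: restrict_ext)

lemma image_opcone_mor:
  assumes \<mu>: "\<mu> \<in> opcone_mors A \<Sigma> (TAlg K T i m \<Omega>) Fbar E"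
  shows "\<lparr>mdom = image_cone A Forget (mdom \<mu>), mcod = image_cone A Forget (mcod \<mu>),
      mcell = (\<lambda>X\<in>Obj A. wund (mcell \<mu> X))\<rparr> \<in> opcone_mors A \<Sigma> K F (carr E)"
proof -
  have cones: "mdom \<mu> \<in> opcones A \<Sigma> (TAlg K T i m \<Omega>) Fbar E"
      "mcod \<mu> \<in> opcones A \<Sigma> (TAlg K T i m \<Omega>) Fbar E"
    and cells: "\<And>X. X \<in> Obj A \<Longrightarrow> mcell \<mu> X \<in> wcells K T i m \<Omega>"
      "\<And>X. X \<in> Obj A \<Longrightarrow> wdom (mcell \<mu> X) = leg (mdom \<mu>) X"
      "\<And>X. X \<in> Obj A \<Longrightarrow> wcod (mcell \<mu> X) = leg (mcod \<mu>) X"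
    and nat: "\<And>f. f \<in> Arr A \<Longrightarrow> (idc K (arrmap F f) \<star>\<^bsub>K\<^esub> wund (mcell \<mu> (src A f))) \<bullet>\<^bsub>K\<^esub>
        wund (legcell (mdom \<mu>) f) =
        wund (legcell (mcod \<mu>) f) \<bullet>\<^bsub>K\<^esub> wund (mcell \<mu> (trg A f))"
    using \<mu> unfolding Fbar.opcone_mors_iff by auto
  have "wund (mcell \<mu> X) \<in> Cell K \<and> Dom K (wund (mcell \<mu> X)) = warr (leg (mdom \<mu>) X) \<and>
      Cod K (wund (mcell \<mu> X)) = warr (leg (mcod \<mu>) X)" if "X \<in> Obj A" for X
    using cells [OF that] by (auto simp: wcells_iff)
  then show ?thesis
    unfolding F.opcone_mors_iff
    using image_opcone [OF cones(1) \<Sigma>_subset] image_opcone [OF cones(2) \<Sigma>_subset] nat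
    by (simp add: image_cone_def)
qed

text \<open>The underlying 2-cell is supplied by the limit in \<open>K\<close>. What remains is its
  compatibility with the structure 2-cells, an equation between 2-cells into \<open>L\<close>,
  tested at \<open>A0\<close>.\<close>

lemma lift_cell_exists:
  assumes E: "E \<in> algebras K T i m"
    and z: "z \<in> Hom (TAlg K T i m \<Omega>) E Lbar" and z': "z' \<in> Hom (TAlg K T i m \<Omega>) E Lbar"
    and \<mu>: "\<mu> \<in> opcone_mors A \<Sigma> (TAlg K T i m \<Omega>) Fbar E"
      "mdom \<mu> = cone_comp A (TAlg K T i m \<Omega>) \<pi>bar z" "mcod \<mu> = cone_comp A (TAlg K T i m \<Omega>) \<pi>bar z'"
  shows "\<exists>\<beta>\<in>Cells (TAlg K T i m \<Omega>) z z'. \<forall>X\<in>Obj A.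
    hcmp (TAlg K T i m \<Omega>) (idc (TAlg K T i m \<Omega>) (leg \<pi>bar X)) \<beta> = mcell \<mu> X"
proof -
  have zw: "z \<in> wmorphisms K T i m \<Omega>" "wsrc z = E" "wtrg z = Lbar"
    and zw': "z' \<in> wmorphisms K T i m \<Omega>" "wsrc z' = E" "wtrg z' = Lbar"
    using z z' by (auto simp: Fbar.D.Hom_iff)
  note [simp] = algebra_simps [OF E] wmorphism_simps(3-8) [OF zw(1), unfolded zw Lbar_sel]
    wmorphism_simps(3-8) [OF zw'(1), unfolded zw' Lbar_sel] zw zw'
  have hom: "warr z \<in> Hom K (carr E) L" "warr z' \<in> Hom K (carr E) L" by (auto simp: C.Hom_iff)
  from L(5) [OF _ hom image_opcone_mor [OF \<mu>(1)]] cone_comp_\<pi>bar(2) [OF \<mu>(2) [symmetric]]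
    cone_comp_\<pi>bar(2) [OF \<mu>(3) [symmetric]]
  obtain \<beta> where \<beta>: "\<beta> \<in> Cells K (warr z) (warr z')"
    and P\<beta>: "\<And>X. X \<in> Obj A \<Longrightarrow> idc K (P X) \<star>\<^bsub>K\<^esub> \<beta> = wund (mcell \<mu> X)"
    by auto
  have [simp]: "\<beta> \<in> Cell K" "Dom K \<beta> = warr z" "Cod K \<beta> = warr z'"
    using \<beta> by (auto simp: C.Cells_iff)
  have cells: "mcell \<mu> X \<in> wcells K T i m \<Omega>" "wdom (mcell \<mu> X) = wcomp K T (Pbar X) z"
      "wcod (mcell \<mu> X) = wcomp K T (Pbar X) z'" if "X \<in> Obj A" for X
    using \<mu> that cone_comp_\<pi>bar(1) [OF \<mu>(2) [symmetric]] cone_comp_\<pi>bar(1) [OF \<mu>(3) [symmetric]]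
    unfolding Fbar.opcone_mors_iff by auto
  have sq: "(\<beta> \<star>\<^bsub>K\<^esub> idc K (act E)) \<bullet>\<^bsub>K\<^esub> wstr z = wstr z' \<bullet>\<^bsub>K\<^esub> (idc K l \<star>\<^bsub>K\<^esub> cellmap T \<beta>)"
  proof (rule faithful_A0)
    fix X assume X: "X \<in> A0"
    \<comment> \<open>The algebra 2-cell condition on \<open>mcell \<mu> X\<close>, in which the
      strict projection contributes only whiskering by \<open>P X\<close>.\<close>
    then have "(wund (mcell \<mu> X) \<star>\<^bsub>K\<^esub> idc K (act E)) \<bullet>\<^bsub>K\<^esub> (idc K (P X) \<star>\<^bsub>K\<^esub> wstr z) =
        (idc K (P X) \<star>\<^bsub>K\<^esub> wstr z') \<bullet>\<^bsub>K\<^esub> (idc K (a X) \<star>\<^bsub>K\<^esub> cellmap T (wund (mcell \<mu> X)))"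
      using cells [of X] wstr_Pbar_A0 [OF X zw(1,3)] wstr_Pbar_A0 [OF X zw'(1,3)]
      by (simp add: wcells_iff del: wcomp_sel(4))
    then have "(idc K (P X) \<star>\<^bsub>K\<^esub> (\<beta> \<star>\<^bsub>K\<^esub> idc K (act E))) \<bullet>\<^bsub>K\<^esub> (idc K (P X) \<star>\<^bsub>K\<^esub> wstr z) =
        (idc K (P X) \<star>\<^bsub>K\<^esub> wstr z') \<bullet>\<^bsub>K\<^esub> (idc K (a X \<cdot>\<^bsub>K\<^esub> arrmap T (P X)) \<star>\<^bsub>K\<^esub> cellmap T \<beta>)"
      using X by (simp flip: P\<beta>)
    then show "idc K (P X) \<star>\<^bsub>K\<^esub> ((\<beta> \<star>\<^bsub>K\<^esub> idc K (act E)) \<bullet>\<^bsub>K\<^esub> wstr z) =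
        idc K (P X) \<star>\<^bsub>K\<^esub> (wstr z' \<bullet>\<^bsub>K\<^esub> (idc K l \<star>\<^bsub>K\<^esub> cellmap T \<beta>))"
      using X by (simp add: P_l_A0)
  qed simp_all
  define \<beta>bar where "\<beta>bar = \<lparr>wdom = z, wcod = z', wund = \<beta>\<rparr>"
  have "\<beta>bar \<in> Cells (TAlg K T i m \<Omega>) z z'"
    by (simp add: \<beta>bar_def Fbar.D.Cells_iff wcells_iff sq)
  moreover have "hcmp (TAlg K T i m \<Omega>) (idc (TAlg K T i m \<Omega>) (leg \<pi>bar X)) \<beta>bar = mcell \<mu> X"
      if "X \<in> Obj A" for X
    using that cells [OF that] P\<beta> by (intro wcell.equality) (simp_all add: \<beta>bar_def \<pi>bar_def)
  ultimately show ?thesis by blast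
qed

lemma lifted_oplimit: "is_oplimit A \<Sigma> (TAlg K T i m \<Omega>) Fbar Lbar \<pi>bar"
proof (rule Fbar.is_oplimitI [OF \<pi>bar_opcone \<Sigma>_subset])
  fix E z z'
  assume "E \<in> Obj (TAlg K T i m \<Omega>)"
      and z: "z \<in> Hom (TAlg K T i m \<Omega>) E Lbar" "z' \<in> Hom (TAlg K T i m \<Omega>) E Lbar"
    and eq: "cone_comp A (TAlg K T i m \<Omega>) \<pi>bar z = cone_comp A (TAlg K T i m \<Omega>) \<pi>bar z'"
  then have E: "carr E \<in> Obj K" using algebra_simps(1) by simp
  have w: "z \<in> wmorphisms K T i m \<Omega>" "wsrc z = E" "wtrg z = Lbar" "z' \<in> wmorphisms K T i m \<Omega>"
      "wsrc z' = E" "wtrg z' = Lbar"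
    using z by (auto simp: Fbar.D.Hom_iff)
  \<comment> \<open>Uniqueness in two stages: the underlying arrow by the limit in \<open>K\<close>,
    then the structure 2-cell by \<open>wstr_faithful\<close>.\<close>
  have warr: "warr z = warr z'"
    by (rule L(4) [OF E])
      (use w wmorphism_simps(3-5) [OF w(1)] wmorphism_simps(3-5) [OF w(4)]
        cone_comp_\<pi>bar(2) [OF eq] cone_comp_\<pi>bar(2) [OF refl, of z'] in \<open>auto simp: C.Hom_iff\<close>)
  show "z = z'"
    by (rule wstr_faithful [OF w(1,3,4,6)])
      (use w warr cone_comp_\<pi>bar(1) [OF eq] cone_comp_\<pi>bar(1) [OF refl, of _ z'] in auto)
next
  fix E z z' \<beta> \<beta>'
  assume "E \<in> Obj (TAlg K T i m \<Omega>)"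
      and z: "z \<in> Hom (TAlg K T i m \<Omega>) E Lbar" "z' \<in> Hom (TAlg K T i m \<Omega>) E Lbar"
    and \<beta>: "\<beta> \<in> Cells (TAlg K T i m \<Omega>) z z'" "\<beta>' \<in> Cells (TAlg K T i m \<Omega>) z z'"
    and eq: "\<And>X. X \<in> Obj A \<Longrightarrow> hcmp (TAlg K T i m \<Omega>) (idc (TAlg K T i m \<Omega>) (leg \<pi>bar X)) \<beta> =
      hcmp (TAlg K T i m \<Omega>) (idc (TAlg K T i m \<Omega>) (leg \<pi>bar X)) \<beta>'"
  have "wund \<beta> = wund \<beta>'"
  proof (rule faithful_A0)
    show "idc K (P X) \<star>\<^bsub>K\<^esub> wund \<beta> = idc K (P X) \<star>\<^bsub>K\<^esub> wund \<beta>'" if "X \<in> A0" for X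
      using arg_cong [OF eq, of X wund] that by (simp add: \<pi>bar_def)
  qed (use z \<beta> wmorphism_simps(5) [of z] in \<open>auto simp: Fbar.D.Hom_iff Fbar.D.Cells_iff wcells_iff\<close>)
  then show "\<beta> = \<beta>'"
    using \<beta> by (intro wcell.equality) (simp_all add: Fbar.D.Cells_iff)
qed (use lift_exists lift_cell_exists in simp_all)

text \<open>Any limit of \<open>Fbar\<close> is isomorphic to \<open>\<pi>bar\<close>. Forgetting
  structure sends the isomorphism to one in \<open>K\<close> and \<open>\<pi>bar\<close> to the
  limit cone \<open>\<pi>\<close>, so \<open>oplimit_transport\<close> applies.\<close>

lemma preserves: "preserves_oplimits A \<Sigma> (TAlg K T i m \<Omega>) K Forget Fbar"
  unfolding preserves_oplimits_def
proof (intro allI impI)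
  fix L' \<pi>' assume lim': "is_oplimit A \<Sigma> (TAlg K T i m \<Omega>) Fbar L' \<pi>'"
  from Fbar.oplimit_unique [OF lifted_oplimit this \<Sigma>_subset]
  obtain u v where uv: "u \<in> Hom (TAlg K T i m \<Omega>) L' Lbar" "v \<in> Hom (TAlg K T i m \<Omega>) Lbar L'"
    "wcomp K T u v = ide (TAlg K T i m \<Omega>) Lbar" "wcomp K T v u = ide (TAlg K T i m \<Omega>) L'"
    and \<pi>': "cone_comp A (TAlg K T i m \<Omega>) \<pi>bar u = \<pi>'"
    by (auto simp del: TAlg_sel(8))
  have hom: "warr u \<in> Hom K (carr L') L" "warr v \<in> Hom K L (carr L')"
    using uv wmorphism_simps(3-5) [of u] wmorphism_simps(3-5) [of v]
        by (auto simp: Fbar.D.Hom_iff C.Hom_iff)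
  have "warr u \<cdot>\<^bsub>K\<^esub> warr v = ide K L" "warr v \<cdot>\<^bsub>K\<^esub> warr u = ide K (carr L')"
    using arg_cong [OF uv(3), of warr] arg_cong [OF uv(4), of warr] by simp_all
  from F.oplimit_transport [OF lim \<Sigma>_subset hom this]
  show "is_oplimit A \<Sigma> K (Forget \<circ>\<^sub>2 Fbar) (obmap Forget L') (image_cone A Forget \<pi>')"
    using cone_comp_\<pi>bar(2) [OF \<pi>'] by (simp flip: F_eq)
qed

end

theorem theorem3p3:
  fixes K :: "('o, 'm, 'c) cat2" and T :: "('o, 'm, 'c, 'o, 'm, 'c) fun2"
    and i m :: "'o \<Rightarrow> 'm" and \<Omega> :: "'c set"
    and A :: "('ao, 'am, 'ac) cat2" and \<Sigma> :: "'am set" and A0 :: "'ao set"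
    and Fbar :: "('ao, 'am, 'ac, ('o, 'm) alg, ('o, 'm, 'c) wmor, ('o, 'm, 'c) wcell) fun2"
    and F :: "('ao, 'am, 'ac, 'o, 'm, 'c) fun2"
    and L :: 'o and \<pi> :: "('ao, 'am, 'm, 'c) opcone"
  assumes "two_category K" and "two_monad K T i m" and "closed_family K \<Omega>"
    and "indexing_pair A \<Sigma>" and "PIE A \<Sigma>" and "initial_family A \<Sigma> A0"
    and "two_functor A (TAlg K T i m \<Omega>) Fbar"
    and "F = Forget \<circ>\<^sub>2 Fbar"
    and "\<forall>X\<in>Obj A. is_invertible_cell K (wstr (arrmap Fbar (initial_arr A \<Sigma> A0 X)))"
    and "is_oplimit A \<Sigma> K F L \<pi>"
    and "compatible A \<Sigma> K F \<Omega> L \<pi>"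
  shows "preserves_oplimits A \<Sigma> (TAlg K T i m \<Omega>) K Forget Fbar \<and>
    (\<exists>Lbar \<pi>bar.
       is_oplimit A \<Sigma> (TAlg K T i m \<Omega>) Fbar Lbar \<pi>bar \<and>
       obmap Forget Lbar = L \<and> image_cone A Forget \<pi>bar = \<pi> \<and>
       (\<forall>X\<in>A0. is_strict K (leg \<pi>bar X)) \<and>
       (\<forall>\<Omega>'. closed_family K \<Omega>' \<and> compatible A \<Sigma> K F \<Omega>' L \<pi> \<longrightarrow>
          jointly_detects K T i m \<Omega> \<Omega>' A0 (leg \<pi>bar) Lbar))"
proof -
  interpret two_monad K T i m by fact
  interpret Fbar: two_functor A "TAlg K T i m \<Omega>" Fbar by fact
  interpret sigma_diagram K T i m \<Omega> A Fbar F \<Sigma> A0 L \<pi>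
    by unfold_locales (use assms in simp_all)
  have "is_strict K (leg \<pi>bar X)" if "X \<in> A0" for X
    using that by (auto simp: \<pi>bar_def is_strict_def is_identity_cell_def t_A0(2) simp flip: P_l_A0)
  then show ?thesis
    using preserves lifted_oplimit image_\<pi>bar detects
    by (intro conjI exI [of _ Lbar] exI [of _ \<pi>bar]) auto
qed

end
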